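(* The Weyl tensor $W$, a section of $E^*\otimes E^*$ over $\mathscr{H}$ (where $E$ is the umbral bundle), depends only on $\mathscr{H}\subset TM'$, not on the choice of defining function $G$. In other words, the Weyl tensor is conformally invariant with respect to the class of generalized conformal transformations of $G$.
   Context: Let $M$ be a smooth manifold of dimension $n\ge 3$, and $TM'$ its tangent bundle with the zero section removed, with local coordinates $(x^i,v^i)$ induced from coordinates $x^i$ on $M$. Let $VTM'=\ker d\pi_{TM'}$ be the vertical bundle, where $\pi_{TM'}:TM'\to M$ is the projection, and $V^0TM'\subset T^*TM'$ its annihilator. Let $\lambda=dx^i\otimes\frac{\partial}{\partial v^i}$, a globally defined section of $\operatorname{End}(TTM')$ with image and kernel $VTM'$. For a function $f$ let $Df=\frac{\partial f}{\partial v^i}dx^i$. Let $\mathscr{H}\subset TM'$ be a smooth hypersurface, invariant under the scalings $(x,v)\mapsto(x,sv)$, $s>0$, projecting onto $M$ and meeting each fibre of $TM'$ in a smooth hypersurface of the fibre. A (local) defining function of $\mathscr{H}$ is a smooth function $G$ on an open scaling-invariant subset $U$ of $TM'$ such that $\mathscr{H}$ is given in $U$ by $G=0$, $DG\ne0$ throughout $U$, and $G(x,tv)=t^kG(x,v)$ for all $t>0$ with $k$ real, $k\ne1$; it is assumed that $g_{ij}=\frac{\partial^2G}{\partial v^i\partial v^j}$ is nondegenerate. A generalized conformal transformation is the passage from $G$ to $\widehat G$, where $G=\widehat G J^{-1}$ with $J$ a non-zero smooth function defined in a neighborhood of the cone $G=0$, and for $t>0$ one has $G(x,tv)=t^kG(x,v)$,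 $\widehat G(x,tv)=t^p\widehat G(x,v)$, $J(x,tv)=t^qJ(x,v)$, with $p-q=k\ne1$ and $p\ne1$. Given $G$, let $\alpha=DG$ (and $d\alpha$ is symplectic), $g_h=g_{ij}\,dx^i\otimes dx^j$, and let $g_v$ be the bilinear form on $VTM'$ with $g_v(\partial/\partial v^i,\partial/\partial v^j)=g_{ij}$. Let $V$ be the vector field with $V\lrcorner\,d\alpha=-(k-1)\,dG$ (usual interior product); in coordinates $V=v^i\frac{\partial}{\partial x^i}+u^i\frac{\partial}{\partial v^i}$ with $u^ig_{ij}=\frac{\partial G}{\partial x^j}-v^i\frac{\partial^2G}{\partial x^i\partial v^j}$; $V$ is tangent to $\mathscr{H}$. Let $P=\frac12(\operatorname{Id}+\mathscr{L}_V\lambda):TTM'\to VTM'$, where $(\mathscr{L}_V\lambda)(X)=[V,\lambda X]-\lambda[V,X]$. The tidal force tensor is the symmetric section $S$ of $V^0TM'\otimes V^0TM'$ determined by $\frac12(\mathscr{L}_V^2g_h)(X,Y)=g_v(PX,PY)+S(X,Y)$ for all $X,Y$; it satisfies $S(V,X)=0$. Let $V\mathscr{H}=T\mathscr{H}\cap VTM'$ and $\Lambda_{\mathscr{H}}=\ker(\alpha|_{T\mathscr{H}})$. The umbral bundle is the rank $n-2$ vector bundle $E$ over $\mathscr{H}$ obtained as the quotient of $\Lambda_{\mathscr{H}}$ by the kernel of $g_h|_{\Lambda_{\mathscr{H}}\times\Lambda_{\mathscr{H}}}$; this kernel is $V\mathscr{H}\oplus\operatorname{span}V$. The form $g_h$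 descends to a nondegenerate metric $g_E$ on $E$, and $S$, restricted to $\Lambda_{\mathscr{H}}\times\Lambda_{\mathscr{H}}$, descends to a section of $E^*\otimes E^*$, also denoted $S$. Let $S_E^\sharp\in\operatorname{End}(E)$ be defined by $g_E(S_E^\sharp X,Y)=S(X,Y)$ for $X,Y\in E$. The Weyl tensor $W\in\Gamma_{\mathscr{H}}(E^*\otimes E^* )$ is the trace-free part of $S$ on $E$: $$W(X,Y)=S(X,Y)-\left(\frac1{n-2}\operatorname{tr}S_E^\sharp\right)g_E(X,Y),\qquad X,Y\in E.$$
   Formalization: Literally W is not independent of G (replacing G by cG multiplies W by c); what is proved is that E and W with an index raised by g_E depend only on the hypersurface, and that W and g_E rescale by the same nonzero factor, equal to J under a generalized conformal transformation. *)

theory Defs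
  imports "HOL-Analysis.Analysis" "HOL-Library.Set_Algebras"
begin

section \<open>Smooth functions and hypersurfaces in Euclidean space\<close>

text \<open>Only used on open sets of finite-dimensional spaces, where \<open>diff_on k\<close> is class \<open>C^k\<close>:
  all iterated directional derivatives up to order \<open>k\<close> exist and are continuous.\<close>

primrec diff_on ::
  "nat \<Rightarrow> 'a::real_normed_vector set \<Rightarrow> ('a \<Rightarrow> 'b::real_normed_vector) \<Rightarrow> bool"
where
  "diff_on 0 S f \<longleftrightarrow> continuous_on S f"
| "diff_on (Suc k) S f \<longleftrightarrow>
     (\<forall>x\<in>S. f differentiable (at x)) \<and>
     (\<forall>v. diff_on k S (\<lambda>x. frechet_derivative f (at x) v))"

definition smooth_on ::
  "'a::real_normed_vector set \<Rightarrow> ('a \<Rightarrow> 'b::real_normed_vector) \<Rightarrow> bool"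
where "smooth_on S f \<longleftrightarrow> (\<forall>k. diff_on k S f)"

definition smooth_hypersurface :: "'a::euclidean_space set \<Rightarrow> bool" where
  "smooth_hypersurface S \<longleftrightarrow>
     (\<forall>z\<in>S. \<exists>Q (f :: 'a \<Rightarrow> real). open Q \<and> z \<in> Q \<and> smooth_on Q f \<and>
        (\<forall>y\<in>Q. frechet_derivative f (at y) \<noteq> (\<lambda>_. 0)) \<and>
        S \<inter> Q = {y \<in> Q. f y = 0})"

text \<open>The tangent space of a hypersurface, as the common kernel of the differentials of the smooth
  functions that vanish on it; it is determined by the set \<open>S\<close> alone.\<close>

definition tangent_space :: "'a::euclidean_space set \<Rightarrow> 'a \<Rightarrow> 'a set" where
  "tangent_space S z =
     {w. \<forall>Q (f :: 'a \<Rightarrow> real).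
           open Q \<and> z \<in> Q \<and> smooth_on Q f \<and> (\<forall>y \<in> S \<inter> Q. f y = 0) \<longrightarrow>
           frechet_derivative f (at z) w = 0}"


section \<open>Smooth manifolds and the slit tangent bundle\<close>

type_synonym ('m, 'n) chart = "'m set \<times> ('m \<Rightarrow> real ^ 'n)"

definition transition ::
  "('m, 'n::finite) chart \<Rightarrow> ('m, 'n) chart \<Rightarrow> real ^ 'n \<Rightarrow> real ^ 'n"
where "transition c d = snd d \<circ> inv_into (fst c) (snd c)"

definition manifold_carrier :: "('m, 'n) chart set \<Rightarrow> 'm set" where
  "manifold_carrier A = (\<Union>c\<in>A. fst c)"

text \<open>The manifold is the open subset of the type \<open>'m\<close> covered by the charts in the atlas.\<close>

definition smooth_atlas ::
  "('m::{t2_space, second_countable_topology}, 'n::finite) chart set \<Rightarrow> bool"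
where
  "smooth_atlas A \<longleftrightarrow>
     (\<forall>c\<in>A. open (fst c) \<and> open (snd c ` fst c) \<and>
        (\<exists>\<psi>. homeomorphism (fst c) (snd c ` fst c) (snd c) \<psi>)) \<and>
     (\<forall>c\<in>A. \<forall>d\<in>A. smooth_on (snd c ` (fst c \<inter> fst d)) (transition c d))"

text \<open>A tangent vector at \<open>p\<close> is the family of its component vectors in all charts around \<open>p\<close>,
  related by the Jacobians of the transition maps (and \<open>0\<close> at charts not around \<open>p\<close>).\<close>

type_synonym ('m, 'n) tpoint = "'m \<times> (('m, 'n) chart \<Rightarrow> real ^ 'n)"

definition tangent_vectors ::
  "('m, 'n::finite) chart set \<Rightarrow> 'm \<Rightarrow> (('m, 'n) chart \<Rightarrow> real ^ 'n) set"
where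
  "tangent_vectors A p =
     {\<xi>. (\<forall>c\<in>A. \<forall>d\<in>A. p \<in> fst c \<inter> fst d \<longrightarrow>
            \<xi> d = frechet_derivative (transition c d) (at (snd c p)) (\<xi> c)) \<and>
         (\<forall>c. \<not> (c \<in> A \<and> p \<in> fst c) \<longrightarrow> \<xi> c = 0)}"

definition slit_tangent_bundle :: "('m, 'n::finite) chart set \<Rightarrow> ('m, 'n) tpoint set" where
  "slit_tangent_bundle A =
     {(p, \<xi>). p \<in> manifold_carrier A \<and> \<xi> \<in> tangent_vectors A p \<and> \<xi> \<noteq> (\<lambda>_. 0)}"

definition fibre_scale :: "real \<Rightarrow> ('m, 'n::finite) tpoint \<Rightarrow> ('m, 'n) tpoint" where
  "fibre_scale s z = (fst z, \<lambda>c. s *\<^sub>R snd z c)"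

text \<open>\<open>tchart c\<close> is the chart \<open>(x, v)\<close> of the slit tangent bundle induced by the chart \<open>c\<close>;
  \<open>coord_rep A c f\<close> is the function \<open>f\<close> written in it. Values of \<open>coord_rep\<close> outside the
  image of \<open>tchart c\<close> are meaningless and never used.\<close>

definition tdom ::
  "('m, 'n::finite) chart set \<Rightarrow> ('m, 'n) chart \<Rightarrow> ('m, 'n) tpoint set"
where "tdom A c = {z \<in> slit_tangent_bundle A. fst z \<in> fst c}"

definition tchart ::
  "('m, 'n::finite) chart \<Rightarrow> ('m, 'n) tpoint \<Rightarrow> (real ^ 'n) \<times> (real ^ 'n)"
where "tchart c z = (snd c (fst z), snd z c)"

definition coord_rep ::
  "('m, 'n::finite) chart set \<Rightarrow> ('m, 'n) chart \<Rightarrow> (('m, 'n) tpoint \<Rightarrow> real) \<Rightarrow>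
   (real ^ 'n) \<times> (real ^ 'n) \<Rightarrow> real"
where "coord_rep A c f = f \<circ> inv_into (tdom A c) (tchart c)"

definition coord_set ::
  "('m, 'n::finite) chart set \<Rightarrow> ('m, 'n) chart \<Rightarrow> ('m, 'n) tpoint set \<Rightarrow>
   ((real ^ 'n) \<times> (real ^ 'n)) set"
where "coord_set A c U = tchart c ` (U \<inter> tdom A c)"

definition tm_open ::
  "('m, 'n::finite) chart set \<Rightarrow> ('m, 'n) tpoint set \<Rightarrow> bool"
where
  "tm_open A U \<longleftrightarrow> U \<subseteq> slit_tangent_bundle A \<and> (\<forall>c\<in>A. open (coord_set A c U))"

definition tm_smooth_on ::
  "('m, 'n::finite) chart set \<Rightarrow> ('m, 'n) tpoint set \<Rightarrow> (('m, 'n) tpoint \<Rightarrow> real) \<Rightarrow> bool"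
where
  "tm_smooth_on A U f \<longleftrightarrow> (\<forall>c\<in>A. smooth_on (coord_set A c U) (coord_rep A c f))"

definition scale_invariant :: "('m, 'n::finite) tpoint set \<Rightarrow> bool" where
  "scale_invariant U \<longleftrightarrow> (\<forall>z\<in>U. \<forall>s>0. fibre_scale s z \<in> U)"

definition homogeneous_on ::
  "('m, 'n::finite) tpoint set \<Rightarrow> real \<Rightarrow> (('m, 'n) tpoint \<Rightarrow> real) \<Rightarrow> bool"
where
  "homogeneous_on U k f \<longleftrightarrow> (\<forall>z\<in>U. \<forall>t>0. f (fibre_scale t z) = t powr k * f z)"

definition conic_hypersurface ::
  "('m, 'n::finite) chart set \<Rightarrow> ('m, 'n) tpoint set \<Rightarrow> bool"
where
  "conic_hypersurface A H \<longleftrightarrow>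
     H \<subseteq> slit_tangent_bundle A \<and>
     (\<forall>c\<in>A. smooth_hypersurface (coord_set A c H)) \<and>
     scale_invariant H \<and>
     fst ` H = manifold_carrier A \<and>
     (\<forall>c\<in>A. \<forall>p \<in> fst c. smooth_hypersurface {v. (snd c p, v) \<in> coord_set A c H})"


section \<open>Tensors attached to a function of the coordinates \<open>(x, v)\<close>\<close>

text \<open>From here on, points and tangent vectors of the slit tangent bundle are written in an induced
  chart: a point is \<open>(x, v)\<close>, and a tangent vector \<open>(a, b)\<close> stands for
  \<open>a^i \<partial>/\<partial>x^i + b^i \<partial>/\<partial>v^i\<close>. Tensor fields are functions of the point and of vector arguments.\<close>

type_synonym 'n vec2 = "(real ^ 'n) \<times> (real ^ 'n)"

definition dv :: "('n::finite vec2 \<Rightarrow> real) \<Rightarrow> 'n vec2 \<Rightarrow> 'n \<Rightarrow> real" where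
  "dv G z i = frechet_derivative G (at z) (0, axis i 1)"

definition vhess :: "('n::finite vec2 \<Rightarrow> real) \<Rightarrow> 'n vec2 \<Rightarrow> real ^ 'n ^ 'n" where
  "vhess G z = (\<chi> i j. dv (\<lambda>w. dv G w j) z i)"

definition alpha :: "('n::finite vec2 \<Rightarrow> real) \<Rightarrow> 'n vec2 \<Rightarrow> 'n vec2 \<Rightarrow> real" where
  "alpha G z X = (\<Sum>i\<in>UNIV. dv G z i * fst X $ i)"

definition g_h :: "('n::finite vec2 \<Rightarrow> real) \<Rightarrow> 'n vec2 \<Rightarrow> 'n vec2 \<Rightarrow> 'n vec2 \<Rightarrow> real" where
  "g_h G z X Y = (\<Sum>i\<in>UNIV. \<Sum>j\<in>UNIV. vhess G z $ i $ j * fst X $ i * fst Y $ j)"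

text \<open>Meant for vertical \<open>X\<close> and \<open>Y\<close>, i.e. \<open>fst X = fst Y = 0\<close>.\<close>

definition g_v :: "('n::finite vec2 \<Rightarrow> real) \<Rightarrow> 'n vec2 \<Rightarrow> 'n vec2 \<Rightarrow> 'n vec2 \<Rightarrow> real" where
  "g_v G z X Y = (\<Sum>i\<in>UNIV. \<Sum>j\<in>UNIV. vhess G z $ i $ j * snd X $ i * snd Y $ j)"

text \<open>Exterior and Lie derivatives, by the invariant formulas with the constant vector fields
  \<open>X\<close>, \<open>Y\<close> as arguments; so \<open>[X, Y] = 0\<close> in the first.\<close>

definition ext_deriv ::
  "('a::real_normed_vector \<Rightarrow> 'a \<Rightarrow> real) \<Rightarrow> 'a \<Rightarrow> 'a \<Rightarrow> 'a \<Rightarrow> real"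
where
  "ext_deriv \<theta> z X Y =
     frechet_derivative (\<lambda>w. \<theta> w Y) (at z) X - frechet_derivative (\<lambda>w. \<theta> w X) (at z) Y"

definition lie_bracket ::
  "('a::real_normed_vector \<Rightarrow> 'a) \<Rightarrow> ('a \<Rightarrow> 'a) \<Rightarrow> 'a \<Rightarrow> 'a"
where
  "lie_bracket X Y z = frechet_derivative Y (at z) (X z) - frechet_derivative X (at z) (Y z)"

definition lie_form ::
  "('a::real_normed_vector \<Rightarrow> 'a) \<Rightarrow> ('a \<Rightarrow> 'a \<Rightarrow> 'a \<Rightarrow> real) \<Rightarrow> 'a \<Rightarrow> 'a \<Rightarrow> 'a \<Rightarrow> real"
where
  "lie_form V h z X Y =
     frechet_derivative (\<lambda>w. h w X Y) (at z) (V z)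
     - h z (lie_bracket V (\<lambda>_. X) z) Y - h z X (lie_bracket V (\<lambda>_. Y) z)"

definition lie_endo ::
  "('a::real_normed_vector \<Rightarrow> 'a) \<Rightarrow> ('a \<Rightarrow> 'a \<Rightarrow> 'a) \<Rightarrow> 'a \<Rightarrow> 'a \<Rightarrow> 'a"
where
  "lie_endo V L z X = lie_bracket V (\<lambda>w. L w X) z - L z (lie_bracket V (\<lambda>_. X) z)"

definition lam :: "'n::finite vec2 \<Rightarrow> 'n vec2 \<Rightarrow> 'n vec2" where
  "lam z X = (0, fst X)"

text \<open>The vector field with \<open>V \<rfloor> d\<alpha> = -(k - 1) dG\<close>.\<close>

definition spray :: "real \<Rightarrow> ('n::finite vec2 \<Rightarrow> real) \<Rightarrow> 'n vec2 \<Rightarrow> 'n vec2" where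
  "spray k G z =
     (THE w. \<forall>Y. ext_deriv (alpha G) z w Y = - (k - 1) * frechet_derivative G (at z) Y)"

definition P_endo :: "real \<Rightarrow> ('n::finite vec2 \<Rightarrow> real) \<Rightarrow> 'n vec2 \<Rightarrow> 'n vec2 \<Rightarrow> 'n vec2" where
  "P_endo k G z X = (1/2) *\<^sub>R (X + lie_endo (spray k G) lam z X)"

definition tidal ::
  "real \<Rightarrow> ('n::finite vec2 \<Rightarrow> real) \<Rightarrow> 'n vec2 \<Rightarrow> 'n vec2 \<Rightarrow> 'n vec2 \<Rightarrow> real"
where
  "tidal k G z X Y =
     (1/2) * lie_form (spray k G) (lie_form (spray k G) (g_h G)) z X Y
     - g_v G z (P_endo k G z X) (P_endo k G z Y)"


section \<open>Quotients of vector spaces\<close>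

text \<open>For subspaces \<open>K \<subseteq> L\<close>, the quotient \<open>L / K\<close> is the set of cosets \<open>X +o K\<close>. A basis of it is
  given by a finite set of representatives.\<close>

definition quot :: "'a::real_vector set \<Rightarrow> 'a set \<Rightarrow> 'a set set" where
  "quot L K = (\<lambda>X. X +o K) ` L"

definition coset_coords ::
  "'a::real_vector set \<Rightarrow> 'a set \<Rightarrow> 'a set \<Rightarrow> ('a \<Rightarrow> real) \<Rightarrow> bool"
where
  "coset_coords K B C c \<longleftrightarrow> (\<forall>b. b \<notin> B \<longrightarrow> c b = 0) \<and> C = (\<Sum>b\<in>B. c b *\<^sub>R b) +o K"

definition quot_basis :: "'a::real_vector set \<Rightarrow> 'a set \<Rightarrow> 'a set \<Rightarrow> bool" where
  "quot_basis L K B \<longleftrightarrow> finite B \<and> B \<subseteq> L \<and> (\<forall>C \<in> quot L K. \<exists>!c. coset_coords K B C c)"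

text \<open>The trace of an endomorphism does not depend on the basis, so any basis may be chosen.\<close>

definition quot_trace :: "'a::real_vector set \<Rightarrow> 'a set \<Rightarrow> ('a set \<Rightarrow> 'a set) \<Rightarrow> real" where
  "quot_trace L K T =
     (let B = (SOME B. quot_basis L K B)
      in \<Sum>b\<in>B. (THE c. coset_coords K B (T (b +o K)) c) b)"

definition descend :: "('a \<Rightarrow> 'a \<Rightarrow> real) \<Rightarrow> 'a set \<Rightarrow> 'a set \<Rightarrow> real" where
  "descend h C D = (THE r. \<forall>X\<in>C. \<forall>Y\<in>D. h X Y = r)"

text \<open>The endomorphism \<open>T\<close> of \<open>E\<close> with \<open>g (T C) D = h C D\<close>.\<close>

definition raise ::
  "'e set \<Rightarrow> ('e \<Rightarrow> 'e \<Rightarrow> real) \<Rightarrow> ('e \<Rightarrow> 'e \<Rightarrow> real) \<Rightarrow> 'e \<Rightarrow> 'e"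
where
  "raise E g h C = (THE C'. C' \<in> E \<and> (\<forall>D\<in>E. g C' D = h C D))"


section \<open>Umbral bundle and Weyl tensor\<close>

text \<open>\<open>S\<close> is the hypersurface and \<open>z\<close> a point of it, both in an induced chart.\<close>

definition Lam ::
  "'n::finite vec2 set \<Rightarrow> ('n vec2 \<Rightarrow> real) \<Rightarrow> 'n vec2 \<Rightarrow> 'n vec2 set"
where
  "Lam S G z = {X \<in> tangent_space S z. alpha G z X = 0}"

definition umbral_ker ::
  "'n::finite vec2 set \<Rightarrow> ('n vec2 \<Rightarrow> real) \<Rightarrow> 'n vec2 \<Rightarrow> 'n vec2 set"
where
  "umbral_ker S G z = {X \<in> Lam S G z. \<forall>Y \<in> Lam S G z. g_h G z X Y = 0}"

definition umbral ::
  "'n::finite vec2 set \<Rightarrow> ('n vec2 \<Rightarrow> real) \<Rightarrow> 'n vec2 \<Rightarrow> 'n vec2 set set"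
where
  "umbral S G z = quot (Lam S G z) (umbral_ker S G z)"

definition g_E ::
  "('n::finite vec2 \<Rightarrow> real) \<Rightarrow> 'n vec2 \<Rightarrow> 'n vec2 set \<Rightarrow> 'n vec2 set \<Rightarrow> real"
where "g_E G z = descend (g_h G z)"

definition S_E ::
  "real \<Rightarrow> ('n::finite vec2 \<Rightarrow> real) \<Rightarrow> 'n vec2 \<Rightarrow> 'n vec2 set \<Rightarrow> 'n vec2 set \<Rightarrow> real"
where "S_E k G z = descend (tidal k G z)"

definition S_sharp ::
  "'n::finite vec2 set \<Rightarrow> real \<Rightarrow> ('n vec2 \<Rightarrow> real) \<Rightarrow> 'n vec2 \<Rightarrow> 'n vec2 set \<Rightarrow> 'n vec2 set"
where "S_sharp S k G z = raise (umbral S G z) (g_E G z) (S_E k G z)"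

definition weyl ::
  "'n::finite vec2 set \<Rightarrow> real \<Rightarrow> ('n vec2 \<Rightarrow> real) \<Rightarrow> 'n vec2 \<Rightarrow>
   'n vec2 set \<Rightarrow> 'n vec2 set \<Rightarrow> real"
where
  "weyl S k G z C D =
     S_E k G z C D
     - (1 / (real CARD('n) - 2) *
        quot_trace (Lam S G z) (umbral_ker S G z) (S_sharp S k G z)) * g_E G z C D"

text \<open>The Weyl tensor with one index raised by \<open>g_E\<close>. If \<open>G\<close> is multiplied by a constant, then
  \<open>weyl\<close> and \<open>g_E\<close> are multiplied by that constant, while \<open>weyl_sharp\<close> does not change.\<close>

definition weyl_sharp ::
  "'n::finite vec2 set \<Rightarrow> real \<Rightarrow> ('n vec2 \<Rightarrow> real) \<Rightarrow> 'n vec2 \<Rightarrow> 'n vec2 set \<Rightarrow> 'n vec2 set"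
where "weyl_sharp S k G z = raise (umbral S G z) (g_E G z) (weyl S k G z)"


section \<open>Defining functions and generalized conformal transformations\<close>

definition defining_function ::
  "('m, 'n::finite) chart set \<Rightarrow> ('m, 'n) tpoint set \<Rightarrow> ('m, 'n) tpoint set \<Rightarrow> real \<Rightarrow>
   (('m, 'n) tpoint \<Rightarrow> real) \<Rightarrow> bool"
where
  "defining_function A H U k G \<longleftrightarrow>
     tm_open A U \<and> scale_invariant U \<and> tm_smooth_on A U G \<and>
     H \<inter> U = {z \<in> U. G z = 0} \<and>
     homogeneous_on U k G \<and> k \<noteq> 1 \<and>
     (\<forall>c\<in>A. \<forall>w \<in> coord_set A c U.
        (\<exists>i. dv (coord_rep A c G) w i \<noteq> 0) \<and> invertible (vhess (coord_rep A c G) w))"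

text \<open>\<open>Q\<close> is the neighborhood of the cone \<open>G = 0\<close> on which \<open>J\<close> is given.\<close>

definition generalized_conformal ::
  "('m, 'n::finite) chart set \<Rightarrow>
   ('m, 'n) tpoint set \<Rightarrow> real \<Rightarrow> (('m, 'n) tpoint \<Rightarrow> real) \<Rightarrow>
   ('m, 'n) tpoint set \<Rightarrow> real \<Rightarrow> (('m, 'n) tpoint \<Rightarrow> real) \<Rightarrow>
   ('m, 'n) tpoint set \<Rightarrow> real \<Rightarrow> (('m, 'n) tpoint \<Rightarrow> real) \<Rightarrow> bool"
where
  "generalized_conformal A U k G U' p G' Q q J \<longleftrightarrow>
     tm_open A Q \<and> scale_invariant Q \<and> {z \<in> U \<inter> U'. G z = 0} \<subseteq> Q \<and> Q \<subseteq> U \<inter> U' \<and>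
     tm_smooth_on A Q J \<and> (\<forall>z\<in>Q. J z \<noteq> 0) \<and>
     (\<forall>z\<in>Q. G z = G' z * inverse (J z)) \<and>
     homogeneous_on Q k G \<and> homogeneous_on Q p G' \<and> homogeneous_on Q q J \<and>
     p - q = k \<and> k \<noteq> 1 \<and> p \<noteq> 1"

end

theory Submission
  imports Defs
begin

text \<open>
  In an induced chart write \<open>V = (v, u)\<close> for the spray of \<open>G\<close>. Its defining equation is
  \<open>V(\<partial>G/\<partial>v) = \<partial>G/\<partial>x\<close>, and differentiating it shows that the tidal tensor depends only on the
  horizontal parts of its arguments and annihilates \<open>V\<close>.

  Let \<open>G'\<close> have the same zero set. Functions that agree on the zero set have the same derivatives
  along it. Hence there \<open>dG' = J dG\<close>, the Hessians satisfy
  \<open>Hess G' = J Hess G + \<theta> \<otimes> dG + dG \<otimes> \<theta>\<close> for a one-form \<open>\<theta>\<close>, and the spray of \<open>G'\<close> is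
  \<open>V' = V + f L\<close> with \<open>L\<close> the radial field. No division \<open>J = G'/G\<close> off the zero set is needed,
  because only derivatives along \<open>V'\<close> and along vectors tangent to the zero set enter. Inserting these
  relations, all terms containing \<open>\<theta>\<close> cancel and the tidal tensor becomes \<open>J S + c g\<close> on the kernel of
  \<open>\<alpha>\<close>, with \<open>c\<close> independent of the arguments. The trace-free part therefore scales by \<open>J\<close>.
\<close>

section \<open>Calculus of smooth functions\<close>

text \<open>The obstacle is that the tidal tensor contains second derivatives along the spray, while
  the relations between \<open>G\<close> and \<open>G'\<close> hold only on the zero set and may be
  differentiated only in tangential directions. The second spray is tangential, but a horizontal
  vector \<open>(a, 0)\<close> in general is not. So the tensors are compared on vectors of the
  kernel of \<open>alpha\<close> with their vertical parts retained, although these do not affect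
  the value. A fixed vertical direction \<open>e\<close> transverse to the zero set serves
  throughout: it presents \<open>J\<close> as a quotient of derivatives, corrects vectors to
  tangential ones, and reads off coefficients of \<open>dG\<close>. Adding a multiple of the radial
  field to a spray reparametrizes its base curves. Accordingly the constant \<open>c\<close> is
  \<open>- J / 2\<close> times \<open>V' f - f^2 / 2\<close>, the expression of a Schwarzian
  derivative. Since \<open>weyl\<close> and \<open>g_E\<close> acquire the same factor, raising an
  index removes it; this is the exact invariance stated for \<open>weyl_sharp\<close>.\<close>

abbreviation D :: "('a::real_normed_vector \<Rightarrow> 'b::real_normed_vector) \<Rightarrow> 'a \<Rightarrow> 'a \<Rightarrow> 'b" where
  "D f z \<equiv> frechet_derivative f (at z)"

lemma D_eqI: "(f has_derivative f') (at z) \<Longrightarrow> D f z X = f' X"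
  using frechet_derivative_at by metis

lemma D_cong_open:
  assumes "open S" "z \<in> S" "\<And>y. y \<in> S \<Longrightarrow> f y = g y"
  shows "D f z = D g z"
proof -
  have "(f has_derivative f') (at z) \<longleftrightarrow> (g has_derivative f') (at z)" for f'
    using assms has_derivative_transform_within_open[of f f' z UNIV S g]
      has_derivative_transform_within_open[of g f' z UNIV S f] by auto
  then show ?thesis unfolding frechet_derivative_def by simp
qed

lemma differentiable_cong_open:
  assumes "open S" "z \<in> S" "\<And>y. y \<in> S \<Longrightarrow> f y = g y" "f differentiable (at z)"
  shows "g differentiable (at z)"
  using assms has_derivative_transform_within_open unfolding differentiable_def by blast

lemma diff_on_cong:
  assumes "open S" "\<And>y. y \<in> S \<Longrightarrow> f y = g y" "diff_on k S f"
  shows "diff_on k S g"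
  using assms(2,3)
proof (induction k arbitrary: f g)
  case 0
  then show ?case by (simp cong: continuous_on_cong)
next
  case (Suc k)
  have "D f x = D g x" if "x \<in> S" for x
    using D_cong_open[OF assms(1) that] Suc.prems(1) by blast
  moreover have "\<forall>x\<in>S. g differentiable (at x)"
    using Suc.prems differentiable_cong_open[OF assms(1)] by (metis diff_on.simps(2))
  ultimately show ?case using Suc.IH[of "\<lambda>x. D f x _" "\<lambda>x. D g x _"] Suc.prems(2)
    by auto
qed

lemma smooth_on_cong:
  assumes "open S" "\<And>y. y \<in> S \<Longrightarrow> f y = g y" "smooth_on S f"
  shows "smooth_on S g"
  using assms diff_on_cong unfolding smooth_on_def by blast

lemma diff_on_subset: "diff_on k S f \<Longrightarrow> T \<subseteq> S \<Longrightarrow> diff_on k T f"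
  by (induction k arbitrary: f) (auto intro: continuous_on_subset)

lemma smooth_on_subset: "smooth_on S f \<Longrightarrow> T \<subseteq> S \<Longrightarrow> smooth_on T f"
  unfolding smooth_on_def using diff_on_subset by blast

lemma smooth_on_differentiable: "smooth_on S f \<Longrightarrow> x \<in> S \<Longrightarrow> f differentiable (at x)"
  unfolding smooth_on_def by (metis diff_on.simps(2))

lemma smooth_on_has_derivative: "smooth_on S f \<Longrightarrow> x \<in> S \<Longrightarrow> (f has_derivative D f x) (at x)"
  using smooth_on_differentiable frechet_derivative_works by blast

lemma smooth_on_linear_D: "smooth_on S f \<Longrightarrow> x \<in> S \<Longrightarrow> linear (D f x)"
  using smooth_on_differentiable linear_frechet_derivative by blast

lemma smooth_on_continuous: "smooth_on S f \<Longrightarrow> continuous_on S f"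
  unfolding smooth_on_def by (metis diff_on.simps(1))

lemma smooth_on_D: "smooth_on S f \<Longrightarrow> smooth_on S (\<lambda>x. D f x X)"
  unfolding smooth_on_def by (metis diff_on.simps(2))

lemma diff_on_pred: "diff_on (Suc k) S f \<Longrightarrow> diff_on k S f"
proof (induction k arbitrary: f)
  case 0
  then show ?case
    by (auto intro!: continuous_at_imp_continuous_on differentiable_imp_continuous_within)
qed simp

lemma diff_on_has_derivative:
  "diff_on (Suc k) S f \<Longrightarrow> x \<in> S \<Longrightarrow> (f has_derivative D f x) (at x)"
  using frechet_derivative_works by auto

section \<open>Closure of \<open>C^k\<close> and smooth functions under algebraic operations\<close>

lemma diff_on_const [simp]: "diff_on k S (\<lambda>x. c)"
  by (induction k arbitrary: c) auto

lemma diff_on_bounded_linear_comp: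
  assumes L: "bounded_linear L" and "open S" and "diff_on k S f"
  shows "diff_on k S (\<lambda>x. L (f x))"
  using assms(3)
proof (induction k arbitrary: f)
  case 0
  then show ?case using L bounded_linear.continuous_on by auto
next
  case (Suc k)
  have *: "((\<lambda>x. L (f x)) has_derivative (\<lambda>X. L (D f x X))) (at x)" if "x \<in> S" for x
    using that by (intro bounded_linear.has_derivative[OF L] diff_on_has_derivative[OF Suc.prems])
  have "diff_on k S (\<lambda>x. L (D f x v))" for v
    using Suc by auto
  then have "diff_on k S (\<lambda>x. D (\<lambda>x. L (f x)) x v)" for v
    by (rule diff_on_cong[OF assms(2), rotated]) (use D_eqI[OF *] in auto)
  then show ?case using * by (auto simp: differentiable_def)
qed

lemma diff_on_add:
  assumes "open S" and "diff_on k S f" and "diff_on k S g"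
  shows "diff_on k S (\<lambda>x. f x + g x)"
  using assms(2,3)
proof (induction k arbitrary: f g)
  case 0
  then show ?case by (auto intro: continuous_intros)
next
  case (Suc k)
  have *: "((\<lambda>x. f x + g x) has_derivative (\<lambda>X. D f x X + D g x X)) (at x)" if "x \<in> S" for x
    using that by (intro has_derivative_add diff_on_has_derivative[OF Suc.prems(1)]
        diff_on_has_derivative[OF Suc.prems(2)])
  have "diff_on k S (\<lambda>x. D f x v + D g x v)" for v
    using Suc by auto
  then have "diff_on k S (\<lambda>x. D (\<lambda>x. f x + g x) x v)" for v
    by (rule diff_on_cong[OF assms(1), rotated]) (use D_eqI[OF *] in auto)
  then show ?case using * by (auto simp: differentiable_def)
qed

text \<open>Each term of the Leibniz rule keeps one undifferentiated factor; that factor, of class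
  \<open>k + 1\<close>, is lowered to class \<open>k\<close> before the induction hypothesis
  applies.\<close>

lemma diff_on_bilinear:
  assumes B: "bounded_bilinear B" and "open S" and "diff_on k S f" and "diff_on k S g"
  shows "diff_on k S (\<lambda>x. B (f x) (g x))"
  using assms(3,4)
proof (induction k arbitrary: f g)
  case 0
  then show ?case using B by (auto intro: bounded_bilinear.continuous_on)
next
  case (Suc k)
  have *: "((\<lambda>x. B (f x) (g x)) has_derivative (\<lambda>X. B (f x) (D g x X) + B (D f x X) (g x))) (at x)"
    if "x \<in> S" for x
    using that by (intro bounded_bilinear.FDERIV[OF B] diff_on_has_derivative[OF Suc.prems(1)]
        diff_on_has_derivative[OF Suc.prems(2)])
  have "diff_on k S (\<lambda>x. B (f x) (D g x v) + B (D f x v) (g x))" for v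
    using Suc diff_on_pred[OF Suc.prems(1)] diff_on_pred[OF Suc.prems(2)]
    by (intro diff_on_add[OF assms(2)] Suc.IH) auto
  then have "diff_on k S (\<lambda>x. D (\<lambda>x. B (f x) (g x)) x v)" for v
    by (rule diff_on_cong[OF assms(2), rotated]) (use D_eqI[OF *] in auto)
  then show ?case using * by (auto simp: differentiable_def)
qed

lemma diff_on_inverse:
  fixes f :: "'a::real_normed_vector \<Rightarrow> real"
  assumes "open S" and "\<And>x. x \<in> S \<Longrightarrow> f x \<noteq> 0" and "diff_on k S f"
  shows "diff_on k S (\<lambda>x. inverse (f x))"
  using assms(3)
proof (induction k)
  case 0
  then show ?case using assms(2) by (auto intro: continuous_intros)
next
  case (Suc k)
  have *: "((\<lambda>x. inverse (f x)) has_derivative (\<lambda>X. - (inverse (f x) * D f x X * inverse (f x)))) (at x)"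
    if "x \<in> S" for x
    using assms(2)[OF that] diff_on_has_derivative[OF Suc.prems that] by (rule Deriv.has_derivative_inverse)
  \<comment> \<open>The derivative of a reciprocal contains the reciprocal again. Its class
    \<open>k\<close> comes from the induction hypothesis, and the derivative is then a product of
    functions of class \<open>k\<close>.\<close>
  have i: "diff_on k S (\<lambda>x. inverse (f x))" using Suc diff_on_pred by blast
  have "diff_on k S (\<lambda>x. - (inverse (f x) * D f x v * inverse (f x)))" for v
    using Suc.prems i
    by (intro diff_on_bounded_linear_comp[OF bounded_linear_minus[OF bounded_linear_ident]]
        diff_on_bilinear[OF bounded_bilinear_mult] assms(1)) auto
  then have "diff_on k S (\<lambda>x. D (\<lambda>x. inverse (f x)) x v)" for v
    by (rule diff_on_cong[OF assms(1), rotated]) (use D_eqI[OF *] in auto)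
  then show ?case using * by (auto simp: differentiable_def)
qed

lemma smooth_on_const: "smooth_on S (\<lambda>x. c)"
  by (simp add: smooth_on_def)

lemma smooth_on_bounded_linear_comp:
  "bounded_linear L \<Longrightarrow> open S \<Longrightarrow> smooth_on S f \<Longrightarrow> smooth_on S (\<lambda>x. L (f x))"
  by (simp add: smooth_on_def diff_on_bounded_linear_comp)

lemma smooth_on_ident: "smooth_on S (\<lambda>x. x)"
  unfolding smooth_on_def
proof
  fix k show "diff_on k S (\<lambda>x. x)" by (cases k) auto
qed

lemma smooth_on_add: "open S \<Longrightarrow> smooth_on S f \<Longrightarrow> smooth_on S g \<Longrightarrow> smooth_on S (\<lambda>x. f x + g x)"
  by (simp add: smooth_on_def diff_on_add)

lemma smooth_on_minus: "open S \<Longrightarrow> smooth_on S f \<Longrightarrow> smooth_on S (\<lambda>x. - f x)"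
  by (rule smooth_on_bounded_linear_comp[OF bounded_linear_minus[OF bounded_linear_ident]])

lemma smooth_on_diff: "open S \<Longrightarrow> smooth_on S f \<Longrightarrow> smooth_on S g \<Longrightarrow> smooth_on S (\<lambda>x. f x - g x)"
  using smooth_on_add[of S f "\<lambda>x. - g x"] smooth_on_minus by auto

lemma smooth_on_mult:
  fixes f g :: "'a::real_normed_vector \<Rightarrow> real"
  shows "open S \<Longrightarrow> smooth_on S f \<Longrightarrow> smooth_on S g \<Longrightarrow> smooth_on S (\<lambda>x. f x * g x)"
  by (simp add: smooth_on_def diff_on_bilinear[OF bounded_bilinear_mult])

lemma smooth_on_scaleR:
  "open S \<Longrightarrow> smooth_on S f \<Longrightarrow> smooth_on S g \<Longrightarrow> smooth_on S (\<lambda>x. f x *\<^sub>R g x)"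
  by (simp add: smooth_on_def diff_on_bilinear[OF bounded_bilinear_scaleR])

lemma smooth_on_divide:
  fixes f g :: "'a::real_normed_vector \<Rightarrow> real"
  shows "open S \<Longrightarrow> smooth_on S f \<Longrightarrow> smooth_on S g \<Longrightarrow> (\<And>x. x \<in> S \<Longrightarrow> g x \<noteq> 0) \<Longrightarrow>
    smooth_on S (\<lambda>x. f x / g x)"
  by (simp add: smooth_on_def divide_inverse diff_on_inverse diff_on_bilinear[OF bounded_bilinear_mult])

lemma smooth_on_sum:
  "open S \<Longrightarrow> (\<And>i. i \<in> I \<Longrightarrow> smooth_on S (f i)) \<Longrightarrow> smooth_on S (\<lambda>x. \<Sum>i\<in>I. f i x)"
  by (induction I rule: infinite_finite_induct) (auto simp: smooth_on_const smooth_on_add)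

lemma smooth_on_prod:
  fixes f :: "'i \<Rightarrow> 'a::real_normed_vector \<Rightarrow> real"
  shows "open S \<Longrightarrow> (\<And>i. i \<in> I \<Longrightarrow> smooth_on S (f i)) \<Longrightarrow> smooth_on S (\<lambda>x. \<Prod>i\<in>I. f i x)"
  by (induction I rule: infinite_finite_induct) (auto simp: smooth_on_const smooth_on_mult)

lemma smooth_on_vec:
  fixes f :: "'a::real_normed_vector \<Rightarrow> real ^ 'n"
  assumes "open S" and "\<And>i. smooth_on S (\<lambda>x. f x $ i)"
  shows "smooth_on S f"
proof -
  have "smooth_on S (\<lambda>x. \<Sum>i\<in>UNIV. (f x $ i) *\<^sub>R axis i (1::real))"
    using assms by (intro smooth_on_sum smooth_on_scaleR smooth_on_const)
  moreover have "(\<Sum>i\<in>UNIV. (f x $ i) *\<^sub>R axis i (1::real)) = f x" for x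
    using basis_expansion[of "f x"] by (simp add: scalar_mult_eq_scaleR)
  ultimately show ?thesis by simp
qed

lemma smooth_on_Pair:
  assumes "open S" and "smooth_on S f" and "smooth_on S g"
  shows "smooth_on S (\<lambda>x. (f x, g x))"
proof -
  have "bounded_linear (\<lambda>x. (x, 0))" "bounded_linear (\<lambda>x. (0, x))"
    by (auto intro!: bounded_linear_Pair bounded_linear_ident bounded_linear_zero)
  then have "smooth_on S (\<lambda>x. (f x, 0) + (0, g x))"
    using assms by (intro smooth_on_add smooth_on_bounded_linear_comp[where L = "\<lambda>x. (x, 0)"]
        smooth_on_bounded_linear_comp[where L = "\<lambda>x. (0, x)"])
  then show ?thesis by simp
qed

lemma smooth_on_det:
  fixes M :: "'a::real_normed_vector \<Rightarrow> real ^ 'n ^ 'n"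
  assumes "open S" and "\<And>i j. smooth_on S (\<lambda>x. M x $ i $ j)"
  shows "smooth_on S (\<lambda>x. det (M x))"
  unfolding det_def
  using assms by (intro smooth_on_sum smooth_on_mult smooth_on_prod smooth_on_const)

lemma smooth_on_if: "smooth_on S f \<Longrightarrow> smooth_on S g \<Longrightarrow> smooth_on S (\<lambda>x. if P then f x else g x)"
  by (cases P) auto

text \<open>Cramer's rule writes the components of \<open>u\<close> as quotients of determinants
  with smooth entries.\<close>

lemma smooth_on_linear_solve:
  fixes M :: "'a::real_normed_vector \<Rightarrow> real ^ 'n ^ 'n" and u r :: "'a \<Rightarrow> real ^ 'n"
  assumes S: "open S" and M: "\<And>i j. smooth_on S (\<lambda>x. M x $ i $ j)"
    and r: "\<And>i. smooth_on S (\<lambda>x. r x $ i)"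
    and inv: "\<And>x. x \<in> S \<Longrightarrow> invertible (M x)"
    and u: "\<And>x. x \<in> S \<Longrightarrow> M x *v u x = r x"
  shows "smooth_on S u"
proof -
  have "smooth_on S (\<lambda>x. det (\<chi> i j. if j = l then r x $ i else M x $ i $ j) / det (M x))" for l
    using inv
    by (intro smooth_on_divide[OF S] smooth_on_det[OF S] M)
      (auto simp: invertible_det_nz intro!: M smooth_on_if r)
  moreover have "u x $ l = det (\<chi> i j. if j = l then r x $ i else M x $ i $ j) / det (M x)"
    if "x \<in> S" for x l
    using cramer[of "M x" "u x" "r x"] inv[OF that] u[OF that]
    by (simp add: invertible_det_nz)
  ultimately have "smooth_on S (\<lambda>x. u x $ l)" for l
    by (metis (no_types, lifting) smooth_on_cong[OF S])
  then show ?thesis by (rule smooth_on_vec[OF S])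
qed

section \<open>Rules for computing directional derivatives\<close>

lemma D_const: "D (\<lambda>x. c) z X = 0"
  by simp

lemma D_add:
  "smooth_on S f \<Longrightarrow> smooth_on S g \<Longrightarrow> z \<in> S \<Longrightarrow> D (\<lambda>x. f x + g x) z X = D f z X + D g z X"
  by (rule D_eqI) (intro has_derivative_add smooth_on_has_derivative)

lemma D_diff:
  "smooth_on S f \<Longrightarrow> smooth_on S g \<Longrightarrow> z \<in> S \<Longrightarrow> D (\<lambda>x. f x - g x) z X = D f z X - D g z X"
  by (rule D_eqI) (intro has_derivative_diff smooth_on_has_derivative)

lemma D_mult:
  fixes f g :: "'a::real_normed_vector \<Rightarrow> real"
  shows "smooth_on S f \<Longrightarrow> smooth_on S g \<Longrightarrow> z \<in> S \<Longrightarrow>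
    D (\<lambda>x. f x * g x) z X = f z * D g z X + D f z X * g z"
  by (rule D_eqI) (intro has_derivative_mult smooth_on_has_derivative)

lemma D_scaleR:
  "smooth_on S f \<Longrightarrow> smooth_on S g \<Longrightarrow> z \<in> S \<Longrightarrow>
    D (\<lambda>x. f x *\<^sub>R g x) z X = f z *\<^sub>R D g z X + D f z X *\<^sub>R g z"
  by (rule D_eqI) (intro has_derivative_scaleR smooth_on_has_derivative)

lemma D_cmult:
  fixes f :: "'a::real_normed_vector \<Rightarrow> real"
  shows "smooth_on S f \<Longrightarrow> z \<in> S \<Longrightarrow> D (\<lambda>x. c * f x) z X = c * D f z X"
  using D_mult[of S "\<lambda>_. c" f] smooth_on_const by (auto simp: D_const)

lemma D_bounded_linear: "bounded_linear L \<Longrightarrow> D L z X = L X"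
  by (rule D_eqI) (rule bounded_linear_imp_has_derivative)

lemma D_Pair:
  "smooth_on S f \<Longrightarrow> smooth_on S g \<Longrightarrow> z \<in> S \<Longrightarrow> D (\<lambda>x. (f x, g x)) z X = (D f z X, D g z X)"
  by (rule D_eqI) (intro has_derivative_Pair smooth_on_has_derivative)

lemma linear_basis_expansion:
  fixes F :: "'b::euclidean_space \<Rightarrow> real"
  assumes "linear F"
  shows "F v = (\<Sum>b\<in>Basis. (v \<bullet> b) * F b)"
proof -
  have "F v = F (\<Sum>b\<in>Basis. (v \<bullet> b) *\<^sub>R b)" by (simp add: euclidean_representation)
  also have "\<dots> = (\<Sum>b\<in>Basis. (v \<bullet> b) * F b)"
    using assms by (simp add: linear_sum linear_cmul)
  finally show ?thesis .
qed

lemma smooth_on_contract: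
  fixes F :: "'a::real_normed_vector \<Rightarrow> 'b::euclidean_space \<Rightarrow> real"
  assumes S: "open S" and F: "\<And>b. smooth_on S (\<lambda>x. F x b)" and V: "smooth_on S V"
    and lin: "\<And>x. x \<in> S \<Longrightarrow> linear (F x)"
  shows "smooth_on S (\<lambda>x. F x (V x))"
proof -
  have "smooth_on S (\<lambda>x. \<Sum>b\<in>Basis. (V x \<bullet> b) * F x b)"
    by (intro smooth_on_sum smooth_on_mult S F
        smooth_on_bounded_linear_comp[where L = "\<lambda>v. v \<bullet> _"] bounded_linear_inner_left V)
  then show ?thesis
    by (rule smooth_on_cong[OF S, rotated]) (rule linear_basis_expansion[OF lin, symmetric])
qed

text \<open>Product rule for a linear form evaluated at a moving vector. Identities whose argument
  depends on the point, such as \<open>D G y (V y) = 0\<close>, are differentiated with it.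
  Expanding \<open>V\<close> in a fixed basis reduces it to products of scalar functions.\<close>

lemma D_contract:
  fixes F :: "'a::real_normed_vector \<Rightarrow> 'b::euclidean_space \<Rightarrow> real"
  assumes S: "open S" and F: "\<And>b. smooth_on S (\<lambda>x. F x b)" and V: "smooth_on S V"
    and lin: "\<And>x. x \<in> S \<Longrightarrow> linear (F x)" and z: "z \<in> S"
  shows "D (\<lambda>x. F x (V x)) z X = D (\<lambda>x. F x (V z)) z X + F z (D V z X)"
proof -
  have sV: "smooth_on S (\<lambda>x. V x \<bullet> b)" for b
    by (intro smooth_on_bounded_linear_comp[where L = "\<lambda>v. v \<bullet> _"] bounded_linear_inner_left V S)
  have dV: "D (\<lambda>x. V x \<bullet> b) z X = D V z X \<bullet> b" for b
    by (rule D_eqI) (intro bounded_linear.has_derivative[OF bounded_linear_inner_left]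
        smooth_on_has_derivative[OF V z])
  have "D (\<lambda>x. F x (V x)) z X = D (\<lambda>x. \<Sum>b\<in>Basis. (V x \<bullet> b) * F x b) z X"
    by (subst D_cong_open[OF S z, OF linear_basis_expansion[OF lin]]) auto
  also have "\<dots> = (\<Sum>b\<in>Basis. (V z \<bullet> b) * D (\<lambda>x. F x b) z X + (D V z X \<bullet> b) * F z b)"
    unfolding dV[symmetric]
    by (rule D_eqI) (intro has_derivative_sum has_derivative_mult smooth_on_has_derivative[OF _ z] sV F)
  also have "\<dots> = (\<Sum>b\<in>Basis. (V z \<bullet> b) * D (\<lambda>x. F x b) z X) + F z (D V z X)"
    by (simp add: sum.distrib linear_basis_expansion[OF lin[OF z], of "D V z X", symmetric])
  also have "(\<Sum>b\<in>Basis. (V z \<bullet> b) * D (\<lambda>x. F x b) z X) = D (\<lambda>x. F x (V z)) z X"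
  proof -
    have "D (\<lambda>x. F x (V z)) z X = D (\<lambda>x. \<Sum>b\<in>Basis. (V z \<bullet> b) * F x b) z X"
      by (subst D_cong_open[OF S z, OF linear_basis_expansion[OF lin]]) auto
    also have "\<dots> = (\<Sum>b\<in>Basis. (V z \<bullet> b) * D (\<lambda>x. F x b) z X)"
      by (rule D_eqI) (intro has_derivative_sum has_derivative_mult_right smooth_on_has_derivative[OF _ z] F)
    finally show ?thesis by simp
  qed
  finally show ?thesis .
qed

lemma linear_D_family:
  assumes S: "open S" and F: "\<And>b. smooth_on S (\<lambda>x. F x b)"
    and lin: "\<And>x. x \<in> S \<Longrightarrow> linear (F x)" and z: "z \<in> S"
  shows "linear (\<lambda>b. D (\<lambda>x. F x b) z X)"
proof (rule linearI)
  fix a b c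
  have "D (\<lambda>x. F x (a + b)) z = D (\<lambda>x. F x a + F x b) z"
    by (rule D_cong_open[OF S z]) (simp add: linear_add[OF lin])
  then show "D (\<lambda>x. F x (a + b)) z X = D (\<lambda>x. F x a) z X + D (\<lambda>x. F x b) z X"
    using D_add[OF F F z] by simp
  have "D (\<lambda>x. F x (c *\<^sub>R b)) z = D (\<lambda>x. c *\<^sub>R F x b) z"
    by (rule D_cong_open[OF S z]) (simp add: linear_cmul[OF lin])
  then show "D (\<lambda>x. F x (c *\<^sub>R b)) z X = c *\<^sub>R D (\<lambda>x. F x b) z X"
    using D_scaleR[OF smooth_on_const F z, of c] by (simp add: D_const)
qed

section \<open>Symmetry of second derivatives\<close>

lemma D_along_line:
  assumes "smooth_on S f" "z + r *\<^sub>R X \<in> S"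
  shows "((\<lambda>r. f (z + r *\<^sub>R X)) has_derivative (\<lambda>h. h *\<^sub>R D f (z + r *\<^sub>R X) X)) (at r)"
proof -
  have "((\<lambda>r. f (z + r *\<^sub>R X)) has_derivative (\<lambda>h. D f (z + r *\<^sub>R X) (h *\<^sub>R X))) (at r)"
    by (rule has_derivative_compose[where f = "\<lambda>r. z + r *\<^sub>R X"])
      (auto intro!: derivative_eq_intros smooth_on_has_derivative assms)
  then show ?thesis
    using linear_cmul[OF smooth_on_linear_D[OF assms]] by simp
qed

lemma mean_value_along_line:
  fixes f :: "'a::real_normed_vector \<Rightarrow> real"
  assumes "smooth_on S f" "t > 0" "\<And>r. 0 \<le> r \<Longrightarrow> r \<le> t \<Longrightarrow> z + r *\<^sub>R X \<in> S"
  obtains r where "0 < r" "r < t" "f (z + t *\<^sub>R X) - f z = t * D f (z + r *\<^sub>R X) X"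
proof -
  have *: "((\<lambda>r. f (z + r *\<^sub>R X)) has_real_derivative D f (z + r *\<^sub>R X) X) (at r)"
    if "0 \<le> r" "r \<le> t" for r
    using D_along_line[OF assms(1) assms(3)[OF that]]
    by (simp add: has_field_derivative_def mult.commute[of _ "D f _ _"])
  show thesis
    using MVT2[of 0 t "\<lambda>r. f (z + r *\<^sub>R X)" "\<lambda>r. D f (z + r *\<^sub>R X) X"] assms(2) * that
    by auto
qed

text \<open>Both mixed derivatives are limits of the same second difference quotient.\<close>

lemma second_difference:
  fixes f :: "'a::real_normed_vector \<Rightarrow> real"
  assumes S: "open S" and f: "smooth_on S f" and z: "z \<in> S"
  shows "((\<lambda>t. (f (z + t *\<^sub>R X + t *\<^sub>R Y) - f (z + t *\<^sub>R X) - f (z + t *\<^sub>R Y) + f z) / t\<^sup>2)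
          \<longlongrightarrow> D (\<lambda>y. D f y X) z Y) (at_right 0)"
proof (rule tendstoI)
  fix e :: real assume "e > 0"
  let ?h = "\<lambda>y. D (\<lambda>y. D f y X) y Y"
  have "continuous_on S ?h"
    by (intro smooth_on_continuous smooth_on_D f)
  then have "isCont ?h z" using S z by (simp add: continuous_on_eq_continuous_at)
  then obtain d1 where d1: "d1 > 0" "\<And>y. dist y z < d1 \<Longrightarrow> dist (?h y) (?h z) < e"
    using \<open>e > 0\<close> unfolding continuous_at_eps_delta dist_norm by blast
  obtain d2 where d2: "d2 > 0" "ball z d2 \<subseteq> S" using S z openE by blast
  \<comment> \<open>For \<open>r\<close> and \<open>s\<close> in \<open>[0, d)\<close> the point
    \<open>z + r X + s Y\<close> stays within both radii. The summand 1 keeps the denominator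
    positive when \<open>X\<close> and \<open>Y\<close> vanish.\<close>
  define d where "d = min d1 d2 / (norm X + norm Y + 1)"
  have "d > 0" using d1 d2 by (simp add: d_def add_nonneg_pos)
  have near: "dist (z + r *\<^sub>R X + s *\<^sub>R Y) z < min d1 d2"
    if "0 \<le> r" "0 \<le> s" "r < d" "s < d" for r s
  proof -
    have "dist (z + r *\<^sub>R X + s *\<^sub>R Y) z = norm (r *\<^sub>R X + s *\<^sub>R Y)"
      by (simp add: dist_norm)
    also have "\<dots> \<le> r * norm X + s * norm Y"
      using that norm_triangle_ineq[of "r *\<^sub>R X" "s *\<^sub>R Y"] by simp
    also have "\<dots> \<le> d * norm X + d * norm Y"
      using that by (intro add_mono mult_right_mono) auto
    also have "\<dots> < d * (norm X + norm Y + 1)" using \<open>d > 0\<close> by (simp add: algebra_simps)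
    also have "\<dots> = min d1 d2"
      using add_nonneg_pos[of "norm X + norm Y" 1] by (simp add: d_def)
    finally show ?thesis .
  qed
  have inS: "z + r *\<^sub>R X + s *\<^sub>R Y \<in> S"
    if "0 \<le> r" "0 \<le> s" "r < d" "s < d" for r s
    using near[OF that] d2 by (auto simp: dist_commute)
  have main: "dist ((f (z + t *\<^sub>R X + t *\<^sub>R Y) - f (z + t *\<^sub>R X) - f (z + t *\<^sub>R Y) + f z) / t\<^sup>2)
    (?h z) < e" if t: "0 < t" "t < d" for t
  proof -
    define U where "U = {y \<in> S. y + t *\<^sub>R Y \<in> S}"
    have "open U"
    proof -
      have "U = S \<inter> (\<lambda>y. y + t *\<^sub>R Y) -` S" by (auto simp: U_def)
      moreover have "open ((\<lambda>y. y + t *\<^sub>R Y) -` S)"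
        by (rule open_vimage[OF S]) (intro continuous_intros)
      ultimately show ?thesis using S by auto
    qed
    have seg: "z + r *\<^sub>R X \<in> U" if "0 \<le> r" "r \<le> t" for r
      using inS[of r 0] inS[of r t] that t by (simp add: U_def)
    \<comment> \<open>The second difference is an increment of \<open>g\<close>. One mean value
      theorem in the direction \<open>X\<close>, and a second one for \<open>D f y X\<close> in the
      direction \<open>Y\<close>, turn the quotient into the value of \<open>?h\<close> at a single
      nearby point.\<close>
    define g where "g r = f (z + r *\<^sub>R X + t *\<^sub>R Y) - f (z + r *\<^sub>R X)" for r
    define g' where "g' r = D f (z + r *\<^sub>R X + t *\<^sub>R Y) X - D f (z + r *\<^sub>R X) X" for r
    have dg: "(g has_real_derivative g' r) (at r)" if r: "0 \<le> r" "r \<le> t" for r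
    proof -
      have "((\<lambda>r. f (z + t *\<^sub>R Y + r *\<^sub>R X) - f (z + r *\<^sub>R X)) has_derivative
        (\<lambda>h. h *\<^sub>R D f (z + t *\<^sub>R Y + r *\<^sub>R X) X - h *\<^sub>R D f (z + r *\<^sub>R X) X)) (at r)"
        using seg[OF r]
        by (intro has_derivative_diff D_along_line[OF f]) (auto simp: U_def ac_simps)
      moreover have "(\<lambda>h. h *\<^sub>R D f (z + t *\<^sub>R Y + r *\<^sub>R X) X - h *\<^sub>R D f (z + r *\<^sub>R X) X) = (*) (g' r)"
        by (auto simp: g'_def algebra_simps)
      moreover have "(\<lambda>r. f (z + t *\<^sub>R Y + r *\<^sub>R X) - f (z + r *\<^sub>R X)) = g"
        by (auto simp: g_def algebra_simps)
      ultimately show ?thesis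
        unfolding has_field_derivative_def by simp
    qed
    obtain r where r: "0 < r" "r < t" "g t - g 0 = (t - 0) * g' r"
      using MVT2[of 0 t g g', OF t(1) dg] by blast
    obtain s where s: "0 < s" "s < t"
      "D f (z + r *\<^sub>R X + t *\<^sub>R Y) X - D f (z + r *\<^sub>R X) X = t * ?h (z + r *\<^sub>R X + s *\<^sub>R Y)"
    proof (rule mean_value_along_line[OF smooth_on_D[OF f, of X], of t "z + r *\<^sub>R X" Y])
      show "z + r *\<^sub>R X + q *\<^sub>R Y \<in> S" if "0 \<le> q" "q \<le> t" for q
        using that r t by (intro inS) auto
      show "0 < t" by (rule t)
    qed (rule that)
    have "(f (z + t *\<^sub>R X + t *\<^sub>R Y) - f (z + t *\<^sub>R X) - f (z + t *\<^sub>R Y) + f z) / t\<^sup>2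
      = ?h (z + r *\<^sub>R X + s *\<^sub>R Y)"
    proof -
      have "f (z + t *\<^sub>R X + t *\<^sub>R Y) - f (z + t *\<^sub>R X) - f (z + t *\<^sub>R Y) + f z
        = t\<^sup>2 * ?h (z + r *\<^sub>R X + s *\<^sub>R Y)"
      proof -
        have "f (z + t *\<^sub>R X + t *\<^sub>R Y) - f (z + t *\<^sub>R X) - f (z + t *\<^sub>R Y) + f z = g t - g 0"
          unfolding g_def by simp
        also have "\<dots> = t * g' r" unfolding r(3) by simp
        also have "g' r = t * ?h (z + r *\<^sub>R X + s *\<^sub>R Y)" unfolding g'_def by (rule s(3))
        finally show ?thesis unfolding power2_eq_square mult.assoc .
      qed
      then show ?thesis using t by simp
    qed
    then show ?thesis using d1(2) near[of r s] r s t by simp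
  qed
  show "\<forall>\<^sub>F t in at_right 0. dist ((f (z + t *\<^sub>R X + t *\<^sub>R Y) - f (z + t *\<^sub>R X) - f (z + t *\<^sub>R Y) + f z) / t\<^sup>2)
    (?h z) < e"
    unfolding eventually_at_right_field using main \<open>d > 0\<close> by auto
qed

lemma D_commute:
  fixes f :: "'a::real_normed_vector \<Rightarrow> real"
  assumes S: "open S" and f: "smooth_on S f" and z: "z \<in> S"
  shows "D (\<lambda>y. D f y X) z Y = D (\<lambda>y. D f y Y) z X"
proof -
  have *: "(\<lambda>t. (f (z + t *\<^sub>R Y + t *\<^sub>R X) - f (z + t *\<^sub>R Y) - f (z + t *\<^sub>R X) + f z) / t\<^sup>2)
      = (\<lambda>t. (f (z + t *\<^sub>R X + t *\<^sub>R Y) - f (z + t *\<^sub>R X) - f (z + t *\<^sub>R Y) + f z) / t\<^sup>2)"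
    by (simp add: algebra_simps)
  show ?thesis
    by (rule tendsto_unique[OF trivial_limit_at_right_real second_difference[OF assms, of X Y]
          second_difference[OF assms, of Y X, unfolded *]])
qed

text \<open>By the intermediate value theorem in the direction \<open>e\<close>, the zero set of \<open>G\<close> contains points
  at distance \<open>o(t)\<close> from \<open>z + t T\<close>.\<close>

lemma D_tangential_zero:
  fixes F G :: "'a::real_normed_vector \<Rightarrow> real"
  assumes S: "open S" and G: "smooth_on S G" and F: "F differentiable (at z)" and z: "z \<in> S" "G z = 0"
    and van: "\<And>y. y \<in> S \<Longrightarrow> G y = 0 \<Longrightarrow> F y = 0"
    and e: "D G z e \<noteq> 0" and T: "D G z T = 0"
  shows "D F z T = 0"
proof (rule ccontr)
  assume nz: "D F z T \<noteq> 0"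
  have linF: "linear (D F z)" using F linear_frechet_derivative by blast
  have linG: "linear (D G z)" using G z smooth_on_linear_D by blast
  define c where "c = \<bar>D F z T\<bar>"
  \<comment> \<open>Zeros of \<open>G\<close> are sought at \<open>z + t T + s e\<close> with
    \<open>|s| \<le> \<epsilon> t\<close>. This value keeps \<open>s * D F z e\<close> below
    \<open>c t / 2\<close>.\<close>
  define \<epsilon> where "\<epsilon> = c / (2 * (\<bar>D F z e\<bar> + 1))"
  have c: "c > 0" using nz by (simp add: c_def)
  then have eps: "\<epsilon> > 0" by (simp add: \<epsilon>_def add_nonneg_pos)
  define N where "N = norm T + \<epsilon> * norm e + 1"
  have N: "N > 0" using eps by (simp add: N_def add_nonneg_pos)
  \<comment> \<open>The admissible slope of the linearization errors. The first bound gives an error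
    of at most \<open>c t / 4\<close> for \<open>F\<close>, and
    \<open>c t / 4 + c t / 2 < c t\<close> is the contradiction. The second keeps the error of
    \<open>G\<close> at most half of its linear part at \<open>s = \<epsilon> t\<close> and
    \<open>s = - \<epsilon> t\<close>, so \<open>G\<close> changes sign between them.\<close>
  define m where "m = min (c / (4 * N)) (\<epsilon> * \<bar>D G z e\<bar> / (2 * N))"
  have m: "m > 0" using c N eps e by (simp add: m_def)
  have hF: "(F has_derivative D F z) (at z)" and hG: "(G has_derivative D G z) (at z)"
    using F smooth_on_has_derivative[OF G z(1)] frechet_derivative_works by auto
  obtain dF where dF: "dF > 0" "\<And>y. norm (y - z) < dF \<Longrightarrow> norm (F y - F z - D F z (y - z)) \<le> m * norm (y - z)"
    using hF m unfolding has_derivative_at_alt by blast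
  obtain dG where dG: "dG > 0" "\<And>y. norm (y - z) < dG \<Longrightarrow> norm (G y - G z - D G z (y - z)) \<le> m * norm (y - z)"
    using hG m unfolding has_derivative_at_alt by blast
  obtain dS where dS: "dS > 0" "ball z dS \<subseteq> S" using S z openE by blast
  define t where "t = min dF (min dG dS) / (2 * N)"
  have t: "t > 0" using dF dG dS N by (simp add: t_def)
  let ?p = "\<lambda>s. z + t *\<^sub>R T + s *\<^sub>R e"
  have near: "norm (?p s - z) \<le> t * N" if "\<bar>s\<bar> \<le> \<epsilon> * t" for s
  proof -
    have "norm (?p s - z) \<le> norm (t *\<^sub>R T) + norm (s *\<^sub>R e)"
      using norm_triangle_ineq[of "t *\<^sub>R T" "s *\<^sub>R e"] by (simp add: algebra_simps)
    also have "\<dots> \<le> t * norm T + \<epsilon> * t * norm e"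
      using t that by (simp add: mult_right_mono)
    also have "\<dots> \<le> t * N" using t by (simp add: N_def algebra_simps)
    finally show ?thesis .
  qed
  have tN: "t * N < dF" "t * N < dG" "t * N < dS"
    using N dF dG dS by (auto simp: t_def min_def)
  have DF: "D F z (?p s - z) = t * D F z T + s * D F z e"
    and DG: "D G z (?p s - z) = s * D G z e" for s
  proof -
    have "?p s - z = t *\<^sub>R T + s *\<^sub>R e" by simp
    then show "D F z (?p s - z) = t * D F z T + s * D F z e" "D G z (?p s - z) = s * D G z e"
      using T by (simp_all only: linear_add[OF linF] linear_add[OF linG] linear_cmul[OF linF]
          linear_cmul[OF linG]) simp_all
  qed
  have pS: "?p s \<in> S" if "\<bar>s\<bar> \<le> \<epsilon> * t" for s
    using near[OF that] tN dS dist_norm[of "?p s" z] by (auto simp: dist_commute subset_eq)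
  have Gest: "\<bar>G (?p s) - s * D G z e\<bar> \<le> \<epsilon> * t * \<bar>D G z e\<bar> / 2" if "\<bar>s\<bar> \<le> \<epsilon> * t" for s
  proof -
    have "\<bar>G (?p s) - s * D G z e\<bar> \<le> m * norm (?p s - z)"
      using dG(2)[of "?p s"] near[OF that] tN z unfolding DG by simp
    also have "\<dots> \<le> (\<epsilon> * \<bar>D G z e\<bar> / (2 * N)) * (t * N)"
      using near[OF that] m N by (intro mult_mono) (auto simp: m_def)
    also have "\<dots> = \<epsilon> * t * \<bar>D G z e\<bar> / 2" using N by simp
    finally show ?thesis .
  qed
  let ?g = "\<lambda>s. G (?p s) * sgn (D G z e)"
  have et: "\<epsilon> * t > 0" using eps t by simp
  have "0 < \<epsilon> * t * \<bar>D G z e\<bar>" using et e by simp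
  then have ends: "?g (- (\<epsilon> * t)) \<le> 0" "0 \<le> ?g (\<epsilon> * t)"
    using Gest[of "\<epsilon> * t"] Gest[of "- (\<epsilon> * t)"] et e
    by (auto simp: sgn_if abs_if algebra_simps split: if_splits)
  have cont: "continuous_on {- (\<epsilon> * t)..\<epsilon> * t} ?g"
    by (intro continuous_intros continuous_on_compose2[OF smooth_on_continuous[OF G]])
      (use pS in auto)
  obtain s where s: "- (\<epsilon> * t) \<le> s" "s \<le> \<epsilon> * t" "?g s = 0"
    using IVT'[OF ends _ cont] et by auto
  then have sa: "\<bar>s\<bar> \<le> \<epsilon> * t" and "G (?p s) = 0" using e by (auto simp: sgn_if split: if_splits)
  then have "F (?p s) = 0" "F z = 0" using van pS z by auto
  then have "\<bar>t * D F z T + s * D F z e\<bar> \<le> m * norm (?p s - z)"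
    using dF(2)[of "?p s"] near[OF sa] tN unfolding DF by simp
  also have "\<dots> \<le> (c / (4 * N)) * (t * N)"
    using near[OF sa] m N by (intro mult_mono) (auto simp: m_def)
  also have "\<dots> = c * t / 4" using N by simp
  finally have 1: "\<bar>t * D F z T + s * D F z e\<bar> \<le> c * t / 4" .
  have "\<bar>s * D F z e\<bar> \<le> \<epsilon> * t * \<bar>D F z e\<bar>" using sa by (simp add: abs_mult mult_right_mono)
  also have "\<dots> \<le> \<epsilon> * t * (\<bar>D F z e\<bar> + 1)" using et by (intro mult_left_mono) auto
  also have "\<dots> = (\<epsilon> * (\<bar>D F z e\<bar> + 1)) * t" by simp
  also have "\<epsilon> * (\<bar>D F z e\<bar> + 1) = c / 2"
    using abs_ge_zero[of "D F z e"] by (simp add: \<epsilon>_def field_simps)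
  finally have 2: "\<bar>s * D F z e\<bar> \<le> c * t / 2" by simp
  have "\<bar>t * D F z T\<bar> = c * t" using t by (simp add: c_def abs_mult)
  then show False using 1 2 c t mult_pos_pos[OF c t] by linarith
qed

lemma D_tangential:
  fixes F F' G :: "'a::real_normed_vector \<Rightarrow> real"
  assumes S: "open S" and G: "smooth_on S G" and F: "smooth_on S F" "smooth_on S F'"
    and z: "z \<in> S" "G z = 0"
    and eq: "\<And>y. y \<in> S \<Longrightarrow> G y = 0 \<Longrightarrow> F y = F' y"
    and e: "D G z e \<noteq> 0" and T: "D G z T = 0"
  shows "D F z T = D F' z T"
proof -
  have "D (\<lambda>y. F y - F' y) z T = 0"
    using smooth_on_differentiable[OF smooth_on_diff[OF S F] z(1)] eq
    by (intro D_tangential_zero[OF S G _ z _ e T]) auto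
  then show ?thesis using D_diff[OF F z(1)] by simp
qed

section \<open>The spray and the tidal force tensor in coordinates\<close>

definition hess :: "('a::real_normed_vector \<Rightarrow> real) \<Rightarrow> 'a \<Rightarrow> 'a \<Rightarrow> 'a \<Rightarrow> real" where
  "hess f z X Y = D (\<lambda>y. D f y Y) z X"

definition third :: "('a::real_normed_vector \<Rightarrow> real) \<Rightarrow> 'a \<Rightarrow> 'a \<Rightarrow> 'a \<Rightarrow> 'a \<Rightarrow> real" where
  "third f z X Y Z = D (\<lambda>y. hess f y Y Z) z X"

lemma bilinear_sum_axis:
  fixes B :: "real ^ 'n \<Rightarrow> real ^ 'n \<Rightarrow> real"
  assumes "bilinear B"
  shows "B a b = (\<Sum>i\<in>UNIV. \<Sum>j\<in>UNIV. B (axis i 1) (axis j 1) * a $ i * b $ j)"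
proof -
  have "B a b = B (\<Sum>i\<in>UNIV. a $ i *\<^sub>R axis i 1) (\<Sum>j\<in>UNIV. b $ j *\<^sub>R axis j 1)"
    using basis_expansion[of a] basis_expansion[of b] by (simp add: scalar_mult_eq_scaleR)
  also have "\<dots> = (\<Sum>i\<in>UNIV. \<Sum>j\<in>UNIV. B (axis i 1) (axis j 1) * a $ i * b $ j)"
    using assms
    by (simp add: bilinear_sum sum.cartesian_product bilinear_lmul bilinear_rmul mult_ac)
  finally show ?thesis .
qed

lemma linear_sum_axis:
  fixes F :: "real ^ 'n \<Rightarrow> real"
  assumes "linear F"
  shows "F a = (\<Sum>i\<in>UNIV. F (axis i 1) * a $ i)"
proof -
  have "F a = F (\<Sum>i\<in>UNIV. a $ i *\<^sub>R axis i 1)"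
    using basis_expansion[of a] by (simp add: scalar_mult_eq_scaleR)
  also have "\<dots> = (\<Sum>i\<in>UNIV. F (axis i 1) * a $ i)"
    using assms by (simp add: linear_sum linear_cmul mult_ac)
  finally show ?thesis .
qed

lemma linear_Pair_zero: "linear (\<lambda>b. (0, b))" "linear (\<lambda>a. (a, 0))"
  by (auto intro!: linearI)

locale smooth_function =
  fixes W :: "'a::euclidean_space set" and f :: "'a \<Rightarrow> real"
  assumes open_W: "open W" and smooth_f: "smooth_on W f"
begin

lemma smooth_Df: "smooth_on W (\<lambda>z. D f z X)"
  by (rule smooth_on_D[OF smooth_f])

lemma smooth_hess: "smooth_on W (\<lambda>z. hess f z X Y)"
  unfolding hess_def by (intro smooth_on_D smooth_f)

lemma smooth_third: "smooth_on W (\<lambda>z. third f z X Y Z)"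
  unfolding third_def by (intro smooth_on_D smooth_hess)

context
  fixes z assumes z: "z \<in> W"
begin

lemma linear_Df: "linear (D f z)"
  by (rule smooth_on_linear_D[OF smooth_f z])

lemma hess_commute: "hess f z X Y = hess f z Y X"
  unfolding hess_def by (rule D_commute[OF open_W smooth_f z])

lemma linear_hess: "linear (\<lambda>X. hess f z X Y)"
  unfolding hess_def using smooth_on_linear_D[OF smooth_Df z] by (simp add: eta_contract_eq)

lemma linear_hess2: "linear (hess f z X)"
  using linear_hess[of X] hess_commute[of X] by presburger

lemma third_commute1: "third f z X Y Z = third f z Y X Z"
  unfolding third_def hess_def by (rule D_commute[OF open_W smooth_Df z])

end

lemma third_commute2: "z \<in> W \<Longrightarrow> third f z X Y Z = third f z X Z Y"
  unfolding third_def using D_cong_open[OF open_W, of z "\<lambda>y. hess f y Y Z" "\<lambda>y. hess f y Z Y"] hess_commute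
  by presburger

lemma linear_third: "z \<in> W \<Longrightarrow> linear (\<lambda>X. third f z X Y Z)"
  unfolding third_def using smooth_on_linear_D[OF smooth_hess] by (simp add: eta_contract_eq)

lemma linear_third2: "z \<in> W \<Longrightarrow> linear (\<lambda>Y. third f z X Y Z)"
  using linear_third[of z X Z] third_commute1[of z] by presburger

lemma linear_third3: "z \<in> W \<Longrightarrow> linear (\<lambda>Z. third f z X Y Z)"
  using linear_third2[of z X Y] third_commute2[of z X] by presburger

end

text \<open>Homogeneity is recorded infinitesimally, as Euler's relation for the radial vector
  \<open>(0, snd z)\<close>. In this form it restricts to open sets \<open>W\<close> that are not
  invariant under scaling.\<close>

locale conic_function = smooth_function W G
  for W :: "'n::finite vec2 set" and G :: "'n vec2 \<Rightarrow> real" +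
  fixes k :: real
  assumes euler: "z \<in> W \<Longrightarrow> D G z (0, snd z) = k * G z"
    and k: "k \<noteq> 1"
    and inv: "z \<in> W \<Longrightarrow> invertible (vhess G z)"
begin

definition g where "g z a b = hess G z (0, a) (0, b)"

definition u where
  "u z = matrix_inv (vhess G z) *v
     (\<chi> j. D G z (axis j 1, 0) - hess G z (snd z, 0) (0, axis j 1))"

definition V where "V z = (snd z, u z)"

text \<open>The derivative of the fibre metric \<open>g\<close> along the spray, written through
  \<open>third\<close> so that the symmetries of third derivatives apply.\<close>

definition psi where "psi z a b = third G z (V z) (0, a) (0, b)"

text \<open>The vertical Jacobian of the spray coefficients. Half of it gives the coefficients of
  the nonlinear connection whose vertical projection is \<open>P_endo\<close>.\<close>

definition N where "N z b = D u z (0, b)"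

text \<open>The coordinate form of the tidal tensor. The bracket of the spray with a constant field
  is minus the derivative of the spray in that direction; each of the two Lie derivatives produces
  the mixed terms once, hence the factors 2.\<close>

definition tid where
  "tid z X Y = (1/2) * (D (\<lambda>y. psi y (fst X) (fst Y)) z (V z)
     + 2 * psi z (snd X) (fst Y) + 2 * psi z (fst X) (snd Y) + 2 * g z (snd X) (snd Y)
     + g z (D u z X) (fst Y) + g z (fst X) (D u z Y))
     - g z (snd X - (1/2) *\<^sub>R N z (fst X)) (snd Y - (1/2) *\<^sub>R N z (fst Y))"

lemma vhess_inv_right: "z \<in> W \<Longrightarrow> vhess G z ** matrix_inv (vhess G z) = mat 1"
  using inv someI_ex[of "\<lambda>A'. vhess G z ** A' = mat 1 \<and> A' ** vhess G z = mat 1"]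
  unfolding matrix_inv_def invertible_def by blast

lemma smooth_g: "smooth_on W (\<lambda>z. g z a b)"
  unfolding g_def by (rule smooth_hess)

lemma smooth_snd: "smooth_on W snd"
  using smooth_on_bounded_linear_comp[OF bounded_linear_snd open_W smooth_on_ident] by simp

lemma D_snd: "D snd z X = snd X" for z :: "'n vec2"
  by (rule D_bounded_linear[OF bounded_linear_snd])

lemma smooth_L: "smooth_on W (\<lambda>z. (0, snd z) :: 'n vec2)"
  by (intro smooth_on_Pair smooth_on_const smooth_snd open_W)

lemma D_L: "z \<in> W \<Longrightarrow> D (\<lambda>z. (0, snd z) :: 'n vec2) z X = (0, snd X)"
  by (subst D_Pair[OF smooth_on_const smooth_snd]) (auto simp: D_snd)

lemma vhess_eq: "vhess G z $ i $ j = g z (axis i 1) (axis j 1)"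
  by (simp add: vhess_def dv_def g_def hess_def)

context
  fixes z assumes z: "z \<in> W"
begin

lemma bilinear_g: "bilinear (g z)"
  unfolding bilinear_def g_def
  using linear_compose[OF linear_Pair_zero(1) linear_hess[OF z]]
    linear_compose[OF linear_Pair_zero(1) linear_hess2[OF z]]
  by (auto simp: o_def)

lemma g_commute: "g z a b = g z b a"
  unfolding g_def by (rule hess_commute[OF z])

lemma vhess_mult: "(vhess G z *v b) $ i = g z (axis i 1) b"
proof -
  have "g z (axis i 1) b = (\<Sum>j\<in>UNIV. g z (axis i 1) (axis j 1) * b $ j)"
    using linear_sum_axis[of "g z (axis i 1)" b] bilinear_g by (simp add: bilinear_def)
  then show ?thesis by (simp add: matrix_vector_mult_def vhess_eq)
qed

lemma g_nondegenerate:
  assumes "\<And>a. g z b a = 0"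
  shows "b = 0"
proof -
  have "vhess G z *v b = 0"
    using assms by (simp add: vec_eq_iff vhess_mult g_commute[of _ b])
  then show ?thesis using inv[OF z] matrix_vector_mult_0_right
    by (metis invertible_def matrix_vector_mul_assoc matrix_vector_mul_lid)
qed

lemma g_solve_vhess:
  assumes "linear r" "vhess G z *v y = (\<chi> j. r (axis j 1))"
  shows "g z y a = r a"
proof -
  have *: "g z y (axis j 1) = r (axis j 1)" for j
    using arg_cong[OF assms(2), of "\<lambda>v. v $ j"] by (simp add: vhess_mult g_commute[of y])
  have "g z y a = (\<Sum>j\<in>UNIV. g z y (axis j 1) * a $ j)"
    using linear_sum_axis[of "g z y" a] bilinear_g by (simp add: bilinear_def)
  also have "\<dots> = r a" unfolding * by (rule linear_sum_axis[OF assms(1), symmetric])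
  finally show ?thesis .
qed

lemma g_solve:
  assumes "linear r"
  obtains y where "\<And>a. g z y a = r a"
proof -
  have "vhess G z *v (matrix_inv (vhess G z) *v (\<chi> j. r (axis j 1))) = (\<chi> j. r (axis j 1))"
    by (simp add: matrix_vector_mul_assoc vhess_inv_right z)
  then show thesis using that g_solve_vhess[OF assms] by blast
qed

lemma u_eq: "g z (u z) a = D G z (a, 0) - hess G z (snd z, 0) (0, a)"
proof (rule g_solve_vhess)
  show "linear (\<lambda>a. D G z (a, 0) - hess G z (snd z, 0) (0, a))"
    using linear_compose[OF linear_Pair_zero(2) linear_Df[OF z]]
      linear_compose[OF linear_Pair_zero(1) linear_hess2[OF z]]
    by (intro linear_compose_sub) (auto simp: o_def)
  show "vhess G z *v u z = (\<chi> j. D G z (axis j 1, 0) - hess G z (snd z, 0) (0, axis j 1))"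
    by (simp add: u_def matrix_vector_mul_assoc vhess_inv_right z)
qed

lemma hess_split: "hess G z (a, b) Y = hess G z (a, 0) Y + hess G z (0, b) Y"
  using linear_add[OF linear_hess[OF z], of "(a, 0)" "(0, b)"] by simp

lemma D_split: "D G z (a, b) = D G z (a, 0) + D G z (0, b)"
  using linear_add[OF linear_Df[OF z], of "(a, 0)" "(0, b)"] by simp

text \<open>The Euler-Lagrange equation of the Lagrangian \<open>G\<close>: along the spray,
  \<open>\<partial>G/\<partial>v\<close> changes at the rate
  \<open>\<partial>G/\<partial>x\<close>.\<close>

lemma spray_eq: "hess G z (V z) (0, a) = D G z (a, 0)"
  using u_eq[of a] hess_split[of "snd z" "u z" "(0, a)"] by (simp add: V_def g_def)

text \<open>The derivative of Euler's relation in the direction \<open>X\<close>; the second summand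
  comes from the variation of the radial vector itself.\<close>

lemma euler_hess: "hess G z X (0, snd z) + D G z (0, snd X) = k * D G z X"
proof -
  have "D (\<lambda>y. D G y (0, snd y)) z X = D (\<lambda>y. k * G y) z X"
    using D_cong_open[OF open_W z euler] by simp
  moreover have "D (\<lambda>y. D G y (0, snd y)) z X = hess G z X (0, snd z) + D G z (0, snd X)"
    using D_contract[OF open_W smooth_Df smooth_L linear_Df z, of X] D_L[OF z, of X]
    by (simp add: hess_def)
  ultimately show ?thesis using D_cmult[OF smooth_f z] by simp
qed

text \<open>As \<open>k \<noteq> 1\<close>, the radial vector represents \<open>alpha\<close>
  through \<open>g\<close> up to a nonzero factor. This later identifies the radical of the metric
  on the kernel of \<open>alpha\<close>.\<close>

lemma g_radial: "g z a (snd z) = (k - 1) * D G z (0, a)"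
  using euler_hess[of "(0, a)"] by (simp add: g_def algebra_simps)

text \<open>Conservation of energy: the differentiated Euler relation at \<open>V\<close> and the
  Euler-Lagrange equation show that the derivative equals \<open>k\<close> times itself.\<close>

lemma D_spray: "D G z (V z) = 0"
proof -
  have "hess G z (V z) (0, snd z) + D G z (0, u z) = k * D G z (V z)"
    using euler_hess[of "V z"] by (simp add: V_def)
  then have "D G z (V z) = k * D G z (V z)"
    unfolding spray_eq using D_split[of "snd z" "u z"] by (simp add: V_def)
  then show ?thesis using k by auto
qed

end

lemma smooth_u: "smooth_on W u"
proof (rule smooth_on_linear_solve[OF open_W])
  show "smooth_on W (\<lambda>z. vhess G z $ i $ j)" for i j
    unfolding vhess_eq by (rule smooth_g)
  show "invertible (vhess G z)" if "z \<in> W" for z using inv that .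
  show "vhess G z *v u z = (\<chi> j. D G z (axis j 1, 0) - hess G z (snd z, 0) (0, axis j 1))"
    if "z \<in> W" for z
    using that by (simp add: u_def matrix_vector_mul_assoc vhess_inv_right)
  have s: "smooth_on W (\<lambda>z. (snd z, 0))"
    by (intro smooth_on_Pair smooth_on_const smooth_snd open_W)
  show "smooth_on W (\<lambda>z. (\<chi> j. D G z (axis j 1, 0) - hess G z (snd z, 0) (0, axis j 1)) $ i)" for i
    using smooth_on_contract[OF open_W smooth_hess s linear_hess]
    by (auto intro!: smooth_on_diff smooth_Df open_W)
qed

lemma smooth_V: "smooth_on W V"
  unfolding V_def[abs_def] by (intro smooth_on_Pair smooth_snd smooth_u open_W)

lemma D_V: "z \<in> W \<Longrightarrow> D V z X = (snd X, D u z X)"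
  unfolding V_def[abs_def] by (subst D_Pair[OF smooth_snd smooth_u]) (auto simp: D_snd)

lemma smooth_psi: "smooth_on W (\<lambda>z. psi z a b)"
  unfolding psi_def by (rule smooth_on_contract[OF open_W smooth_third smooth_V linear_third])

section \<open>The invariant definitions expressed in coordinates\<close>

lemma alpha_eq: "z \<in> W \<Longrightarrow> alpha G z X = D G z (0, fst X)"
  using linear_sum_axis[OF linear_compose[OF linear_Pair_zero(1) linear_Df], of z "fst X"]
  by (simp add: alpha_def dv_def o_def)

lemma ext_deriv_alpha:
  assumes z: "z \<in> W"
  shows "ext_deriv (alpha G) z X Y = hess G z X (0, fst Y) - hess G z Y (0, fst X)"
proof -
  have "D (\<lambda>w. alpha G w Y) z = D (\<lambda>w. D G w (0, fst Y)) z" for Y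
    by (rule D_cong_open[OF open_W z alpha_eq])
  then show ?thesis by (simp add: ext_deriv_def hess_def)
qed

lemma spray_V:
  assumes z: "z \<in> W"
  shows "spray k G z = V z"
  unfolding spray_def ext_deriv_alpha[OF z]
proof (rule the_equality)
  show "\<forall>Y. hess G z (V z) (0, fst Y) - hess G z Y (0, fst (V z)) = - (k - 1) * D G z Y"
  proof
    fix Y :: "'n vec2"
    show "hess G z (V z) (0, fst Y) - hess G z Y (0, fst (V z)) = - (k - 1) * D G z Y"
      using euler_hess[OF z, of Y] spray_eq[OF z, of "fst Y"] D_split[OF z, of "fst Y" "snd Y"]
      by (simp add: V_def algebra_simps)
  qed
next
  fix w :: "'n vec2"
  assume w: "\<forall>Y. hess G z w (0, fst Y) - hess G z Y (0, fst w) = - (k - 1) * D G z Y"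
  \<comment> \<open>Vertical test vectors determine the base component of \<open>w\<close>, since
    the radial vector satisfies the same equation.\<close>
  have "g z (fst w - snd z) a = 0" for a
  proof -
    have "g z (snd z) a = (k - 1) * D G z (0, a)"
      using g_radial[OF z, of a] g_commute[OF z] by simp
    moreover have "g z (fst w) a = (k - 1) * D G z (0, a)"
      using w[rule_format, of "(0, a)"] linear_0[OF linear_hess2[OF z]] g_commute[OF z, of a]
      by (simp add: g_def zero_prod_def[symmetric] algebra_simps)
    ultimately show ?thesis by (simp add: bilinear_lsub[OF bilinear_g[OF z]])
  qed
  then have f: "fst w = snd z" using g_nondegenerate[OF z, of "fst w - snd z"] by auto
  \<comment> \<open>With the base component known, horizontal test vectors reduce to the
    Euler-Lagrange equation, whose solution is unique by nondegeneracy.\<close>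
  have "g z (snd w - u z) a = 0" for a
  proof -
    have "hess G z w (0, a) - hess G z (a, 0) (0, snd z) = - (k - 1) * D G z (a, 0)"
      using w[rule_format, of "(a, 0)"] f by simp
    moreover have "hess G z (a, 0) (0, snd z) = k * D G z (a, 0)"
      using euler_hess[OF z, of "(a, 0)"] linear_0[OF linear_Df[OF z]] by (simp add: zero_prod_def)
    ultimately have "hess G z w (0, a) = hess G z (V z) (0, a)"
      using spray_eq[OF z, of a] by (simp add: algebra_simps)
    moreover have "w = (snd z, snd w)" using f by (metis prod.collapse)
    ultimately show ?thesis
      using hess_split[OF z, of "snd z" "snd w"] hess_split[OF z, of "snd z" "u z"]
      by (simp add: V_def g_def[symmetric] bilinear_lsub[OF bilinear_g[OF z]])
  qed
  then have "snd w = u z" using g_nondegenerate[OF z, of "snd w - u z"] by auto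
  then show "w = V z" using f by (simp add: V_def prod_eq_iff)
qed

lemma g_h_eq:
  assumes "z \<in> W"
  shows "g_h G z X Y = g z (fst X) (fst Y)"
  using bilinear_sum_axis[OF bilinear_g[OF assms], of "fst X" "fst Y"] by (simp add: g_h_def vhess_eq)

lemma g_v_eq:
  assumes "z \<in> W"
  shows "g_v G z X Y = g z (snd X) (snd Y)"
  using bilinear_sum_axis[OF bilinear_g[OF assms], of "snd X" "snd Y"] by (simp add: g_v_def vhess_eq)

lemma D_spray_field: "z \<in> W \<Longrightarrow> D (spray k G) z X = (snd X, D u z X)"
  using D_cong_open[OF open_W _ spray_V, of z] D_V by simp

lemma D_g: "D (\<lambda>w. g w a b) z X = third G z X (0, a) (0, b)"
  by (simp add: g_def third_def)

lemma lie_form_g_h: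
  assumes z: "z \<in> W"
  shows "lie_form (spray k G) (g_h G) z X Y
    = psi z (fst X) (fst Y) + g z (snd X) (fst Y) + g z (fst X) (snd Y)"
proof -
  have "D (\<lambda>w. g_h G w X Y) z = D (\<lambda>w. g w (fst X) (fst Y)) z"
    by (rule D_cong_open[OF open_W z g_h_eq])
  then show ?thesis
    by (simp add: lie_form_def lie_bracket_def spray_V z D_spray_field g_h_eq D_g psi_def
        bilinear_lneg[OF bilinear_g[OF z]] bilinear_rneg[OF bilinear_g[OF z]])
qed

lemma tidal_eq:
  assumes z: "z \<in> W"
  shows "tidal k G z X Y = tid z X Y"
proof -
  let ?h = "lie_form (spray k G) (g_h G)"
  have "D (\<lambda>w. ?h w X Y) z = D (\<lambda>w. psi w (fst X) (fst Y) + g w (snd X) (fst Y) + g w (fst X) (snd Y)) z"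
    by (rule D_cong_open[OF open_W z lie_form_g_h])
  then have 1: "D (\<lambda>w. ?h w X Y) z (V z)
    = D (\<lambda>y. psi y (fst X) (fst Y)) z (V z) + psi z (snd X) (fst Y) + psi z (fst X) (snd Y)"
    by (simp add: D_add[OF _ _ z] smooth_on_add open_W smooth_psi smooth_g D_g)
      (simp add: psi_def)
  have 2: "?h z (- X) Y = - ?h z X Y" "?h z X (- Y) = - ?h z X Y" for X Y
    using linear_neg[OF linear_third2[OF z], of "V z" "(0, fst X)" "(0, fst Y)"]
      linear_neg[OF linear_third3[OF z], of "V z" "(0, fst X)" "(0, fst Y)"]
    by (simp_all add: lie_form_g_h z psi_def
        bilinear_lneg[OF bilinear_g[OF z]] bilinear_rneg[OF bilinear_g[OF z]])
  have 3: "lie_form (spray k G) ?h z X Y = D (\<lambda>y. psi y (fst X) (fst Y)) z (V z)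
     + 2 * psi z (snd X) (fst Y) + 2 * psi z (fst X) (snd Y) + 2 * g z (snd X) (snd Y)
     + g z (D u z X) (fst Y) + g z (fst X) (D u z Y)"
    by (subst lie_form_def)
      (simp add: spray_V z 1 lie_bracket_def D_spray_field 2
        lie_form_g_h del: uminus_Pair)
  \<comment> \<open>The horizontal parts of \<open>X\<close> and of the Lie derivative of
    \<open>lam\<close> cancel, so the projection is vertical; the vertical part of \<open>X\<close>
    occurs twice and survives the factor 1/2.\<close>
  have P: "P_endo k G z X = (0, snd X - (1/2) *\<^sub>R N z (fst X))" for X
    by (simp add: P_endo_def lie_endo_def lie_bracket_def lam_def D_spray_field z N_def prod_eq_iff
        algebra_simps flip: scaleR_left_distrib)
  show ?thesis
    unfolding tidal_def 3 P g_v_eq[OF z] by (simp add: tid_def)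
qed

end

section \<open>Differentiated Euler and spray identities, and the algebraic properties of the tidal
  tensor\<close>

context conic_function
begin

lemma smooth_DG: "smooth_on W (\<lambda>z. D G z X)"
  by (rule smooth_Df)

context
  fixes z assumes z: "z \<in> W"
begin

lemma linear_Du: "linear (D u z)"
  by (rule smooth_on_linear_D[OF smooth_u z])

lemma linear_N: "linear (N z)"
  unfolding N_def[abs_def] using linear_compose[OF linear_Pair_zero(1) linear_Du] by (simp add: o_def)

lemma Du_split: "D u z (a, b) = D u z (a, 0) + N z b"
  using linear_add[OF linear_Du, of "(a, 0)" "(0, b)"] by (simp add: N_def)

lemma bilinear_psi: "bilinear (psi z)"
  unfolding bilinear_def psi_def
  using linear_compose[OF linear_Pair_zero(1) linear_third2[OF z]]
    linear_compose[OF linear_Pair_zero(1) linear_third3[OF z]]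
  by (auto simp: o_def)

lemma psi_commute: "psi z a b = psi z b a"
  unfolding psi_def by (rule third_commute2[OF z])

lemma D_spray_deriv: "hess G z X (V z) + D G z (snd X, D u z X) = 0"
proof -
  have "D (\<lambda>y. D G y (V y)) z X = D (\<lambda>y. 0) z X"
    using D_cong_open[OF open_W z D_spray] by simp
  then show ?thesis
    using D_contract[OF open_W smooth_Df smooth_V linear_Df z, of X]
    by (simp add: hess_def D_V z)
qed

lemma spray_eq_deriv:
  "third G z X (V z) (0, a) + hess G z (snd X, D u z X) (0, a) = hess G z X (a, 0)"
proof -
  have "D (\<lambda>y. hess G y (V y) (0, a)) z X = D (\<lambda>y. D G y (a, 0)) z X"
    using D_cong_open[OF open_W z spray_eq] by simp
  then show ?thesis
    using D_contract[OF open_W smooth_hess smooth_V linear_hess z, of "(0, a)" X]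
    by (simp add: hess_def[of G z X] third_def D_V z)
qed

text \<open>The derivative of the Euler-Lagrange equation in the vertical direction
  \<open>(0, b)\<close>.\<close>

lemma N_eq: "g z (N z b) a = hess G z (0, b) (a, 0) - hess G z (b, 0) (0, a) - psi z a b"
proof -
  have "third G z (0, b) (V z) (0, a) = psi z a b"
    using third_commute1[OF z, of "(0, b)"] psi_commute[of a b] by (simp add: psi_def)
  then show ?thesis
    using spray_eq_deriv[of "(0, b)" a] hess_split[OF z, of b "N z b" "(0, a)"]
    by (simp add: g_def N_def)
qed

text \<open>The mixed Hessian terms in \<open>N_eq\<close> are antisymmetric in \<open>a\<close> and
  \<open>b\<close> and drop out on symmetrizing. Geometrically, \<open>g\<close> is parallel along
  the spray for the covariant derivative \<open>V(a) - N a / 2\<close>.\<close>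

lemma metric_compatible: "2 * psi z a b + g z (N z a) b + g z a (N z b) = 0"
  using N_eq[of a b] N_eq[of b a] psi_commute[of a b] g_commute[OF z, of a "N z b"]
    hess_commute[OF z, of "(0, a)"] hess_commute[OF z, of "(0, b)"]
  by simp

lemma euler_third:
  "third G z Y X (0, snd z) + hess G z X (0, snd Y) + hess G z Y (0, snd X) = k * hess G z X Y"
proof -
  have "D (\<lambda>y. hess G y X (0, snd y) + D G y (0, snd X)) z Y = D (\<lambda>y. k * D G y X) z Y"
    using D_cong_open[OF open_W z euler_hess] by simp
  moreover have "smooth_on W (\<lambda>y. hess G y X (0, snd y))"
    by (rule smooth_on_contract[OF open_W smooth_hess smooth_L linear_hess2])
  moreover have "D (\<lambda>y. hess G y X (0, snd y)) z Y = third G z Y X (0, snd z) + hess G z X (0, snd Y)"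
    using D_contract[OF open_W smooth_hess smooth_L linear_hess2 z, of X Y] D_L[OF z, of Y]
    by (simp add: third_def)
  ultimately show ?thesis
    using D_add[OF _ smooth_DG z] D_cmult[OF smooth_DG z] hess_commute[OF z, of X Y]
    by (simp add: hess_def[of G z Y])
qed

lemma D_g_radial: "third G z (0, snd z) (0, a) (0, b) = (k - 2) * g z a b"
proof -
  have "third G z (0, snd z) (0, a) (0, b) = third G z (0, b) (0, a) (0, snd z)"
    by (metis third_commute1[OF z] third_commute2[OF z])
  then show ?thesis
    using euler_third[of "(0, b)" "(0, a)"] g_commute[OF z, of a b] by (simp add: g_def algebra_simps)
qed

text \<open>This is Euler's relation of degree 2 for the spray coefficients. It is extracted from
  the differentiated identities for \<open>G\<close>, and nondegeneracy of \<open>g\<close> turns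
  the tested equation into one for vectors.\<close>

lemma N_radial: "N z (snd z) = 2 *\<^sub>R u z"
proof -
  have "g z (N z (snd z) - 2 *\<^sub>R u z) a = 0" for a
  proof -
    have "third G z (0, snd z) (V z) (0, a) = third G z (V z) (0, a) (0, snd z)"
      unfolding third_commute1[OF z, of "(0, snd z)" "V z"] by (rule third_commute2[OF z])
    also have "\<dots> = k * hess G z (0, a) (V z) - hess G z (0, a) (0, u z) - hess G z (V z) (0, a)"
      using euler_third[of "V z" "(0, a)"] by (simp add: V_def)
    also have "\<dots> = (k - 1) * D G z (a, 0) - g z (u z) a"
      using spray_eq[OF z, of a]
      by (simp add: g_def hess_commute[OF z, of "(0, a)"] algebra_simps)
    finally have 1: "third G z (0, snd z) (V z) (0, a) = (k - 1) * D G z (a, 0) - g z (u z) a" .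
    have 2: "hess G z (0, snd z) (a, 0) = k * D G z (a, 0)"
      using euler_hess[OF z, of "(a, 0)"] linear_0[OF linear_Df[OF z]]
      by (simp add: zero_prod_def hess_commute[OF z, of "(0, snd z)"])
    have 3: "hess G z (snd z, N z (snd z)) (0, a) = D G z (a, 0) - g z (u z) a + g z (N z (snd z)) a"
      using hess_split[OF z, of "snd z" "u z"] hess_split[OF z, of "snd z" "N z (snd z)"]
        spray_eq[OF z, of a] by (simp add: V_def g_def)
    have 4: "third G z (0, snd z) (V z) (0, a) + hess G z (snd z, N z (snd z)) (0, a)
        = hess G z (0, snd z) (a, 0)"
      using spray_eq_deriv[of "(0, snd z)" a] by (simp add: N_def)
    have "g z (N z (snd z)) a = 2 * g z (u z) a"
      using 4 unfolding 1 2 3 by (simp add: left_diff_distrib)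
    then show ?thesis
      by (simp add: bilinear_lsub[OF bilinear_g[OF z]] bilinear_lmul[OF bilinear_g[OF z]])
  qed
  then show ?thesis using g_nondegenerate[OF z, of "N z (snd z) - 2 *\<^sub>R u z"] by simp
qed

end

text \<open>The radial field \<open>L\<close> satisfies \<open>[L, V] = V\<close>, because
  \<open>u\<close> has degree 2. Applied to the components of \<open>g\<close>, which have degree
  \<open>k - 2\<close>, this gives their derivatives along \<open>V\<close> degree
  \<open>k - 1\<close>.\<close>

lemma D_psi_radial:
  assumes z: "z \<in> W"
  shows "D (\<lambda>y. psi y a b) z (0, snd z) = (k - 1) * psi z a b"
proof -
  interpret gab: smooth_function W "\<lambda>y. g y a b"
    by unfold_locales (rule open_W smooth_g)+
  have psi: "psi y a b = D (\<lambda>y. g y a b) y (V y)" for y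
    by (simp add: psi_def third_def g_def)
  have Dg: "D (\<lambda>y. g y a b) y X = third G y X (0, a) (0, b)" for y X
    by (simp add: third_def g_def)
  have "D (\<lambda>y. D (\<lambda>y. g y a b) y (0, snd y)) z (V z) = D (\<lambda>y. (k - 2) * g y a b) z (V z)"
    using D_cong_open[OF open_W z, of "\<lambda>y. D (\<lambda>y. g y a b) y (0, snd y)" "\<lambda>y. (k - 2) * g y a b"]
    by (simp add: Dg D_g_radial)
  then have 1: "hess (\<lambda>y. g y a b) z (V z) (0, snd z) + D (\<lambda>y. g y a b) z (0, u z) = (k - 2) * psi z a b"
    using D_contract[OF open_W gab.smooth_Df smooth_L gab.linear_Df z, of "V z"] D_L[OF z, of "V z"]
      D_cmult[OF smooth_g z]
    by (simp add: hess_def psi V_def)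
  have "D (\<lambda>y. psi y a b) z (0, snd z)
      = hess (\<lambda>y. g y a b) z (0, snd z) (V z) + D (\<lambda>y. g y a b) z (snd z, 2 *\<^sub>R u z)"
    using D_contract[OF open_W gab.smooth_Df smooth_V gab.linear_Df z, of "(0, snd z)"]
    by (simp add: psi hess_def D_V z N_radial N_def[symmetric])
  moreover have "(snd z, 2 *\<^sub>R u z) = V z + (0, u z)"
    by (simp add: V_def scaleR_2)
  ultimately have "D (\<lambda>y. psi y a b) z (0, snd z)
      = hess (\<lambda>y. g y a b) z (V z) (0, snd z) + psi z a b + D (\<lambda>y. g y a b) z (0, u z)"
    using linear_add[OF gab.linear_Df[OF z], of "V z" "(0, u z)"]
      gab.hess_commute[OF z, of "V z" "(0, snd z)"] psi[of z] by simp
  then show ?thesis using 1 by (simp add: algebra_simps)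
qed

text \<open>The vertical parts occur exactly in the combinations that
  \<open>metric_compatible\<close> annihilates, and the two terms \<open>g z (snd X) (snd Y)\<close>
  cancel.\<close>

lemma tid_horizontal:
  assumes z: "z \<in> W"
  shows "tid z X Y = (1/2) * (D (\<lambda>y. psi y (fst X) (fst Y)) z (V z)
    + g z (D u z (fst X, 0)) (fst Y) + g z (fst X) (D u z (fst Y, 0)))
    - (1/4) * g z (N z (fst X)) (N z (fst Y))"
proof -
  note bl = bilinear_lsub[OF bilinear_g[OF z]] bilinear_rsub[OF bilinear_g[OF z]]
    bilinear_ladd[OF bilinear_g[OF z]] bilinear_radd[OF bilinear_g[OF z]]
    bilinear_lmul[OF bilinear_g[OF z]] bilinear_rmul[OF bilinear_g[OF z]]
  have "2 * psi z (snd X) (fst Y) + g z (N z (snd X)) (fst Y) + g z (snd X) (N z (fst Y)) = 0"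
    "2 * psi z (fst X) (snd Y) + g z (N z (fst X)) (snd Y) + g z (fst X) (N z (snd Y)) = 0"
    by (rule metric_compatible[OF z])+
  moreover have "g z (snd X - (1/2) *\<^sub>R N z (fst X)) (snd Y - (1/2) *\<^sub>R N z (fst Y))
    = g z (snd X) (snd Y) - (1/2) * g z (N z (fst X)) (snd Y) - (1/2) * g z (snd X) (N z (fst Y))
      + (1/4) * g z (N z (fst X)) (N z (fst Y))"
    by (simp add: bl algebra_simps)
  moreover have "D u z X = D u z (fst X, 0) + N z (snd X)" "D u z Y = D u z (fst Y, 0) + N z (snd Y)"
    using Du_split[OF z, of "fst X" "snd X"] Du_split[OF z, of "fst Y" "snd Y"] by simp_all
  ultimately show ?thesis
    unfolding tid_def by (simp only: bl) argo
qed

lemma tid_commute: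
  assumes z: "z \<in> W"
  shows "tid z X Y = tid z Y X"
proof -
  have "D (\<lambda>y. psi y (fst X) (fst Y)) z = D (\<lambda>y. psi y (fst Y) (fst X)) z"
    by (rule D_cong_open[OF open_W z psi_commute])
  then show ?thesis
    unfolding tid_horizontal[OF z] by (simp add: g_commute[OF z])
qed

lemma linear_tid:
  assumes z: "z \<in> W"
  shows "linear (tid z X)"
proof -
  have *: "linear (\<lambda>b. D (\<lambda>y. psi y a b) z (V z))" for a
    using bilinear_psi by (intro linear_D_family[OF open_W smooth_psi _ z]) (simp add: bilinear_def)
  have gl: "linear (g z a)" for a
    using bilinear_g[OF z] by (simp add: bilinear_def)
  have f: "linear (\<lambda>Y::'n vec2. fst Y)" by (rule linear_fst)
  have s: "linear (\<lambda>Y::'n vec2. (fst Y, 0::real ^ 'n))" by (auto intro!: linearI)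
  have 1: "linear (\<lambda>Y::'n vec2. D (\<lambda>y. psi y (fst X) (fst Y)) z (V z))"
    using linear_compose[OF f *] unfolding o_def .
  have 2: "linear (\<lambda>Y::'n vec2. g z (D u z (fst X, 0)) (fst Y))"
    using linear_compose[OF f gl] unfolding o_def .
  have 3: "linear (\<lambda>Y::'n vec2. g z (fst X) (D u z (fst Y, 0)))"
    using linear_compose[OF linear_compose[OF s linear_Du[OF z]] gl] unfolding o_def .
  have 4: "linear (\<lambda>Y::'n vec2. g z (N z (fst X)) (N z (fst Y)))"
    using linear_compose[OF linear_compose[OF f linear_N[OF z]] gl] unfolding o_def .
  from 1 2 3 4 have "linear (\<lambda>Y::'n vec2. (1/2) *\<^sub>R (D (\<lambda>y. psi y (fst X) (fst Y)) z (V z)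
    + g z (D u z (fst X, 0)) (fst Y) + g z (fst X) (D u z (fst Y, 0)))
    - (1/4) *\<^sub>R g z (N z (fst X)) (N z (fst Y)))"
    by (intro linear_compose_sub linear_compose_add linear_compose_scale_right)
  then show ?thesis
    unfolding real_scaleR_def by (simp only: tid_horizontal[OF z, of X, symmetric])
qed

lemma bilinear_tid:
  assumes z: "z \<in> W"
  shows "bilinear (tid z)"
proof -
  have "linear (\<lambda>Y. tid z Y X)" for X
    using linear_tid[OF z, of X] unfolding tid_commute[OF z, of X] .
  then show ?thesis using linear_tid[OF z] by (simp add: bilinear_def)
qed

lemma tid_spray:
  assumes z: "z \<in> W" and X: "fst X = snd z"
  shows "tid z X Y = 0"
proof -
  let ?a = "fst Y" and ?v = "snd z"
  have lin: "linear (\<lambda>b. psi y b ?a)" "linear (\<lambda>b. g y b ?a)" if "y \<in> W" for y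
    using bilinear_psi[OF that] bilinear_g[OF that] by (auto simp: bilinear_def)
  \<comment> \<open>A contraction of the twice differentiated Euler relation. It holds throughout
    \<open>W\<close>, so it can be differentiated along \<open>V\<close>, which produces the
    derivative of \<open>psi\<close> that occurs in the tidal tensor.\<close>
  have eq: "psi y (snd y) ?a + g y (u y) ?a = (k - 1) * D G y (?a, 0)" if y: "y \<in> W" for y
  proof -
    have "third G y (V y) (0, ?a) (0, snd y) + hess G y (0, ?a) (0, u y) = (k - 1) * hess G y (0, ?a) (V y)"
      using euler_third[OF y, of "V y" "(0, ?a)"] hess_commute[OF y, of "V y"] by (simp add: V_def algebra_simps)
    then show ?thesis
      using third_commute2[OF y, of "V y" "(0, ?a)" "(0, snd y)"] hess_commute[OF y, of "(0, ?a)"]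
        spray_eq[OF y, of ?a] by (simp add: psi_def g_def)
  qed
  have sm: "smooth_on W (\<lambda>y. psi y (snd y) ?a)" "smooth_on W (\<lambda>y. g y (u y) ?a)"
    using smooth_on_contract[OF open_W smooth_psi smooth_snd lin(1)]
      smooth_on_contract[OF open_W smooth_g smooth_u lin(2)] by auto
  have "D (\<lambda>y. psi y (snd y) ?a + g y (u y) ?a) z = D (\<lambda>y. (k - 1) * D G y (?a, 0)) z"
    by (rule D_cong_open[OF open_W z eq])
  then have "D (\<lambda>y. psi y (snd y) ?a) z (V z) + D (\<lambda>y. g y (u y) ?a) z (V z)
      = (k - 1) * hess G z (V z) (?a, 0)"
    using D_add[OF sm z] D_cmult[OF smooth_DG z] by (simp add: hess_def)
  moreover have "D (\<lambda>y. psi y (snd y) ?a) z (V z) = D (\<lambda>y. psi y ?v ?a) z (V z) + psi z (u z) ?a"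
    using D_contract[OF open_W smooth_psi smooth_snd lin(1) z] by (simp add: D_snd V_def)
  moreover have "D (\<lambda>y. g y (u y) ?a) z (V z) = psi z (u z) ?a + g z (D u z (V z)) ?a"
    using D_contract[OF open_W smooth_g smooth_u lin(2) z] by (simp add: D_g psi_def)
  moreover have "D u z (V z) = D u z (?v, 0) + N z (u z)"
    unfolding V_def by (rule Du_split[OF z])
  moreover have "g z ?v (D u z (?a, 0)) = - (k - 1) * hess G z (V z) (?a, 0)"
  proof -
    have "D G z (0, D u z (?a, 0)) = - hess G z (?a, 0) (V z)"
      using D_spray_deriv[OF z, of "(?a, 0)"] by simp
    then show ?thesis
      using g_radial[OF z, of "D u z (?a, 0)"] g_commute[OF z, of ?v] hess_commute[OF z, of "V z"]
      by (simp add: algebra_simps)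
  qed
  moreover have "2 * psi z (u z) ?a + g z (N z (u z)) ?a + g z (u z) (N z ?a) = 0"
    by (rule metric_compatible[OF z])
  ultimately show ?thesis
    unfolding tid_horizontal[OF z] X
    by (simp add: N_radial[OF z] bilinear_ladd[OF bilinear_g[OF z]] bilinear_lmul[OF bilinear_g[OF z]]
        algebra_simps)
qed

end

section \<open>Two functions with the same zero set\<close>

lemma D_tangential_vec:
  fixes F F' :: "'a::real_normed_vector \<Rightarrow> 'b::euclidean_space" and G :: "'a \<Rightarrow> real"
  assumes S: "open S" and G: "smooth_on S G" and F: "smooth_on S F" "smooth_on S F'"
    and z: "z \<in> S" "G z = 0"
    and eq: "\<And>y. y \<in> S \<Longrightarrow> G y = 0 \<Longrightarrow> F y = F' y"
    and e: "D G z e \<noteq> 0" and T: "D G z T = 0"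
  shows "D F z T = D F' z T"
proof (rule euclidean_eqI)
  fix b :: 'b
  have s: "smooth_on S (\<lambda>x. F x \<bullet> b)" if "smooth_on S F" for F :: "'a \<Rightarrow> 'b"
    by (intro smooth_on_bounded_linear_comp[where L = "\<lambda>v. v \<bullet> _"] bounded_linear_inner_left that S)
  have d: "D (\<lambda>x. F x \<bullet> b) z T = D F z T \<bullet> b" if "smooth_on S F" for F :: "'a \<Rightarrow> 'b"
    by (rule D_eqI) (intro bounded_linear.has_derivative[OF bounded_linear_inner_left]
        smooth_on_has_derivative[OF that z(1)])
  show "D F z T \<bullet> b = D F' z T \<bullet> b"
    unfolding d[OF F(1), symmetric] d[OF F(2), symmetric]
    by (rule D_tangential[OF S G s[OF F(1)] s[OF F(2)] z _ e T]) (simp add: eq)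
qed

text \<open>The vector \<open>e\<close> is one vertical direction along which \<open>G\<close> has
  nonzero derivative at every point of \<open>W\<close>, so division by that derivative is
  smooth.\<close>

locale conic_pair = c1: conic_function W G k + c2: conic_function W G' p
  for W :: "'n::finite vec2 set" and G G' :: "'n vec2 \<Rightarrow> real" and k p :: real +
  fixes e :: "real ^ 'n"
  assumes zero_iff: "z \<in> W \<Longrightarrow> G' z = 0 \<longleftrightarrow> G z = 0"
    and e: "z \<in> W \<Longrightarrow> D G z (0, e) \<noteq> 0"
begin

text \<open>On the zero set this is the factor between the two differentials. Elsewhere it is just
  one smooth extension of that factor, dependent on \<open>e\<close>.\<close>

definition J where "J z = D G' z (0, e) / D G z (0, e)"

definition K where "K z X Y = hess G' z X Y - J z * hess G z X Y"

text \<open>On the zero set \<open>K\<close> is the symmetric product of \<open>dG\<close> with a one-form; evaluating it at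
  \<open>(0, e)\<close> gives the formula for that form.\<close>

definition theta where
  "theta z Y = K z (0, e) Y / D G z (0, e) - D G z Y * K z (0, e) (0, e) / (2 * (D G z (0, e))\<^sup>2)"

text \<open>Only on the zero set is \<open>c2.u - c1.u\<close> a multiple of the radial direction; the inner product
  extends the factor smoothly to \<open>W\<close>.\<close>

definition f where "f z = ((c2.u z - c1.u z) \<bullet> snd z) / (snd z \<bullet> snd z)"

text \<open>The rate of change of \<open>theta\<close> along the second spray. Its smoothness
  matters because the formula for \<open>psi\<close> that contains it is differentiated once
  more.\<close>

definition Om where "Om z a = D (\<lambda>y. theta y (0, a)) z (c2.V z)"

lemma smooth_J: "smooth_on W J"
  unfolding J_def[abs_def] by (intro smooth_on_divide c1.smooth_DG c2.smooth_DG c1.open_W e)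

lemma smooth_theta: "smooth_on W (\<lambda>z. theta z Y)"
  unfolding theta_def K_def power2_eq_square
  by (intro smooth_on_diff smooth_on_divide smooth_on_mult smooth_on_const c1.smooth_DG c1.smooth_hess
      c2.smooth_hess smooth_J c1.open_W) (auto simp: e)

lemma snd_nonzero: "z \<in> W \<Longrightarrow> snd z \<noteq> 0"
  using c1.g_radial[of z e] e[of z] c1.k bilinear_rzero[OF c1.bilinear_g[of z], of e] by auto

lemma smooth_f: "smooth_on W f"
proof -
  have "smooth_on W (\<lambda>z. \<Sum>i\<in>UNIV. (c2.u z - c1.u z) $ i * snd z $ i)"
    "smooth_on W (\<lambda>z. \<Sum>i\<in>UNIV. snd z $ i * snd z $ i)"
    by (intro smooth_on_sum smooth_on_mult c1.open_W smooth_on_diff c1.smooth_u c2.smooth_u c1.smooth_snd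
        smooth_on_bounded_linear_comp[where L = "\<lambda>v. v $ _"] bounded_linear_vec_nth)+
  then show ?thesis
    unfolding f_def[abs_def] inner_vec_def inner_real_def using snd_nonzero
    by (intro smooth_on_divide c1.open_W) (auto simp: inner_vec_def[symmetric] simp flip: inner_real_def)
qed

lemma linear_theta:
  assumes "z \<in> W"
  shows "linear (theta z)"
proof -
  have "linear (\<lambda>Y. (1 / D G z (0, e)) *\<^sub>R (hess G' z (0, e) Y - J z *\<^sub>R hess G z (0, e) Y)
    - (K z (0, e) (0, e) / (2 * (D G z (0, e))\<^sup>2)) *\<^sub>R D G z Y)"
    by (intro linear_compose_sub linear_compose_scale_right c1.linear_hess2 c2.linear_hess2 c1.linear_Df assms)
  then show ?thesis by (simp add: theta_def[abs_def] K_def mult.commute)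
qed

lemma smooth_Om: "smooth_on W (\<lambda>z. Om z a)"
  unfolding Om_def
  by (rule smooth_on_contract[OF c1.open_W smooth_on_D[OF smooth_theta] c2.smooth_V
        smooth_on_linear_D[OF smooth_theta]])

section \<open>First-order comparison on the zero set\<close>

context
  fixes z assumes z: "z \<in> W" and G0: "G z = 0"
begin

lemma tangential:
  fixes F F' :: "'n vec2 \<Rightarrow> 'b::euclidean_space"
  assumes "smooth_on W F" "smooth_on W F'" "\<And>y. y \<in> W \<Longrightarrow> G y = 0 \<Longrightarrow> F y = F' y" "D G z T = 0"
  shows "D F z T = D F' z T"
  by (rule D_tangential_vec[OF c1.open_W c1.smooth_f assms(1,2) z G0 assms(3) e[OF z] assms(4)])

lemma tangential_part: "D G z (X - (D G z X / D G z (0, e)) *\<^sub>R (0, e)) = 0"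
proof -
  note l = c1.linear_Df[OF z]
  show ?thesis
    unfolding linear_diff[OF l] linear_cmul[OF l] using e[OF z] by simp
qed

text \<open>\<open>G'\<close> agrees with 0 on the zero set, so its differential kills the
  tangential part of \<open>X\<close>; the remaining multiple of \<open>(0, e)\<close> gives the
  quotient \<open>J\<close>.\<close>

lemma D_G': "D G' z X = J z * D G z X"
proof -
  note l = c2.linear_Df[OF z]
  have "D G' z (X - (D G z X / D G z (0, e)) *\<^sub>R (0, e)) = D (\<lambda>y. 0) z (X - (D G z X / D G z (0, e)) *\<^sub>R (0, e))"
    using zero_iff tangential_part[of X]
    by (intro tangential c2.smooth_f smooth_on_const) auto
  then show ?thesis
    unfolding linear_diff[OF l] linear_cmul[OF l] by (simp add: J_def)
qed

lemma alpha_radial: "D G z (0, snd z) = 0"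
  using c1.euler[OF z] G0 by simp

text \<open>If \<open>J\<close> vanished, \<open>dG'\<close> would vanish, and by
  \<open>g_radial\<close> the nonzero radial vector would lie in the radical of the second fibre
  metric.\<close>

lemma J_nonzero: "J z \<noteq> 0"
proof
  assume "J z = 0"
  then have "c2.g z (snd z) a = 0" for a
    using c2.g_radial[OF z, of a] c2.g_commute[OF z, of a] D_G'[of "(0, a)"] by simp
  then show False using c2.g_nondegenerate[OF z] snd_nonzero[OF z] by blast
qed

end

context
  fixes z assumes z: "z \<in> W" and G0: "G z = 0"
begin

text \<open>The relation \<open>D G' = J * D G\<close> may be differentiated along a tangent vector
  of the zero set.\<close>

lemma K_tangential:
  assumes "D G z T = 0"
  shows "K z T Y = D J z T * D G z Y"
proof -
  have "D (\<lambda>y. D G' y Y) z T = D (\<lambda>y. J y * D G y Y) z T"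
    by (intro tangential[OF z G0] c2.smooth_DG smooth_on_mult c1.open_W smooth_J c1.smooth_DG D_G' assms)
  then show ?thesis
    using D_mult[OF smooth_J c1.smooth_DG z] by (simp add: K_def hess_def)
qed

text \<open>\<open>K\<close> is symmetric, and in a tangential first argument it is a multiple of
  \<open>dG\<close>; only its value on the pair \<open>(0, e)\<close>, \<open>(0, e)\<close> remains
  free. The two summands share that value equally, whence the 2 in the definition of
  \<open>theta\<close>.\<close>

lemma K_eq: "K z X Y = theta z X * D G z Y + D G z X * theta z Y"
proof -
  let ?E = "(0, e)"
  define x where "x X = D G z X / D G z ?E" for X
  define T where "T X = X - x X *\<^sub>R ?E" for X
  have Kadd: "K z (A + B) Y = K z A Y + K z B Y" "K z (r *\<^sub>R A) Y = r * K z A Y" for A B Y r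
    using linear_add[OF c1.linear_hess[OF z]] linear_add[OF c2.linear_hess[OF z]]
      linear_cmul[OF c1.linear_hess[OF z]] linear_cmul[OF c2.linear_hess[OF z]]
    by (simp_all add: K_def algebra_simps)
  have Kcom: "K z A B = K z B A" for A B
    by (simp add: K_def c1.hess_commute[OF z, of A] c2.hess_commute[OF z, of A])
  have dec: "X = T X + x X *\<^sub>R ?E" for X by (simp add: T_def)
  have 1: "K z X Y = D J z (T X) * D G z Y + x X * K z ?E Y" for X Y
    using K_tangential[OF tangential_part[OF z G0]] Kadd dec[of X]
    by (metis T_def x_def)
  have 2: "K z ?E Y = D J z (T Y) * D G z ?E + x Y * K z ?E ?E" for Y
    using 1[of Y ?E] Kcom by simp
  have 3: "D G z X = x X * D G z ?E" for X using e[OF z] by (simp add: x_def)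
  have th: "theta z Y = D J z (T Y) + x Y * K z ?E ?E / (2 * D G z ?E)" for Y
    unfolding theta_def 2[of Y] 3[of Y] using e[OF z] by (simp add: field_simps power2_eq_square)
  show ?thesis
    unfolding 1[of X Y] 2[of Y] th 3[of X] 3[of Y] using e[OF z] by (simp add: field_simps)
qed

lemma hess_G': "hess G' z X Y = J z * hess G z X Y + theta z X * D G z Y + D G z X * theta z Y"
  using K_eq[of X Y] by (simp add: K_def)

lemma g'_eq: "c2.g z a b = J z * c1.g z a b + theta z (0, a) * D G z (0, b) + D G z (0, a) * theta z (0, b)"
  by (simp add: c1.g_def c2.g_def hess_G')

lemma u'_eq: "c2.u z = c1.u z + f z *\<^sub>R snd z"
proof -
  \<comment> \<open>The first spray satisfies the Euler-Lagrange equation of \<open>G'\<close> up to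
    the error \<open>theta z (c1.V z) * D G z (0, a)\<close>. By \<open>g_radial\<close> for
    \<open>G'\<close>, adding \<open>r\<close> times the radial vector contributes
    \<open>r * (p - 1) * J z * D G z (0, a)\<close>, and \<open>r\<close> makes the two
    cancel.\<close>
  define r where "r = - theta z (c1.V z) / ((p - 1) * J z)"
  have "c2.g z (c1.u z + r *\<^sub>R snd z - c2.u z) a = 0" for a
  proof -
    have r: "r * ((p - 1) * J z) = - theta z (c1.V z)"
      using J_nonzero[OF z G0] c2.k by (simp add: r_def)
    have gv: "c2.g z (snd z) a = (p - 1) * (J z * D G z (0, a))"
      using c2.g_radial[OF z, of a] c2.g_commute[OF z, of a] D_G'[OF z G0, of "(0, a)"] by simp
    have "hess G' z (c1.V z) (0, a) = J z * D G z (a, 0) + theta z (c1.V z) * D G z (0, a)"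
      using hess_G'[of "c1.V z" "(0, a)"] c1.spray_eq[OF z, of a] c1.D_spray[OF z] by simp
    moreover have "hess G' z (c2.V z) (0, a) = J z * D G z (a, 0)"
      using c2.spray_eq[OF z, of a] D_G'[OF z G0, of "(a, 0)"] by simp
    moreover have "hess G' z (c1.V z) (0, a) - hess G' z (c2.V z) (0, a) = c2.g z (c1.u z) a - c2.g z (c2.u z) a"
      using c2.hess_split[OF z, of "snd z" "c1.u z"] c2.hess_split[OF z, of "snd z" "c2.u z"]
      by (simp add: c1.V_def c2.V_def c2.g_def)
    ultimately have "c2.g z (c1.u z) a - c2.g z (c2.u z) a + r * c2.g z (snd z) a
      = (theta z (c1.V z) + r * ((p - 1) * J z)) * D G z (0, a)"
      unfolding gv by (simp add: algebra_simps)
    then show ?thesis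
      unfolding r
      by (simp add: bilinear_lsub[OF c2.bilinear_g[OF z]] bilinear_ladd[OF c2.bilinear_g[OF z]]
          bilinear_lmul[OF c2.bilinear_g[OF z]])
  qed
  then have "c1.u z + r *\<^sub>R snd z - c2.u z = 0" using c2.g_nondegenerate[OF z] by blast
  then have *: "c2.u z = c1.u z + r *\<^sub>R snd z" by simp
  \<comment> \<open>The inner product with the radial vector in the definition of \<open>f\<close>
    recovers the factor, because the difference of the sprays is radial here.\<close>
  then have "f z = r" using snd_nonzero[OF z] by (simp add: f_def)
  then show ?thesis using * by simp
qed

lemma V'_eq: "c2.V z = c1.V z + f z *\<^sub>R (0, snd z)"
  by (simp add: c1.V_def c2.V_def u'_eq)

lemma V'_tangential: "D G z (c2.V z) = 0"
  using c2.D_spray[OF z] D_G'[OF z G0, of "c2.V z"] J_nonzero[OF z G0] by simp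

lemma hess_V'_vertical: "hess G z (c2.V z) (0, a) = D G z (a, 0) + f z * (k - 1) * D G z (0, a)"
proof -
  note l = c1.linear_hess[OF z]
  show ?thesis
    unfolding V'_eq linear_add[OF l] linear_cmul[OF l]
    using c1.spray_eq[OF z, of a] c1.g_radial[OF z, of a] c1.g_commute[OF z, of a]
    by (simp add: c1.g_def)
qed

lemma hess_V'_horizontal: "hess G z (c2.V z) (a, 0) = hess G z (c1.V z) (a, 0) + f z * k * D G z (a, 0)"
proof -
  note l = c1.linear_hess[OF z]
  have "hess G z (0, snd z) (a, 0) = k * D G z (a, 0)"
    using c1.euler_hess[OF z, of "(a, 0)"] c1.hess_commute[OF z, of "(a, 0)"] linear_0[OF c1.linear_Df[OF z]]
    by (simp add: zero_prod_def)
  then show ?thesis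
    unfolding V'_eq linear_add[OF l] linear_cmul[OF l] by simp
qed

text \<open>Differentiating \<open>D G' (0, e) = J * D G (0, e)\<close> along the second spray and
  using both Euler-Lagrange equations leaves only the radial correction, with the degree
  \<open>k - 1\<close> of \<open>alpha\<close>.\<close>

lemma D_J_V': "D J z (c2.V z) = - f z * (k - 1) * J z"
proof -
  have "D (\<lambda>y. D G' y (0, e)) z (c2.V z) = D (\<lambda>y. J y * D G y (0, e)) z (c2.V z)"
    by (intro tangential[OF z G0] c2.smooth_DG smooth_on_mult c1.open_W smooth_J c1.smooth_DG D_G' V'_tangential)
  then have "hess G' z (c2.V z) (0, e) = J z * hess G z (c2.V z) (0, e) + D J z (c2.V z) * D G z (0, e)"
    using D_mult[OF smooth_J c1.smooth_DG z] by (simp add: hess_def)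
  then have "(D J z (c2.V z) + f z * (k - 1) * J z) * D G z (0, e) = 0"
    unfolding c2.spray_eq[OF z] hess_V'_vertical D_G'[OF z G0] by (simp add: algebra_simps)
  then show ?thesis using e[OF z] by simp
qed

text \<open>The radial part of the second spray contributes \<open>f\<close> times the degree of
  homogeneity, here \<open>k - 2\<close>. In the following rules the degrees are
  \<open>k - 1\<close> for \<open>alpha\<close> and \<open>psi\<close>, and \<open>k\<close> for
  \<open>\<partial>G/\<partial>x\<close>.\<close>

lemma D_g_V': "D (\<lambda>y. c1.g y a b) z (c2.V z) = c1.psi z a b + f z * (k - 2) * c1.g z a b"
proof -
  note l = smooth_on_linear_D[OF c1.smooth_g z]
  show ?thesis
    unfolding V'_eq linear_add[OF l] linear_cmul[OF l]
    using c1.D_g_radial[OF z, of a b] by (simp add: c1.D_g c1.psi_def)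
qed

lemma D_alpha_V': "D (\<lambda>y. D G y (0, a)) z (c2.V z) = D G z (a, 0) + f z * (k - 1) * D G z (0, a)"
  using hess_V'_vertical by (simp add: hess_def)

lemma D_beta_V': "D (\<lambda>y. D G y (a, 0)) z (c2.V z) = hess G z (c1.V z) (a, 0) + f z * k * D G z (a, 0)"
  using hess_V'_horizontal by (simp add: hess_def)

lemma D_psi_V': "D (\<lambda>y. c1.psi y a b) z (c2.V z)
  = D (\<lambda>y. c1.psi y a b) z (c1.V z) + f z * (k - 1) * c1.psi z a b"
proof -
  note l = smooth_on_linear_D[OF c1.smooth_psi z]
  show ?thesis
    unfolding V'_eq linear_add[OF l] linear_cmul[OF l] by (simp add: c1.D_psi_radial[OF z])
qed

end

section \<open>Comparison of the derivatives along the second spray, and of the tidal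
  tensors\<close>

lemma psi'_eq:
  assumes z: "z \<in> W" and G0: "G z = 0"
  shows "c2.psi z a b = J z * c1.psi z a b - f z * J z * c1.g z a b
    + Om z a * D G z (0, b) + theta z (0, a) * (D G z (b, 0) + f z * (k - 1) * D G z (0, b))
    + Om z b * D G z (0, a) + theta z (0, b) * (D G z (a, 0) + f z * (k - 1) * D G z (0, a))"
proof -
  note sm = smooth_J c1.smooth_g smooth_theta c1.smooth_DG
  note sp = smooth_on_add[OF c1.open_W] smooth_on_mult[OF c1.open_W] sm
  have "c2.psi z a b = D (\<lambda>y. c2.g y a b) z (c2.V z)"
    by (simp add: c2.psi_def c2.D_g)
  \<comment> \<open>The relation between the fibre metrics holds only on the zero set; its
    derivative is legitimate because the second spray is tangential.\<close>
  also have "\<dots> = D (\<lambda>y. J y * c1.g y a b + theta y (0, a) * D G y (0, b) + D G y (0, a) * theta y (0, b)) z (c2.V z)"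
    by (rule tangential[OF z G0 c2.smooth_g _ g'_eq V'_tangential[OF z G0]]) (intro sp)
  also have "\<dots> = J z * D (\<lambda>y. c1.g y a b) z (c2.V z) + D J z (c2.V z) * c1.g z a b
      + (theta z (0, a) * D (\<lambda>y. D G y (0, b)) z (c2.V z) + Om z a * D G z (0, b))
      + (D G z (0, a) * Om z b + D (\<lambda>y. D G y (0, a)) z (c2.V z) * theta z (0, b))"
    unfolding Om_def
    by (subst D_add[OF _ _ z] D_mult[OF _ _ z], (intro sp)+)+ simp
  finally show ?thesis
    unfolding D_g_V'[OF z G0] D_J_V'[OF z G0] D_alpha_V'[OF z G0] by (simp add: algebra_simps)
qed

context
  fixes z assumes z: "z \<in> W" and G0: "G z = 0"
begin

lemma D_psi'_V':
  assumes a: "D G z (0, a) = 0"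
  shows "D (\<lambda>y. c2.psi y a a) z (c2.V z) = J z * D (\<lambda>y. c1.psi y a a) z (c1.V z)
    - f z * J z * c1.psi z a a + 4 * Om z a * D G z (a, 0)
    + 2 * theta z (0, a) * (hess G z (c1.V z) (a, 0) + f z * (2 * k - 1) * D G z (a, 0))
    + ((f z)\<^sup>2 * J z - D f z (c2.V z) * J z) * c1.g z a a"
proof -
  note sm = smooth_J c1.smooth_g c1.smooth_psi smooth_theta c1.smooth_DG smooth_Om smooth_f smooth_on_const
  note sp = smooth_on_add[OF c1.open_W] smooth_on_mult[OF c1.open_W] sm
  \<comment> \<open>The summands with \<open>D G y (0, a)\<close> vanish at \<open>z\<close>, but
    their derivatives along the second spray do not: by the Euler-Lagrange equation they produce
    \<open>D G z (a, 0)\<close>. With the derivative of \<open>theta\<close> this accounts for the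
    coefficient 4 of \<open>Om\<close>.\<close>
  let ?R = "\<lambda>y. J y * c1.psi y a a + (-1) * (f y * (J y * c1.g y a a))
    + 2 * (Om y a * D G y (0, a)) + 2 * (theta y (0, a) * (D G y (a, 0) + (k - 1) * (f y * D G y (0, a))))"
  have "D (\<lambda>y. c2.psi y a a) z (c2.V z) = D ?R z (c2.V z)"
  proof (rule tangential[OF z G0 c2.smooth_psi _ _ V'_tangential[OF z G0]])
    show "smooth_on W ?R" by (intro sp)
    show "c2.psi y a a = ?R y" if "y \<in> W" "G y = 0" for y
      unfolding psi'_eq[OF that] by (simp add: algebra_simps)
  qed
  also have "\<dots> = J z * D (\<lambda>y. c1.psi y a a) z (c2.V z) + D J z (c2.V z) * c1.psi z a a
      - (f z * (J z * D (\<lambda>y. c1.g y a a) z (c2.V z) + D J z (c2.V z) * c1.g z a a)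
         + D f z (c2.V z) * (J z * c1.g z a a))
      + 2 * (Om z a * D (\<lambda>y. D G y (0, a)) z (c2.V z) + D (\<lambda>y. Om y a) z (c2.V z) * D G z (0, a))
      + 2 * (theta z (0, a) * (D (\<lambda>y. D G y (a, 0)) z (c2.V z)
           + (k - 1) * (f z * D (\<lambda>y. D G y (0, a)) z (c2.V z) + D f z (c2.V z) * D G z (0, a)))
         + Om z a * (D G z (a, 0) + (k - 1) * (f z * D G z (0, a))))"
    unfolding Om_def[of z a, symmetric]
    by (subst D_add[OF _ _ z] D_mult[OF _ _ z] D_cmult[OF _ z], (intro sp)+)+ (simp add: Om_def)
  finally show ?thesis
    unfolding D_g_V'[OF z G0] D_J_V'[OF z G0] D_alpha_V'[OF z G0] D_beta_V'[OF z G0]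
      D_psi_V'[OF z G0] a
    by (simp add: algebra_simps power2_eq_square)
qed

lemma D_u'_tangential:
  assumes "D G z X = 0"
  shows "D c2.u z X = D c1.u z X + D f z X *\<^sub>R snd z + f z *\<^sub>R snd X"
proof -
  have s: "smooth_on W (\<lambda>y. f y *\<^sub>R snd y)"
    by (intro smooth_on_scaleR smooth_f c1.smooth_snd c1.open_W)
  have "D c2.u z X = D (\<lambda>y. c1.u y + f y *\<^sub>R snd y) z X"
    by (intro tangential[OF z G0] c2.smooth_u smooth_on_add c1.smooth_u s c1.open_W u'_eq assms)
  then show ?thesis
    using D_add[OF c1.smooth_u s z, of X] D_scaleR[OF smooth_f c1.smooth_snd z, of X] by (simp add: c1.D_snd)
qed

lemma N'_eq:
  assumes "D G z (0, a) = 0"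
  shows "c2.N z a = c1.N z a + f z *\<^sub>R a + D f z (0, a) *\<^sub>R snd z"
  using D_u'_tangential[OF assms] by (simp add: c1.N_def c2.N_def)

lemma g'_radial: "c2.g z (snd z) a = (p - 1) * J z * D G z (0, a)"
  using c2.g_radial[OF z, of a] c2.g_commute[OF z, of a] D_G'[OF z G0, of "(0, a)"] by simp

text \<open>The derivative of the energy conservation law in the direction
  \<open>(0, a)\<close>.\<close>

lemma D_G_N: "D G z (0, c1.N z a) = - 2 * D G z (a, 0)"
proof -
  have "hess G z (0, a) (c1.V z) = D G z (a, 0)"
    using c1.hess_commute[OF z, of "(0, a)"] c1.spray_eq[OF z] by simp
  then show ?thesis
    using c1.D_spray_deriv[OF z, of "(0, a)"] c1.D_split[OF z, of a "c1.N z a"]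
    by (simp add: c1.N_def)
qed

text \<open>Differentiating the explicit value of \<open>f\<close> would bring in vertical
  derivatives of \<open>theta\<close>. Instead \<open>f\<close> is read off from the connection
  coefficients: the formulas for \<open>N\<close> of \<open>G\<close> and of \<open>G'\<close> are
  compared against the transverse vector \<open>e\<close>.\<close>

lemma D_f_vertical:
  assumes a: "D G z (0, a) = 0"
  shows "D f z (0, a) * ((p - 1) * J z)
    = - theta z (a, 0) - Om z a - f z * k * theta z (0, a) - theta z (0, c1.N z a)"
proof -
  note bl = bilinear_ladd[OF c2.bilinear_g[OF z]] bilinear_lmul[OF c2.bilinear_g[OF z]]
  note N1 = c1.N_eq[OF z, of a e, unfolded c1.psi_commute[OF z, of e a]]
  note N2 = c2.N_eq[OF z, of a e, unfolded c2.psi_commute[OF z, of e a]]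
  have 1: "c2.g z (c2.N z a) e = J z * c1.g z (c1.N z a) e
      + theta z (0, c1.N z a) * D G z (0, e) - 2 * D G z (a, 0) * theta z (0, e)
      + f z * (J z * c1.g z a e + theta z (0, a) * D G z (0, e))
      + D f z (0, a) * ((p - 1) * J z) * D G z (0, e)"
    unfolding N'_eq[OF a] bl g'_radial
    unfolding g'_eq[OF z G0] D_G_N a by (simp add: algebra_simps)
  have 2: "hess G' z (0, a) (e, 0) = J z * hess G z (0, a) (e, 0) + theta z (0, a) * D G z (e, 0)"
    "hess G' z (a, 0) (0, e) = J z * hess G z (a, 0) (0, e) + theta z (a, 0) * D G z (0, e)
      + D G z (a, 0) * theta z (0, e)"
    by (simp_all add: hess_G'[OF z G0] a)
  have 3: "c2.psi z a e = J z * c1.psi z a e - f z * J z * c1.g z a e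
    + Om z a * D G z (0, e) + theta z (0, a) * (D G z (e, 0) + f z * (k - 1) * D G z (0, e))
    + theta z (0, e) * D G z (a, 0)"
    unfolding psi'_eq[OF z G0] a by simp
  \<comment> \<open>The terms with \<open>theta z (0, e)\<close> and with
    \<open>D G z (e, 0)\<close> cancel, and the rest is a multiple of
    \<open>D G z (0, e)\<close>.\<close>
  have "(D f z (0, a) * ((p - 1) * J z) + theta z (a, 0) + Om z a + f z * k * theta z (0, a)
      + theta z (0, c1.N z a)) * D G z (0, e) = 0"
    using N2 unfolding 1 2 3 N1 by (simp add: algebra_simps)
  then show ?thesis using e[OF z] by simp
qed

text \<open>The computation uses \<open>tid_def\<close> and not \<open>tid_horizontal\<close>:
  \<open>c2.u\<close> may be differentiated along the tangential vector \<open>X\<close>, but in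
  general not along \<open>(fst X, 0)\<close>. The vertical part of \<open>X\<close> is therefore
  carried along and its contributions cancel at the end.\<close>

lemma tid'_eq:
  assumes X: "D G z X = 0" and a: "D G z (0, fst X) = 0"
  shows "c2.tid z X X = J z * c1.tid z X X
    + (1/4 * (f z)\<^sup>2 * J z - 1/2 * D f z (c2.V z) * J z) * c1.g z (fst X) (fst X)"
proof -
  define a b where "a = fst X" and "b = snd X"
  define be where "be = D G z (a, 0)"
  define c where "c = D c1.u z X"
  define P where "P = D f z (0, a) * ((p - 1) * J z)"
  have a0: "D G z (0, a) = 0" using a by (simp add: a_def)
  \<comment> \<open>Tangency of \<open>X\<close> makes the vertical part compensate the horizontal
    derivative \<open>be\<close>. The \<open>theta\<close> terms multiplied by \<open>be\<close>
    then have to cancel, through the formula for \<open>P\<close>.\<close>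
  have b: "D G z (0, b) = - be"
    using X c1.D_split[OF z, of a b] by (simp add: a_def b_def be_def)
  have P: "P = - theta z (a, 0) - Om z a - f z * k * theta z (0, a) - theta z (0, c1.N z a)"
    unfolding P_def by (rule D_f_vertical[OF a0])
  note th = linear_add[OF linear_compose[OF linear_Pair_zero(1) linear_theta[OF z]], unfolded o_def]
    linear_cmul[OF linear_compose[OF linear_Pair_zero(1) linear_theta[OF z]], unfolded o_def]
  note al = linear_add[OF linear_compose[OF linear_Pair_zero(1) c1.linear_Df[OF z]], unfolded o_def]
    linear_cmul[OF linear_compose[OF linear_Pair_zero(1) c1.linear_Df[OF z]], unfolded o_def]
  note bl1 = bilinear_ladd[OF c1.bilinear_g[OF z]] bilinear_lmul[OF c1.bilinear_g[OF z]]
    bilinear_radd[OF c1.bilinear_g[OF z]] bilinear_rmul[OF c1.bilinear_g[OF z]]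
    bilinear_lsub[OF c1.bilinear_g[OF z]] bilinear_rsub[OF c1.bilinear_g[OF z]]
  note bl2 = bilinear_ladd[OF c2.bilinear_g[OF z]] bilinear_lmul[OF c2.bilinear_g[OF z]]
    bilinear_radd[OF c2.bilinear_g[OF z]] bilinear_rmul[OF c2.bilinear_g[OF z]]
    bilinear_lsub[OF c2.bilinear_g[OF z]] bilinear_rsub[OF c2.bilinear_g[OF z]]
  have t1: "c1.tid z X X = 1/2 * D (\<lambda>y. c1.psi y a a) z (c1.V z) + 2 * c1.psi z a b
      + c1.g z c a + c1.g z (c1.N z a) b - 1/4 * c1.g z (c1.N z a) (c1.N z a)"
    unfolding c1.tid_def a_def[symmetric] b_def[symmetric] c_def[symmetric] bl1
    using c1.psi_commute[OF z, of a b] c1.g_commute[OF z, of a c] c1.g_commute[OF z, of b "c1.N z a"]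
    by (simp add: field_simps)
  have t2: "c2.tid z X X = 1/2 * D (\<lambda>y. c2.psi y a a) z (c2.V z) + 2 * c2.psi z a b
      + c2.g z (D c2.u z X) a + c2.g z (c2.N z a) b - 1/4 * c2.g z (c2.N z a) (c2.N z a)"
    unfolding c2.tid_def a_def[symmetric] b_def[symmetric] bl2
    using c2.psi_commute[OF z, of a b] c2.g_commute[OF z, of a "D c2.u z X"] c2.g_commute[OF z, of b "c2.N z a"]
    by (simp add: field_simps)
  have gN: "c2.g z (c2.N z a) y = J z * (c1.g z (c1.N z a) y + f z * c1.g z a y)
      + (theta z (0, c1.N z a) + f z * theta z (0, a) + P) * D G z (0, y) - 2 * be * theta z (0, y)" for y
    unfolding N'_eq[OF a0] bl2 g'_radial
    unfolding g'_eq[OF z G0] D_G_N a0 P_def be_def by (simp add: algebra_simps)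
  have vN: "D G z (0, c2.N z a) = - 2 * be"
    unfolding N'_eq[OF a0] al D_G_N a0 alpha_radial[OF z G0] be_def by simp
  have s1: "c2.g z (c2.N z a) b = J z * (c1.g z (c1.N z a) b + f z * c1.g z a b)
      - be * (theta z (0, c1.N z a) + f z * theta z (0, a) + P) - 2 * be * theta z (0, b)"
    unfolding gN b by simp
  have gNa: "c2.g z (c2.N z a) a = J z * (c1.g z (c1.N z a) a + f z * c1.g z a a) - 2 * be * theta z (0, a)"
    unfolding gN a0 by simp
  have gNN: "c2.g z (c2.N z a) (c1.N z a) = J z * (c1.g z (c1.N z a) (c1.N z a) + f z * c1.g z (c1.N z a) a)
      - 2 * be * (theta z (0, c1.N z a) + f z * theta z (0, a) + P) - 2 * be * theta z (0, c1.N z a)"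
    unfolding gN D_G_N be_def[symmetric] c1.g_commute[OF z, of a "c1.N z a"] by simp
  have s2: "c2.g z (c2.N z a) (c2.N z a)
      = J z * (c1.g z (c1.N z a) (c1.N z a) + 2 * f z * c1.g z (c1.N z a) a + (f z)\<^sup>2 * c1.g z a a)
        - 4 * be * (theta z (0, c1.N z a) + f z * theta z (0, a) + P)"
  proof -
    have "c2.g z (c2.N z a) (snd z) = (p - 1) * J z * D G z (0, c2.N z a)"
      using g'_radial[of "c2.N z a"] c2.g_commute[OF z] by simp
    then have "c2.g z (c2.N z a) (c2.N z a) = c2.g z (c2.N z a) (c1.N z a) + f z * c2.g z (c2.N z a) a
      + D f z (0, a) * ((p - 1) * J z * (- 2 * be))"
      using vN by (subst (2) N'_eq[OF a0]) (simp add: bl2)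
    then show ?thesis
      unfolding gNa gNN by (simp add: P_def algebra_simps power2_eq_square)
  qed
  have s3: "c2.g z (D c2.u z X) a = J z * (c1.g z c a + f z * c1.g z a b)
      + theta z (0, a) * (D G z (0, c) - f z * be)"
    unfolding D_u'_tangential[OF X] bl2 g'_radial
    unfolding g'_eq[OF z G0] a0 b_def[symmetric] c_def[symmetric] b c1.g_commute[OF z, of b a]
    by (simp add: algebra_simps)
  have s4: "c2.psi z a b = J z * c1.psi z a b - f z * J z * c1.g z a b
    - Om z a * be + theta z (0, a) * (D G z (b, 0) - f z * (k - 1) * be) + theta z (0, b) * be"
    unfolding psi'_eq[OF z G0] a0 b be_def[symmetric] by (simp add: algebra_simps)
  \<comment> \<open>Energy conservation differentiated along \<open>X\<close>. It rewrites the
    Hessian term of \<open>D_psi'_V'\<close> so that it cancels the multiples of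
    \<open>theta z (0, a)\<close> in \<open>s3\<close> and \<open>s4\<close>.\<close>
  have s5: "hess G z (c1.V z) (a, 0) = - 2 * D G z (b, 0) - D G z (0, c)"
  proof -
    have "hess G z X (c1.V z) = hess G z (c1.V z) (a, 0) + D G z (b, 0)"
      using c1.hess_split[OF z, of a b "c1.V z"] c1.hess_commute[OF z, of _ "c1.V z"] c1.spray_eq[OF z, of b]
      by (simp add: a_def b_def)
    moreover have "D G z (snd X, D c1.u z X) = D G z (b, 0) + D G z (0, c)"
      using c1.D_split[OF z, of b c] by (simp add: b_def c_def)
    ultimately show ?thesis using c1.D_spray_deriv[OF z, of X] by simp
  qed
  have m: "2 * c1.psi z a a + 2 * c1.g z (c1.N z a) a = 0"
    using c1.metric_compatible[OF z, of a a] c1.g_commute[OF z, of a "c1.N z a"] by simp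
  then have m: "c1.g z (c1.N z a) a = - c1.psi z a a" by simp
  show ?thesis
    unfolding t1 t2 D_psi'_V'[OF a0] s1 s2 s3 s4 s5 m P be_def[symmetric] a_def[symmetric]
    by (simp add: field_simps power2_eq_square)
qed

end

end

section \<open>Forms on quotient spaces\<close>

lemma coset_eq_iff:
  fixes K :: "'a::real_vector set"
  assumes "subspace K"
  shows "X +o K = Y +o K \<longleftrightarrow> X - Y \<in> K"
proof
  assume "X +o K = Y +o K"
  moreover have "X \<in> X +o K" using subspace_0[OF assms] by (force simp: elt_set_plus_def)
  ultimately obtain b where "b \<in> K" "X = Y + b" by (auto simp: elt_set_plus_def)
  then show "X - Y \<in> K" by simp
next
  assume d: "X - Y \<in> K"
  show "X +o K = Y +o K"
  proof (intro equalityI subsetI)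
    fix x assume "x \<in> X +o K"
    then obtain b where "b \<in> K" "x = X + b" by (auto simp: elt_set_plus_def)
    then have "(X - Y) + b \<in> K" "x = Y + ((X - Y) + b)" using subspace_add[OF assms d] by auto
    then show "x \<in> Y +o K" unfolding elt_set_plus_def by blast
  next
    fix x assume "x \<in> Y +o K"
    then obtain b where "b \<in> K" "x = Y + b" by (auto simp: elt_set_plus_def)
    then have "b - (X - Y) \<in> K" "x = X + (b - (X - Y))" using subspace_diff[OF assms _ d] by auto
    then show "x \<in> X +o K" unfolding elt_set_plus_def by blast
  qed
qed

lemma coset_coords_iff:
  fixes K :: "'a::real_vector set"
  assumes "subspace K"
  shows "coset_coords K B (X +o K) c \<longleftrightarrow> (\<forall>b. b \<notin> B \<longrightarrow> c b = 0) \<and> X - (\<Sum>b\<in>B. c b *\<^sub>R b) \<in> K"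
  by (simp add: coset_coords_def coset_eq_iff[OF assms])

text \<open>A basis of the orthogonal complement of \<open>K\<close> in \<open>L\<close> represents
  a basis of the quotient. Existence guarantees that the choice in \<open>quot_trace\<close> is a
  genuine basis.\<close>

lemma quot_basis_exists:
  fixes K L :: "'a::euclidean_space set"
  assumes K: "subspace K" and L: "subspace L" and KL: "K \<subseteq> L"
  shows "\<exists>B. quot_basis L K B"
proof -
  define M where "M = {x \<in> L. \<forall>y\<in>K. orthogonal y x}"
  have M: "subspace M"
    using L by (auto simp: M_def subspace_def orthogonal_def inner_add_right)
  obtain B where B: "B \<subseteq> M" "independent B" "M \<subseteq> span B" using maximal_independent_subset by blast
  have fin: "finite B" using B independent_bound by blast
  have MB: "span B = M" using B M by (metis span_minimal subset_antisym)
  have KM: "x = 0" if "x \<in> K" "x \<in> M" for x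
    using that by (auto simp: M_def orthogonal_self)
  have "\<exists>!c. coset_coords K B (X +o K) c" if X: "X \<in> L" for X
  proof -
    obtain y w where yw: "y \<in> span K" "\<And>x. x \<in> span K \<Longrightarrow> orthogonal w x" "X = y + w"
      using orthogonal_subspace_decomp_exists by metis
    have y: "y \<in> K" using yw(1) K by (simp add: span_eq_iff[THEN iffD2])
    have "w = X - y" using yw(3) by simp
    then have "w \<in> L" using y X KL subspace_diff[OF L] by auto
    then have "w \<in> M" using yw(2) span_base by (auto simp: M_def orthogonal_commute)
    then obtain c0 where c0: "w = (\<Sum>b\<in>B. c0 b *\<^sub>R b)"
      using MB span_finite[OF fin] by auto
    define c where "c b = (if b \<in> B then c0 b else 0)" for b
    have c: "w = (\<Sum>b\<in>B. c b *\<^sub>R b)" unfolding c0 c_def by (rule sum.cong) auto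
    show ?thesis
    proof (rule ex1I)
      show "coset_coords K B (X +o K) c"
        using y yw(3) c by (simp add: coset_coords_iff[OF K] c_def)
    next
      fix c' assume "coset_coords K B (X +o K) c'"
      then have c': "\<And>b. b \<notin> B \<Longrightarrow> c' b = 0" "X - (\<Sum>b\<in>B. c' b *\<^sub>R b) \<in> K"
        by (auto simp: coset_coords_iff[OF K])
      let ?d = "\<Sum>b\<in>B. (c b - c' b) *\<^sub>R b"
      have "?d = (X - (\<Sum>b\<in>B. c' b *\<^sub>R b)) - y"
        unfolding yw(3) c by (simp add: sum_subtractf scaleR_left_diff_distrib)
      then have "?d \<in> K" using subspace_diff[OF K c'(2) y] by simp
      moreover have "?d \<in> M" unfolding MB[symmetric] by (intro span_sum span_scale span_base)
      ultimately have "?d = 0" by (rule KM)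
      then have "\<forall>b\<in>B. c b - c' b = 0"
        using B(2) unfolding independent_explicit by (elim conjE allE[of _ "\<lambda>b. c b - c' b"]) simp
      then show "c' = c" using c'(1) by (auto simp: c_def)
    qed
  qed
  then have "quot_basis L K B"
    using fin B(1) by (auto simp: quot_basis_def quot_def M_def)
  then show ?thesis ..
qed

context
  fixes K L B :: "'a::euclidean_space set"
  assumes K: "subspace K" and L: "subspace L" and KL: "K \<subseteq> L" and B: "quot_basis L K B"
begin

lemma quot_basis_coords: "X \<in> L \<Longrightarrow> \<exists>!c. coset_coords K B (X +o K) c"
  using B by (auto simp: quot_basis_def quot_def)

lemma quot_basis_zero:
  assumes "(\<Sum>b\<in>B. c b *\<^sub>R b) \<in> K" "b \<in> B"
  shows "c b = 0"
proof -
  let ?c = "\<lambda>b. if b \<in> B then c b else 0"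
  have "(\<Sum>b\<in>B. ?c b *\<^sub>R b) = (\<Sum>b\<in>B. c b *\<^sub>R b)" by (rule sum.cong) auto
  then have "coset_coords K B (0 +o K) ?c"
    unfolding coset_coords_iff[OF K] using assms subspace_neg[OF K assms(1)] by simp
  moreover have "coset_coords K B (0 +o K) (\<lambda>b. 0)"
    unfolding coset_coords_iff[OF K] using subspace_0[OF K] by simp
  ultimately have "?c = (\<lambda>b. 0)" using quot_basis_coords[OF subspace_0[OF L]] by blast
  then show ?thesis using assms(2) by meson
qed

lemma card_quot_basis: "card B + dim K = dim L"
proof -
  have fin: "finite B" and BL: "B \<subseteq> L" using B by (auto simp: quot_basis_def)
  have ind: "independent B"
    unfolding independent_explicit using fin subspace_0[OF K] quot_basis_zero by auto
  have int: "span B \<inter> K = {0}"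
  proof -
    have "x = 0" if x: "x \<in> span B" "x \<in> K" for x
    proof -
      obtain c where c: "x = (\<Sum>b\<in>B. c b *\<^sub>R b)" using x(1) span_finite[OF fin] by auto
      then have "\<forall>b\<in>B. c b = 0" using x(2) quot_basis_zero by blast
      then show "x = 0" unfolding c by simp
    qed
    then show ?thesis using subspace_0[OF K] by (auto simp: span_zero)
  qed
  have "{x + y |x y. x \<in> span B \<and> y \<in> K} = L"
  proof (intro equalityI subsetI)
    fix x assume "x \<in> {x + y |x y. x \<in> span B \<and> y \<in> K}"
    then show "x \<in> L" using span_minimal[OF BL L] KL subspace_add[OF L] by auto
  next
    fix X assume "X \<in> L"
    then obtain c where "coset_coords K B (X +o K) c" using quot_basis_coords by blast
    then have "X - (\<Sum>b\<in>B. c b *\<^sub>R b) \<in> K" by (simp add: coset_coords_iff[OF K])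
    moreover have "(\<Sum>b\<in>B. c b *\<^sub>R b) \<in> span B" by (intro span_sum span_scale span_base)
    moreover have "X = (\<Sum>b\<in>B. c b *\<^sub>R b) + (X - (\<Sum>b\<in>B. c b *\<^sub>R b))" by simp
    ultimately show "X \<in> {x + y |x y. x \<in> span B \<and> y \<in> K}" by blast
  qed
  then have "dim L + dim (span B \<inter> K) = dim (span B) + dim K"
    using dim_sums_Int[OF subspace_span K, of B] by simp
  then show ?thesis using int dim_eq_card_independent[OF ind] by (simp add: dim_span)
qed

text \<open>Adding \<open>t\<close> times the identity to an endomorphism raises each diagonal
  coefficient by \<open>t\<close>; this is the form in which the trace computation uses it.\<close>

lemma coset_coords_add_basis:
  assumes X: "X \<in> L" and b: "b \<in> B"
  shows "(THE c. coset_coords K B ((X + t *\<^sub>R b) +o K) c) b = (THE c. coset_coords K B (X +o K) c) b + t"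
proof -
  define c where "c = (THE c. coset_coords K B (X +o K) c)"
  have "coset_coords K B (X +o K) c" unfolding c_def by (rule theI'[OF quot_basis_coords[OF X]])
  then have c: "\<And>b. b \<notin> B \<Longrightarrow> c b = 0" "X - (\<Sum>b\<in>B. c b *\<^sub>R b) \<in> K"
    by (auto simp: coset_coords_iff[OF K])
  have fin: "finite B" and BL: "B \<subseteq> L" using B by (auto simp: quot_basis_def)
  let ?c = "c(b := c b + t)"
  have "(\<Sum>x\<in>B. ?c x *\<^sub>R x) = (\<Sum>x\<in>B. c x *\<^sub>R x + (if x = b then t *\<^sub>R x else 0))"
    by (rule sum.cong) (auto simp: scaleR_add_left)
  also have "\<dots> = (\<Sum>x\<in>B. c x *\<^sub>R x) + t *\<^sub>R b" using fin b by (simp add: sum.distrib)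
  finally have "coset_coords K B ((X + t *\<^sub>R b) +o K) ?c"
    using c b by (auto simp: coset_coords_iff[OF K])
  moreover have "X + t *\<^sub>R b \<in> L" using X b BL L by (auto intro: subspace_add subspace_scale)
  ultimately have "(THE c. coset_coords K B ((X + t *\<^sub>R b) +o K) c) = ?c"
    using quot_basis_coords by (intro the1_equality) auto
  then show ?thesis by (simp add: c_def)
qed

end

lemma descend_coset:
  fixes h :: "'a::real_vector \<Rightarrow> 'a \<Rightarrow> real"
  assumes K: "subspace K" and h: "\<And>A B. A \<in> K \<Longrightarrow> B \<in> K \<Longrightarrow> h (X + A) (Y + B) = h X Y"
  shows "descend h (X +o K) (Y +o K) = h X Y"
  unfolding descend_def
proof (rule the_equality)
  show "\<forall>X'\<in>X +o K. \<forall>Y'\<in>Y +o K. h X' Y' = h X Y"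
    using h by (auto simp: elt_set_plus_def)
  fix r assume "\<forall>X'\<in>X +o K. \<forall>Y'\<in>Y +o K. h X' Y' = r"
  moreover have "X \<in> X +o K" "Y \<in> Y +o K"
    using subspace_0[OF K] by (force simp: elt_set_plus_def)+
  ultimately show "r = h X Y" by auto
qed

text \<open>The situation at one point, for the umbral kernel in \<open>Lam\<close> with the metric
  and the tidal tensor. The two null conditions let both forms descend; \<open>adjoint\<close> and
  \<open>g_radical\<close> give existence and uniqueness of the raised endomorphism.\<close>

locale quotient_forms =
  fixes K L :: "'a::euclidean_space set" and g s :: "'a \<Rightarrow> 'a \<Rightarrow> real"
  assumes K: "subspace K" and L: "subspace L" and KL: "K \<subseteq> L"
    and bil_g: "bilinear g" and bil_s: "bilinear s"
    and g_sym: "g X Y = g Y X" and s_sym: "s X Y = s Y X"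
    and g_null: "X \<in> K \<Longrightarrow> Y \<in> L \<Longrightarrow> g X Y = 0"
    and s_null: "X \<in> K \<Longrightarrow> Y \<in> L \<Longrightarrow> s X Y = 0"
    and g_radical: "X \<in> L \<Longrightarrow> (\<And>Y. Y \<in> L \<Longrightarrow> g X Y = 0) \<Longrightarrow> X \<in> K"
    and adjoint: "X \<in> L \<Longrightarrow> \<exists>T\<in>L. \<forall>Y\<in>L. g T Y = s X Y"
begin

lemma descend_form:
  assumes h: "bilinear h" "\<And>X Y. h X Y = h Y X" "\<And>X Y. X \<in> K \<Longrightarrow> Y \<in> L \<Longrightarrow> h X Y = 0"
    and X: "X \<in> L" and Y: "Y \<in> L"
  shows "descend h (X +o K) (Y +o K) = h X Y"
proof (rule descend_coset[OF K])
  fix A B assume A: "A \<in> K" and B: "B \<in> K"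
  then have "h X B = 0" "h A Y = 0" "h A B = 0"
    using h(2)[of X B] h(3) X Y KL by auto
  then show "h (X + A) (Y + B) = h X Y"
    by (simp add: bilinear_ladd[OF h(1)] bilinear_radd[OF h(1)])
qed

lemma descend_g: "X \<in> L \<Longrightarrow> Y \<in> L \<Longrightarrow> descend g (X +o K) (Y +o K) = g X Y"
  by (rule descend_form[OF bil_g g_sym g_null])

lemma descend_s: "X \<in> L \<Longrightarrow> Y \<in> L \<Longrightarrow> descend s (X +o K) (Y +o K) = s X Y"
  by (rule descend_form[OF bil_s s_sym s_null])

lemma raise_coset:
  assumes X: "X \<in> L" and T: "T \<in> L" "\<And>Y. Y \<in> L \<Longrightarrow> g T Y = s X Y"
  shows "raise (quot L K) (descend g) (descend s) (X +o K) = T +o K"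
  unfolding raise_def
proof (rule the_equality)
  show "T +o K \<in> quot L K \<and>
    (\<forall>D\<in>quot L K. descend g (T +o K) D = descend s (X +o K) D)"
    using X T descend_g descend_s by (auto simp: quot_def)
next
  fix C' assume C': "C' \<in> quot L K \<and> (\<forall>D\<in>quot L K. descend g C' D = descend s (X +o K) D)"
  then obtain T' where T': "T' \<in> L" "C' = T' +o K" by (auto simp: quot_def)
  have "g (T' - T) Y = 0" if "Y \<in> L" for Y
  proof -
    have "g T' Y = s X Y"
      using C' that T' X descend_g descend_s by (auto simp: quot_def)
    then show ?thesis using T(2)[OF that] by (simp add: bilinear_lsub[OF bil_g])
  qed
  then have "T' - T \<in> K" using g_radical T T' subspace_diff[OF L] by blast
  then show "C' = T +o K" using T' coset_eq_iff[OF K] by blast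
qed

end

text \<open>The raised endomorphism changes by \<open>c / r\<close> times the identity. The chosen
  basis depends only on \<open>L\<close> and \<open>K\<close>, so both traces use the same one and
  differ by \<open>c / r\<close> times its cardinality.\<close>

lemma quot_trace_conformal:
  assumes gs: "quotient_forms K L g s" and gs': "quotient_forms K L g' s'" and r: "r \<noteq> 0"
    and g': "\<And>X Y. X \<in> L \<Longrightarrow> Y \<in> L \<Longrightarrow> g' X Y = r * g X Y"
    and s': "\<And>X Y. X \<in> L \<Longrightarrow> Y \<in> L \<Longrightarrow> s' X Y = r * s X Y + c * g X Y"
  shows "quot_trace L K (raise (quot L K) (descend g') (descend s'))
    = quot_trace L K (raise (quot L K) (descend g) (descend s)) + (c / r) * (real (dim L) - real (dim K))"
proof -
  interpret a: quotient_forms K L g s by (rule gs)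
  interpret b: quotient_forms K L g' s' by (rule gs')
  define B where "B = (SOME B. quot_basis L K B)"
  have B: "quot_basis L K B"
    unfolding B_def by (rule someI_ex[OF quot_basis_exists[OF a.K a.L a.KL]])
  let ?T = "raise (quot L K) (descend g) (descend s)"
  let ?T' = "raise (quot L K) (descend g') (descend s')"
  have "(THE c. coset_coords K B (?T' (b +o K)) c) b = (THE c. coset_coords K B (?T (b +o K)) c) b + c / r"
    if b: "b \<in> B" for b
  proof -
    have bL: "b \<in> L" using B b by (auto simp: quot_basis_def)
    then obtain T where T: "T \<in> L" "\<And>Y. Y \<in> L \<Longrightarrow> g T Y = s b Y" using a.adjoint by blast
    have "T + (c / r) *\<^sub>R b \<in> L" using T bL a.L by (auto intro: subspace_add subspace_scale)
    moreover have "g' (T + (c / r) *\<^sub>R b) Y = s' b Y" if Y: "Y \<in> L" for Y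
      using T(1) bL Y r
      by (simp add: bilinear_ladd[OF b.bil_g] bilinear_lmul[OF b.bil_g] g' s' T(2))
    ultimately have "?T' (b +o K) = (T + (c / r) *\<^sub>R b) +o K" using b.raise_coset bL by blast
    moreover have "?T (b +o K) = T +o K" using a.raise_coset bL T by blast
    ultimately show ?thesis
      using coset_coords_add_basis[OF a.K a.L a.KL B T(1) b] by simp
  qed
  then have "quot_trace L K ?T' = quot_trace L K ?T + (c / r) * real (card B)"
    by (simp add: quot_trace_def B_def[symmetric] sum.distrib)
  then show ?thesis using card_quot_basis[OF a.K a.L a.KL B] by (simp flip: of_nat_add)
qed

lemma dim_kernel_functional:
  fixes \<phi> :: "'a::euclidean_space \<Rightarrow> real"
  assumes M: "subspace M" and \<phi>: "linear \<phi>" and x0: "x0 \<in> M" "\<phi> x0 \<noteq> 0"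
  shows "subspace {x \<in> M. \<phi> x = 0}" and "dim {x \<in> M. \<phi> x = 0} + 1 = dim M"
proof -
  let ?N = "{x \<in> M. \<phi> x = 0}"
  show N: "subspace ?N"
    using M linear_0[OF \<phi>] linear_add[OF \<phi>] linear_cmul[OF \<phi>] by (auto simp: subspace_def)
  have "{x + y |x y. x \<in> ?N \<and> y \<in> span {x0}} = M"
  proof (intro equalityI subsetI)
    fix x assume "x \<in> {x + y |x y. x \<in> ?N \<and> y \<in> span {x0}}"
    then show "x \<in> M" using M x0 by (auto simp: span_singleton intro: subspace_add subspace_scale)
  next
    fix x assume x: "x \<in> M"
    let ?y = "(\<phi> x / \<phi> x0) *\<^sub>R x0"
    have "x - ?y \<in> ?N" "?y \<in> span {x0}" "x = (x - ?y) + ?y"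
      using x x0 M by (auto simp: linear_diff[OF \<phi>] linear_cmul[OF \<phi>] span_singleton
          intro: subspace_diff subspace_scale)
    then show "x \<in> {x + y |x y. x \<in> ?N \<and> y \<in> span {x0}}" by blast
  qed
  moreover have "?N \<inter> span {x0} = {0}"
    using x0 subspace_0[OF N] by (auto simp: span_singleton linear_cmul[OF \<phi>])
  moreover have "dim (span {x0}) = 1"
    using x0 linear_0[OF \<phi>] by (auto simp: dim_insert)
  ultimately show "dim ?N + 1 = dim M"
    using dim_sums_Int[OF N subspace_span, of "{x0}"] by simp
qed

section \<open>Conformal invariance of the Weyl tensor\<close>

text \<open>One inclusion takes \<open>G\<close> itself as a test function; the other is
  \<open>D_tangential_zero\<close> for an arbitrary test function.\<close>

lemma tangent_space_level_set:
  fixes G :: "'a::euclidean_space \<Rightarrow> real"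
  assumes W: "open W" and G: "smooth_on W G" and z: "z \<in> W" "G z = 0"
    and S: "S \<inter> W = {y \<in> W. G y = 0}" and e: "D G z e \<noteq> 0"
  shows "tangent_space S z = {X. D G z X = 0}"
proof (intro equalityI subsetI)
  fix X assume "X \<in> tangent_space S z"
  then show "X \<in> {X. D G z X = 0}"
    using W G z S by (auto simp: tangent_space_def)
next
  fix X assume X: "X \<in> {X. D G z X = 0}"
  show "X \<in> tangent_space S z"
    unfolding tangent_space_def
  proof (intro CollectI allI impI)
    fix Q :: "'a set" and f :: "'a \<Rightarrow> real"
    assume Q: "open Q \<and> z \<in> Q \<and> smooth_on Q f \<and> (\<forall>y\<in>S \<inter> Q. f y = 0)"
    show "D f z X = 0"
    proof (rule D_tangential_zero[of "W \<inter> Q" G f z e])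
      show "smooth_on (W \<inter> Q) G" using smooth_on_subset[OF G] by blast
      show "f differentiable (at z)" using Q smooth_on_differentiable by blast
    qed (use W Q z S e X in auto)
  qed
qed

section \<open>The umbral bundle of one defining function\<close>

context conic_function
begin

context
  fixes z S e
  assumes z: "z \<in> W" and G0: "G z = 0" and S: "S \<inter> W = {y \<in> W. G y = 0}"
    and e: "D G z (0, e) \<noteq> 0"
begin

lemma Lam_eq: "Lam S G z = {X. D G z X = 0 \<and> D G z (0, fst X) = 0}"
  unfolding Lam_def tangent_space_level_set[OF open_W smooth_f z G0 S e] using alpha_eq[OF z] by auto

lemma alpha_snd: "D G z (0, snd z) = 0"
  using euler[OF z] G0 by simp

lemma umbral_ker_eq: "umbral_ker S G z = {X \<in> Lam S G z. fst X \<in> span {snd z}}"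
proof (intro equalityI subsetI)
  fix X assume X: "X \<in> umbral_ker S G z"
  have l: "linear (\<lambda>a. D G z (0, a))"
    using linear_compose[OF linear_Pair_zero(1) linear_Df[OF z]] by (simp add: o_def)
  have van: "g z (fst X) a = 0" if a: "D G z (0, a) = 0" for a
  proof -
    \<comment> \<open>A lift of \<open>a\<close> to \<open>Lam\<close>: the vertical component along
      \<open>e\<close> restores tangency and is invisible to the metric.\<close>
    let ?Y = "(a, - (D G z (a, 0) / D G z (0, e)) *\<^sub>R e)"
    have "D G z ?Y = D G z (a, 0) + D G z (0, - (D G z (a, 0) / D G z (0, e)) *\<^sub>R e)"
      by (rule D_split[OF z])
    also have "\<dots> = 0" unfolding linear_cmul[OF l] using e by simp
    finally have "?Y \<in> Lam S G z" using a by (simp add: Lam_eq)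
    then have "g_h G z X ?Y = 0" using X by (simp add: umbral_ker_def)
    then show ?thesis by (simp add: g_h_eq[OF z])
  qed
  \<comment> \<open>On all vectors \<open>g z (fst X)\<close> is a multiple of \<open>alpha\<close>,
    as is \<open>g z (snd z)\<close> by \<open>g_radial\<close>; \<open>s\<close> is the ratio, read
    off at \<open>e\<close>.\<close>
  define s where "s = g z (fst X) e / D G z (0, e) / (k - 1)"
  have "g z (fst X - s *\<^sub>R snd z) a = 0" for a
  proof -
    let ?r = "D G z (0, a) / D G z (0, e)"
    have "D G z (0, a - ?r *\<^sub>R e) = 0"
      unfolding linear_diff[OF l] linear_cmul[OF l] using e by simp
    then have "g z (fst X) a = ?r * g z (fst X) e"
      using van[of "a - ?r *\<^sub>R e"]
      by (simp add: bilinear_rsub[OF bilinear_g[OF z]] bilinear_rmul[OF bilinear_g[OF z]])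
    moreover have "g z (snd z) a = (k - 1) * D G z (0, a)"
      using g_radial[OF z, of a] g_commute[OF z, of a] by simp
    ultimately show ?thesis
      using k by (simp add: bilinear_lsub[OF bilinear_g[OF z]] bilinear_lmul[OF bilinear_g[OF z]] s_def)
  qed
  then have "fst X = s *\<^sub>R snd z" using g_nondegenerate[OF z, of "fst X - s *\<^sub>R snd z"] by simp
  then show "X \<in> {X \<in> Lam S G z. fst X \<in> span {snd z}}"
    using X by (auto simp: umbral_ker_def span_singleton)
next
  fix X assume X: "X \<in> {X \<in> Lam S G z. fst X \<in> span {snd z}}"
  then obtain s where s: "fst X = s *\<^sub>R snd z" by (auto simp: span_singleton)
  have "g_h G z X Y = 0" if "Y \<in> Lam S G z" for Y
    using that g_radial[OF z, of "fst Y"] g_commute[OF z, of "fst Y"]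
    by (simp add: g_h_eq[OF z] s bilinear_lmul[OF bilinear_g[OF z]] Lam_eq)
  then show "X \<in> umbral_ker S G z" using X by (auto simp: umbral_ker_def)
qed

lemma dim_Lam: "subspace (Lam S G z)" "dim (Lam S G z) + 2 = 2 * CARD('n)"
proof -
  let ?M = "{X::'n vec2 \<in> UNIV. D G z (0, fst X) = 0}"
  have l: "linear (\<lambda>X::'n vec2. D G z (0, fst X))"
    using linear_compose[OF linear_compose[OF linear_fst linear_Pair_zero(1)] linear_Df[OF z]]
    by (simp add: o_def)
  have 1: "subspace ?M" "dim ?M + 1 = dim (UNIV :: 'n vec2 set)"
    using dim_kernel_functional[OF subspace_UNIV l, of "(e, 0)"] e by auto
  have 2: "subspace {X \<in> ?M. D G z X = 0}" "dim {X \<in> ?M. D G z X = 0} + 1 = dim ?M"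
    using dim_kernel_functional[OF 1(1) linear_Df[OF z], of "(0, e)"] e linear_0[OF linear_Df[OF z]]
    by (auto simp: zero_prod_def)
  have "{X \<in> ?M. D G z X = 0} = Lam S G z" by (auto simp: Lam_eq)
  then show "subspace (Lam S G z)" "dim (Lam S G z) + 2 = 2 * CARD('n)"
    using 1 2 by simp_all
qed

text \<open>Since \<open>alpha\<close> annihilates the radial vector, only tangency constrains the
  \<open>(n + 1)\<close>-dimensional space of vectors with base part in the span of
  \<open>snd z\<close>. With \<open>dim_Lam\<close> this gives \<open>E\<close> rank
  \<open>n - 2\<close>.\<close>

lemma dim_umbral_ker: "subspace (umbral_ker S G z)" "dim (umbral_ker S G z) = CARD('n)"
proof -
  let ?M = "span {snd z} \<times> (UNIV :: (real ^ 'n) set)"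
  have l: "linear (\<lambda>a. D G z (0, a))"
    using linear_compose[OF linear_Pair_zero(1) linear_Df[OF z]] by (simp add: o_def)
  have "snd z \<noteq> 0"
    using g_radial[OF z, of e] e k bilinear_rzero[OF bilinear_g[OF z], of e] by auto
  then have "dim ?M = 1 + CARD('n)"
    using dim_Times[of "span {snd z}" "UNIV :: (real ^ 'n) set"] by (simp add: dim_insert)
  moreover have M: "subspace ?M"
    by (intro subspace_Times subspace_span subspace_UNIV)
  moreover note dim_kernel_functional[OF M linear_Df[OF z], of "(0, e)"]
  moreover have "{X \<in> ?M. D G z X = 0} = umbral_ker S G z"
    using alpha_snd by (auto simp: umbral_ker_eq Lam_eq span_singleton linear_cmul[OF l])
  ultimately show "subspace (umbral_ker S G z)" "dim (umbral_ker S G z) = CARD('n)"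
    using e by (auto simp: span_zero)
qed

lemma quotient_forms_umbral: "quotient_forms (umbral_ker S G z) (Lam S G z) (g_h G z) (tidal k G z)"
proof
  have gh: "g_h G z = (\<lambda>X Y. g z (fst X) (fst Y))" by (intro ext) (rule g_h_eq[OF z])
  have td: "tidal k G z = tid z" by (intro ext) (rule tidal_eq[OF z])
  show "subspace (umbral_ker S G z)" "subspace (Lam S G z)" by (rule dim_umbral_ker dim_Lam)+
  show KL: "umbral_ker S G z \<subseteq> Lam S G z" by (auto simp: umbral_ker_def)
  show "bilinear (g_h G z)"
    using bilinear_g[OF z] linear_compose[OF linear_fst, of "g z _"] linear_compose[OF linear_fst, of "\<lambda>a. g z a _"]
    by (auto simp: gh bilinear_def o_def)
  show "bilinear (tidal k G z)" unfolding td by (rule bilinear_tid[OF z])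
  show "g_h G z X Y = g_h G z Y X" for X Y unfolding gh by (rule g_commute[OF z])
  show "tidal k G z X Y = tidal k G z Y X" for X Y unfolding td by (rule tid_commute[OF z])
  show "g_h G z X Y = 0" if "X \<in> umbral_ker S G z" "Y \<in> Lam S G z" for X Y
    using that by (auto simp: umbral_ker_def)
  have tid0: "tid z X Y = 0" if X: "fst X \<in> span {snd z}" for X Y
  proof -
    obtain s where s: "fst X = s *\<^sub>R snd z" using X by (auto simp: span_singleton)
    have "tid z X Y = tid z (s *\<^sub>R (snd z, 0)) Y"
      unfolding tid_horizontal[OF z] by (simp add: s)
    also have "\<dots> = 0" by (subst bilinear_lmul[OF bilinear_tid[OF z]]) (simp add: tid_spray[OF z])
    finally show ?thesis .
  qed
  show "tidal k G z X Y = 0" if "X \<in> umbral_ker S G z" "Y \<in> Lam S G z" for X Y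
    using that tid0 by (simp add: td umbral_ker_eq)
  show "X \<in> umbral_ker S G z" if "X \<in> Lam S G z" "\<And>Y. Y \<in> Lam S G z \<Longrightarrow> g_h G z X Y = 0" for X
    using that by (auto simp: umbral_ker_def)
  show "\<exists>T\<in>Lam S G z. \<forall>Y\<in>Lam S G z. g_h G z T Y = tidal k G z X Y" if "X \<in> Lam S G z" for X
  proof -
    have "linear (\<lambda>a. tid z X (a, 0))"
      using linear_compose[OF linear_Pair_zero(2) linear_tid[OF z]] by (simp add: o_def)
    then obtain y where y: "g z y a = tid z X (a, 0)" for a using g_solve[OF z] by blast
    \<comment> \<open>The represented vector lies in the kernel of \<open>alpha\<close> exactly
      because the tidal tensor annihilates the spray. It is then lifted to \<open>Lam\<close> by a
      vertical correction along \<open>e\<close>.\<close>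
    have "(k - 1) * D G z (0, y) = tid z X (snd z, 0)"
      using g_radial[OF z, of y] y by simp
    also have "\<dots> = 0" using tid_spray[OF z, of "(snd z, 0)"] tid_commute[OF z, of X] by simp
    finally have y0: "D G z (0, y) = 0" using k by simp
    have l: "linear (\<lambda>a. D G z (0, a))"
      using linear_compose[OF linear_Pair_zero(1) linear_Df[OF z]] by (simp add: o_def)
    let ?T = "(y, - (D G z (y, 0) / D G z (0, e)) *\<^sub>R e)"
    have "D G z ?T = D G z (y, 0) + D G z (0, - (D G z (y, 0) / D G z (0, e)) *\<^sub>R e)"
      by (rule D_split[OF z])
    also have "\<dots> = 0" unfolding linear_cmul[OF l] using e by simp
    finally have "?T \<in> Lam S G z" using y0 by (simp add: Lam_eq)
    moreover have "g_h G z ?T Y = tidal k G z X Y" for Y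
      unfolding gh td using y tid_horizontal[OF z, of X Y] tid_horizontal[OF z, of X "(fst Y, 0)"] by simp
    ultimately show ?thesis by blast
  qed
qed

end

end

section \<open>Comparison of the Weyl tensors at a point of the zero set\<close>

context conic_pair
begin

context
  fixes z S
  assumes z: "z \<in> W" and G0: "G z = 0" and S: "S \<inter> W = {y \<in> W. G y = 0}"
begin

lemma
  shows D_G'_e: "D G' z (0, e) \<noteq> 0" and S': "S \<inter> W = {y \<in> W. G' y = 0}" and G0': "G' z = 0"
  using D_G'[OF z G0] J_nonzero[OF z G0] e[OF z] S zero_iff z G0 by auto

lemma Lam_conformal: "Lam S G' z = Lam S G z"
  unfolding c1.Lam_eq[OF z G0 S e[OF z]] c2.Lam_eq[OF z G0' S' D_G'_e]
  using D_G'[OF z G0] J_nonzero[OF z G0] by auto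

lemma umbral_ker_conformal: "umbral_ker S G' z = umbral_ker S G z"
  unfolding c1.umbral_ker_eq[OF z G0 S e[OF z]] c2.umbral_ker_eq[OF z G0' S' D_G'_e] Lam_conformal ..

lemma umbral_conformal: "umbral S G' z = umbral S G z"
  unfolding umbral_def Lam_conformal umbral_ker_conformal ..

lemma g_h_conformal:
  assumes "X \<in> Lam S G z" "Y \<in> Lam S G z"
  shows "g_h G' z X Y = J z * g_h G z X Y"
  using assms unfolding c1.g_h_eq[OF z] c2.g_h_eq[OF z] g'_eq[OF z G0] c1.Lam_eq[OF z G0 S e[OF z]]
  by simp

lemma tidal_conformal:
  obtains c where "\<And>X Y. X \<in> Lam S G z \<Longrightarrow> Y \<in> Lam S G z \<Longrightarrow>
    tidal p G' z X Y = J z * tidal k G z X Y + c * g_h G z X Y"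
proof -
  define c where "c = 1/4 * (f z)\<^sup>2 * J z - 1/2 * D f z (c2.V z) * J z"
  have diag: "tidal p G' z X X = J z * tidal k G z X X + c * g_h G z X X" if "X \<in> Lam S G z" for X
    using that tid'_eq[OF z G0, of X] c1.Lam_eq[OF z G0 S e[OF z]]
    by (simp add: c1.tidal_eq[OF z] c2.tidal_eq[OF z] c1.g_h_eq[OF z] c_def)
  interpret a: quotient_forms "umbral_ker S G z" "Lam S G z" "g_h G z" "tidal k G z"
    by (rule c1.quotient_forms_umbral[OF z G0 S e[OF z]])
  interpret b: quotient_forms "umbral_ker S G' z" "Lam S G' z" "g_h G' z" "tidal p G' z"
    by (rule c2.quotient_forms_umbral[OF z G0' S' D_G'_e])
  note bl = bilinear_ladd[OF a.bil_g] bilinear_radd[OF a.bil_g] bilinear_ladd[OF a.bil_s] bilinear_radd[OF a.bil_s]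
    bilinear_ladd[OF b.bil_s] bilinear_radd[OF b.bil_s]
  show thesis
  proof (rule that)
    fix X Y assume X: "X \<in> Lam S G z" and Y: "Y \<in> Lam S G z"
    \<comment> \<open>Polarization: both sides are symmetric bilinear forms that agree on the
      diagonal.\<close>
    have "2 * tidal p G' z X Y = 2 * (J z * tidal k G z X Y + c * g_h G z X Y)"
      using diag[OF subspace_add[OF a.L X Y]] diag[OF X] diag[OF Y]
        a.g_sym[of Y X] a.s_sym[of Y X] b.s_sym[of Y X]
      by (simp add: bl algebra_simps)
    then show "tidal p G' z X Y = J z * tidal k G z X Y + c * g_h G z X Y" by simp
  qed
qed

lemma weyl_conformal:
  assumes n: "CARD('n) \<ge> 3" and C: "C \<in> umbral S G z" "C' \<in> umbral S G z"
  shows "g_E G' z C C' = J z * g_E G z C C'"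
    and "weyl S p G' z C C' = J z * weyl S k G z C C'"
proof -
  obtain c where td: "\<And>X Y. X \<in> Lam S G z \<Longrightarrow> Y \<in> Lam S G z \<Longrightarrow>
    tidal p G' z X Y = J z * tidal k G z X Y + c * g_h G z X Y"
    using tidal_conformal by blast
  interpret a: quotient_forms "umbral_ker S G z" "Lam S G z" "g_h G z" "tidal k G z"
    by (rule c1.quotient_forms_umbral[OF z G0 S e[OF z]])
  interpret b: quotient_forms "umbral_ker S G z" "Lam S G z" "g_h G' z" "tidal p G' z"
    using c2.quotient_forms_umbral[OF z G0' S' D_G'_e] unfolding Lam_conformal umbral_ker_conformal .
  obtain X Y where XY: "X \<in> Lam S G z" "Y \<in> Lam S G z" "C = X +o umbral_ker S G z" "C' = Y +o umbral_ker S G z"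
    using C by (auto simp: umbral_def quot_def)
  have gE: "g_E G z C C' = g_h G z X Y" "g_E G' z C C' = J z * g_h G z X Y"
    and sE: "S_E k G z C C' = tidal k G z X Y"
      "S_E p G' z C C' = J z * tidal k G z X Y + c * g_h G z X Y"
    unfolding g_E_def S_E_def XY(3,4)
    using XY(1,2) by (simp_all add: a.descend_g b.descend_g a.descend_s b.descend_s g_h_conformal td)
  show "g_E G' z C C' = J z * g_E G z C C'" unfolding gE ..
  have dims: "real (dim (Lam S G z)) - real (dim (umbral_ker S G z)) = real CARD('n) - 2"
    using c1.dim_Lam(2)[OF z G0 S e[OF z]] c1.dim_umbral_ker(2)[OF z G0 S e[OF z]] by linarith
  have tr: "quot_trace (Lam S G z) (umbral_ker S G z) (S_sharp S p G' z)
    = quot_trace (Lam S G z) (umbral_ker S G z) (S_sharp S k G z) + (c / J z) * (real CARD('n) - 2)"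
    unfolding S_sharp_def g_E_def S_E_def umbral_conformal dims[symmetric]
    unfolding umbral_def
    by (rule quot_trace_conformal[OF a.quotient_forms_axioms b.quotient_forms_axioms
          J_nonzero[OF z G0] g_h_conformal td])
  \<comment> \<open>The trace changes by \<open>c / J\<close> times \<open>n - 2\<close>; dividing
    by this nonzero rank makes the multiple of the metric cancel exactly.\<close>
  have "real CARD('n) - 2 \<noteq> 0" using n by linarith
  then show "weyl S p G' z C C' = J z * weyl S k G z C C'"
    unfolding weyl_def gE sE Lam_conformal umbral_ker_conformal tr
    using J_nonzero[OF z G0] by (simp add: field_simps)
qed

end

end

section \<open>Passage from the slit tangent bundle to an induced chart\<close>

lemma tchart_inj:
  assumes A: "smooth_atlas A" and c: "c \<in> A"
  shows "inj_on (tchart c) (tdom A c)"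
proof (rule inj_onI)
  fix y z assume y: "y \<in> tdom A c" and z: "z \<in> tdom A c" and eq: "tchart c y = tchart c z"
  have "inj_on (snd c) (fst c)"
    using A c unfolding smooth_atlas_def homeomorphism_def by (metis inj_on_inverseI)
  moreover have "snd c (fst y) = snd c (fst z)" "snd y c = snd z c" using eq by (auto simp: tchart_def)
  moreover have "fst y \<in> fst c" "fst z \<in> fst c" using y z by (auto simp: tdom_def)
  ultimately have p: "fst y = fst z" by (auto dest: inj_onD)
  have tv: "snd y \<in> tangent_vectors A (fst z)" "snd z \<in> tangent_vectors A (fst z)"
    using y z p by (auto simp: tdom_def slit_tangent_bundle_def)
  \<comment> \<open>The component in the chart \<open>c\<close> determines the others through the
    Jacobians of the transition maps; at charts not around the point both families are 0.\<close>
  have "snd y d = snd z d" for d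
  proof (cases "d \<in> A \<and> fst z \<in> fst d")
    case True
    then have "fst z \<in> fst c \<inter> fst d" using \<open>fst z \<in> fst c\<close> by blast
    moreover have "\<xi> d = D (transition c d) (snd c (fst z)) (\<xi> c)"
      if "\<xi> \<in> tangent_vectors A (fst z)" "fst z \<in> fst c \<inter> fst d" for \<xi>
      using that True c unfolding tangent_vectors_def by blast
    ultimately show ?thesis using tv \<open>snd y c = snd z c\<close> by metis
  next
    case False
    then have "\<xi> d = 0" if "\<xi> \<in> tangent_vectors A (fst z)" for \<xi>
      using that unfolding tangent_vectors_def by blast
    then show ?thesis using tv by metis
  qed
  then show "y = z" using p by (simp add: prod_eq_iff ext)
qed

lemma coord_rep_tchart:
  "smooth_atlas A \<Longrightarrow> c \<in> A \<Longrightarrow> z \<in> tdom A c \<Longrightarrow> coord_rep A c f (tchart c z) = f z"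
  by (simp add: coord_rep_def tchart_inj)

lemma tchart_in_coord_set:
  "smooth_atlas A \<Longrightarrow> c \<in> A \<Longrightarrow> z \<in> tdom A c \<Longrightarrow> tchart c z \<in> coord_set A c U \<longleftrightarrow> z \<in> U"
  using inj_on_image_mem_iff[OF tchart_inj, of A c z "U \<inter> tdom A c"] by (auto simp: coord_set_def)

lemma coord_setE:
  assumes "w \<in> coord_set A c U"
  obtains z where "z \<in> U" "z \<in> tdom A c" "w = tchart c z"
  using assms by (auto simp: coord_set_def)

lemma coord_euler:
  assumes A: "smooth_atlas A" and c: "c \<in> A" and G: "defining_function A H U k G"
    and w: "w \<in> coord_set A c U"
  shows "D (coord_rep A c G) w (0, snd w) = k * coord_rep A c G w"
proof -
  let ?g = "coord_rep A c G"
  obtain z where z: "z \<in> U" "z \<in> tdom A c" "w = tchart c z" using w by (rule coord_setE)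
  have Us: "U \<subseteq> slit_tangent_bundle A" and inv: "scale_invariant U" and hom: "homogeneous_on U k G"
    and sm: "smooth_on (coord_set A c U) ?g"
    using G c by (auto simp: defining_function_def tm_open_def tm_smooth_on_def)
  \<comment> \<open>The ray through \<open>w\<close> is parametrized so that \<open>w\<close> is at
    \<open>t = 1\<close>; the origin \<open>(fst w, 0)\<close> of the line is never evaluated, as
    the derivative is taken at 1.\<close>
  have eq: "?g ((fst w, 0) + t *\<^sub>R (0, snd w)) = t powr k * ?g w" if t: "t > 0" for t
  proof -
    have "fibre_scale t z \<in> U" using inv z t by (auto simp: scale_invariant_def)
    moreover from this have "fibre_scale t z \<in> tdom A c" using Us z by (auto simp: tdom_def fibre_scale_def)
    moreover have "tchart c (fibre_scale t z) = (fst w, 0) + t *\<^sub>R (0, snd w)"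
      by (simp add: z(3) tchart_def fibre_scale_def)
    ultimately show ?thesis
      using coord_rep_tchart[OF A c, of "fibre_scale t z" G] coord_rep_tchart[OF A c z(2), of G] hom z t
      by (auto simp: homogeneous_on_def)
  qed
  have "((\<lambda>t. ?g ((fst w, 0) + t *\<^sub>R (0, snd w))) has_derivative (\<lambda>h. h *\<^sub>R D ?g ((fst w, 0) + 1 *\<^sub>R (0, snd w)) (0, snd w))) (at 1)"
    by (rule D_along_line[OF sm]) (use w in simp)
  then have "((\<lambda>t. ?g ((fst w, 0) + t *\<^sub>R (0, snd w))) has_derivative (\<lambda>h. h * D ?g w (0, snd w))) (at 1)"
    by simp
  then have "((\<lambda>t. t powr k * ?g w) has_derivative (\<lambda>h. h * D ?g w (0, snd w))) (at 1)"
    by (rule has_derivative_transform_within_open[where s = "{0<..}"]) (auto simp: eq simp del: scaleR_Pair add_Pair)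
  then have "((\<lambda>t. t powr k * ?g w) has_real_derivative D ?g w (0, snd w)) (at 1)"
    by (simp add: has_field_derivative_def mult.commute[of _ "D ?g w _"])
  moreover have "((\<lambda>t. t powr k * ?g w) has_real_derivative k * ?g w) (at 1)"
    by (auto intro!: derivative_eq_intros)
  ultimately show ?thesis by (rule DERIV_unique)
qed

lemma conic_function_coord:
  assumes A: "smooth_atlas A" and c: "c \<in> A" and G: "defining_function A H U k G"
    and W: "open W" "W \<subseteq> coord_set A c U"
  shows "conic_function W (coord_rep A c G) k"
proof
  show "open W" by (rule W)
  have "smooth_on (coord_set A c U) (coord_rep A c G)"
    using G c by (auto simp: defining_function_def tm_smooth_on_def)
  then show "smooth_on W (coord_rep A c G)" using W smooth_on_subset by blast
  show "D (coord_rep A c G) z (0, snd z) = k * coord_rep A c G z" if "z \<in> W" for z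
    using coord_euler[OF A c G] W that by blast
  show "k \<noteq> 1" using G by (simp add: defining_function_def)
  show "invertible (vhess (coord_rep A c G) z)" if "z \<in> W" for z
    using G c W that by (auto simp: defining_function_def)
qed

theorem theorem6:
  fixes A :: "('m::{t2_space, second_countable_topology}, 'n::finite) chart set"
    and H U U' :: "('m, 'n) tpoint set"
    and G G' :: "('m, 'n) tpoint \<Rightarrow> real"
    and k p :: real
  assumes "CARD('n) \<ge> 3"
    and "smooth_atlas A"
    and "conic_hypersurface A H"
    and "defining_function A H U k G"
    and "defining_function A H U' p G'"
  shows "\<forall>z \<in> H \<inter> U \<inter> U'. \<forall>c\<in>A. fst z \<in> fst c \<longrightarrow>
    (let w = tchart c z;
         S = coord_set A c H;
         g = coord_rep A c G;
         g' = coord_rep A c G';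
         E = umbral S g w
     in umbral S g' w = E \<and>
        (\<forall>C\<in>E. weyl_sharp S p g' w C = weyl_sharp S k g w C) \<and>
        (\<exists>r. r \<noteq> 0 \<and>
           (\<forall>C\<in>E. \<forall>D\<in>E. g_E g' w C D = r * g_E g w C D \<and>
                         weyl S p g' w C D = r * weyl S k g w C D)) \<and>
        (\<forall>Q q J. generalized_conformal A U k G U' p G' Q q J \<longrightarrow>
           (\<forall>C\<in>E. \<forall>D\<in>E. g_E g' w C D = J z * g_E g w C D \<and>
                         weyl S p g' w C D = J z * weyl S k g w C D)))"
proof (intro ballI impI)
  fix z c assume zH: "z \<in> H \<inter> U \<inter> U'" and c: "c \<in> A" and zc: "fst z \<in> fst c"
  note A = assms(2) and defG = assms(4) and defG' = assms(5)
  define w where "w = tchart c z"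
  define S where "S = coord_set A c H"
  define g where "g = coord_rep A c G"
  define g' where "g' = coord_rep A c G'"
  define E where "E = umbral S g w"
  have zd: "z \<in> tdom A c"
    using zH zc defG by (auto simp: tdom_def defining_function_def tm_open_def)
  have wU: "w \<in> coord_set A c U" "w \<in> coord_set A c U'"
    using zH by (auto simp: w_def tchart_in_coord_set[OF A c zd])
  have opens: "open (coord_set A c U)" "open (coord_set A c U')"
    using defG defG' c by (auto simp: defining_function_def tm_open_def)
  have smg: "smooth_on (coord_set A c U) g"
    using defG c by (auto simp: defining_function_def tm_smooth_on_def g_def)
  obtain i where i: "D g w (0, axis i 1) \<noteq> 0"
    using defG c wU(1) unfolding defining_function_def dv_def g_def by blast
  define e :: "real ^ 'n" where "e = axis i 1"
  \<comment> \<open>A neighbourhood of \<open>w\<close> on which both functions are defined and the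
    derivative of \<open>g\<close> along the one coordinate direction \<open>e\<close> stays
    nonzero, as \<open>conic_pair\<close> demands.\<close>
  define W where "W = (coord_set A c U \<inter> (\<lambda>y. D g y (0, e)) -` (- {0})) \<inter> coord_set A c U'"
  have "open W"
    unfolding W_def
    by (rule open_Int[OF continuous_open_preimage[OF smooth_on_continuous[OF smooth_on_D[OF smg]]
            opens(1) open_Compl[OF closed_singleton]] opens(2)])
  have wW: "w \<in> W" using wU i by (simp add: W_def e_def)
  have pt: "\<exists>y'. y' \<in> U \<and> y' \<in> U' \<and> y' \<in> tdom A c \<and> y = tchart c y'" if "y \<in> W" for y
  proof -
    have yU: "y \<in> coord_set A c U" "y \<in> coord_set A c U'" using that by (auto simp: W_def)
    obtain y' where y': "y' \<in> U" "y' \<in> tdom A c" "y = tchart c y'" using yU(1) by (rule coord_setE)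
    then have "y' \<in> U'" using yU(2) tchart_in_coord_set[OF A c y'(2)] by blast
    then show ?thesis using y' by blast
  qed
  have zeroH: "g y = 0 \<longleftrightarrow> y \<in> S" "g' y = 0 \<longleftrightarrow> y \<in> S" if "y \<in> W" for y
  proof -
    obtain y' where y': "y' \<in> U" "y' \<in> U'" "y' \<in> tdom A c" "y = tchart c y'" using pt \<open>y \<in> W\<close> by blast
    have "G y' = 0 \<longleftrightarrow> y' \<in> H" "G' y' = 0 \<longleftrightarrow> y' \<in> H"
      using y' defG defG' by (auto simp: defining_function_def)
    then show "g y = 0 \<longleftrightarrow> y \<in> S" "g' y = 0 \<longleftrightarrow> y \<in> S"
      by (simp_all add: g_def g'_def S_def y'(4) coord_rep_tchart[OF A c y'(3)] tchart_in_coord_set[OF A c y'(3)])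
  qed
  interpret a: conic_function W g k
    unfolding g_def by (rule conic_function_coord[OF A c defG \<open>open W\<close>]) (auto simp: W_def)
  interpret b: conic_function W g' p
    unfolding g'_def by (rule conic_function_coord[OF A c defG' \<open>open W\<close>]) (auto simp: W_def)
  interpret conic_pair W g g' k p e
    by unfold_locales (use zeroH in \<open>auto simp: W_def\<close>)
  have S: "S \<inter> W = {y \<in> W. g y = 0}" using zeroH by auto
  have g0: "g w = 0" using zeroH(1)[OF wW] zH by (simp add: S_def w_def tchart_in_coord_set[OF A c zd])
  define r where "r = J w"
  have r0: "r \<noteq> 0" unfolding r_def by (rule J_nonzero[OF wW g0])
  have umb: "umbral S g' w = E"
    unfolding E_def by (rule umbral_conformal[OF wW g0 S])
  have conf: "g_E g' w C C' = r * g_E g w C C'" "weyl S p g' w C C' = r * weyl S k g w C C'"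
    if "C \<in> E" "C' \<in> E" for C C'
    using weyl_conformal[OF wW g0 S assms(1), of C C'] that by (auto simp: r_def E_def)
  have sharp: "weyl_sharp S p g' w C = weyl_sharp S k g w C" if C: "C \<in> E" for C
  proof -
    \<comment> \<open>Both sides of the equation characterizing the raised vector carry the same
      nonzero factor \<open>r\<close>, so the two characterizations coincide.\<close>
    have "(C' \<in> E \<and> (\<forall>D\<in>E. g_E g' w C' D = weyl S p g' w C D))
      \<longleftrightarrow> (C' \<in> E \<and> (\<forall>D\<in>E. g_E g w C' D = weyl S k g w C D))" for C'
      using conf C r0 by auto
    then show ?thesis by (simp add: weyl_sharp_def raise_def umb E_def[symmetric])
  qed
  \<comment> \<open>A factor given by a generalized conformal transformation satisfies
    \<open>g' = j g\<close> near \<open>w\<close>. As \<open>g\<close> vanishes at \<open>w\<close>,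
    the product rule leaves \<open>j w\<close> times the derivative of \<open>g\<close>, so it
    coincides with the quotient of derivatives.\<close>
  have rJ: "r = Jf z" if gc: "generalized_conformal A U k G U' p G' Q q Jf" for Q q Jf
  proof -
    define j where "j = coord_rep A c Jf"
    have "G z = 0" using zH defG by (auto simp: defining_function_def)
    then have zQ: "z \<in> Q" using gc zH by (auto simp: generalized_conformal_def)
    have smj: "smooth_on (coord_set A c Q) j" and oQ: "open (coord_set A c Q)"
      using gc c by (auto simp: generalized_conformal_def tm_smooth_on_def tm_open_def j_def)
    define R where "R = W \<inter> coord_set A c Q"
    have oR: "open R" using oQ \<open>open W\<close> by (auto simp: R_def)
    have wR: "w \<in> R" using wW zQ by (simp add: R_def w_def tchart_in_coord_set[OF A c zd])
    have "g' y = j y * g y" if y: "y \<in> R" for y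
    proof -
      have "y \<in> coord_set A c Q" using y by (simp add: R_def)
      then obtain y' where y': "y' \<in> Q" "y' \<in> tdom A c" "y = tchart c y'" by (rule coord_setE)
      have "G y' = G' y' * inverse (Jf y')" "Jf y' \<noteq> 0"
        using gc y' by (auto simp: generalized_conformal_def)
      then show ?thesis
        by (simp add: g_def g'_def j_def y'(3) coord_rep_tchart[OF A c y'(2)])
    qed
    then have "D g' w = D (\<lambda>y. j y * g y) w"
      by (rule D_cong_open[OF oR wR])
    then have "D g' w (0, e) = D (\<lambda>y. j y * g y) w (0, e)" by simp
    also have "\<dots> = j w * D g w (0, e) + D j w (0, e) * g w"
      by (rule D_mult[OF smooth_on_subset[OF smj] smooth_on_subset[OF a.smooth_f] wR]) (auto simp: R_def)
    finally have "r = j w" using g0 e[OF wW] by (simp add: r_def J_def)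
    then show ?thesis by (simp add: j_def w_def coord_rep_tchart[OF A c zd])
  qed
  show "let w = tchart c z;
         S = coord_set A c H;
         g = coord_rep A c G;
         g' = coord_rep A c G';
         E = umbral S g w
     in umbral S g' w = E \<and>
        (\<forall>C\<in>E. weyl_sharp S p g' w C = weyl_sharp S k g w C) \<and>
        (\<exists>r. r \<noteq> 0 \<and>
           (\<forall>C\<in>E. \<forall>D\<in>E. g_E g' w C D = r * g_E g w C D \<and>
                         weyl S p g' w C D = r * weyl S k g w C D)) \<and>
        (\<forall>Q q J. generalized_conformal A U k G U' p G' Q q J \<longrightarrow>
           (\<forall>C\<in>E. \<forall>D\<in>E. g_E g' w C D = J z * g_E g w C D \<and>
                         weyl S p g' w C D = J z * weyl S k g w C D))"
    unfolding Let_def w_def[symmetric] S_def[symmetric] g_def[symmetric] g'_def[symmetric] E_def[symmetric]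
  proof (intro conjI ballI allI impI)
    show "umbral S g' w = E" by (rule umb)
    show "weyl_sharp S p g' w C = weyl_sharp S k g w C" if "C \<in> E" for C by (rule sharp[OF that])
    show "\<exists>r. r \<noteq> 0 \<and> (\<forall>C\<in>E. \<forall>D\<in>E. g_E g' w C D = r * g_E g w C D \<and>
      weyl S p g' w C D = r * weyl S k g w C D)"
      using r0 conf by (intro exI[of _ r]) simp
    fix Q q Jf C C' assume "generalized_conformal A U k G U' p G' Q q Jf" and C: "C \<in> E" "C' \<in> E"
    then have "r = Jf z" by (intro rJ)
    then show "g_E g' w C C' = Jf z * g_E g w C C'" "weyl S p g' w C C' = Jf z * weyl S k g w C C'"
      using conf[OF C] by simp_all
  qed
qed

end
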